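(* Let $\mathbf{k}$ be a field of characteristic $p>0$, let $\mathrm{A}$ be a graded ($\mathbf{k}$-linear, small) category and let $s\in\mathbb{Z}$. Then $$\mathrm{A}^{\mathrm{A}}=K_{0,s}\mathrm{A}\supseteq K_{1,s}\mathrm{A}\supseteq\dots\supseteq K_{r,s}\mathrm{A}\supseteq\dots\supseteq R_s\mathrm{A}$$ is a decreasing sequence of graded ideals of the graded algebra $\mathrm{A}^{\mathrm{A}}$. In particular, $$\mathrm{A}^{\mathrm{A}}=K_0\mathrm{A}\supseteq K_1\mathrm{A}\supseteq\dots\supseteq K_r\mathrm{A}\supseteq\dots\supseteq R\mathrm{A}$$ is a decreasing sequence of graded ideals. Moreover, if $F:\mathrm{A}\rightarrow\mathrm{A}'$ is a degree preserving equivalence of graded categories, then $F$ induces an isomorphism of graded algebras $\varphi_F:\mathrm{A}^{\mathrm{A}}\rightarrow(\mathrm{A}')^{\mathrm{A}'}$ such that $\varphi_F(K_{r,s}\mathrm{A})=K_{r,s}\mathrm{A}'$ for all $r\geq 0$ and $s\in\mathbb{Z}$.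
   Context: All categories are small and $\mathbf{k}$-linear. Write $\mathrm{A}_x^y=\mathrm{Hom}_{\mathrm{A}}(x,y)$; $fg$ means $f$ after $g$. A graded category is a category with decompositions $\mathrm{A}_x^y=\oplus_{i\in\mathbb{Z}}(\mathrm{A}_x^y)_i$ such that composing morphisms of degrees $i$ and $j$ gives a morphism of degree $i+j$. Center: $\mathrm{A}^{\mathrm{A}}=\oplus_{i}\mathrm{A}^{\mathrm{A}}_i$, where $\mathrm{A}^{\mathrm{A}}_i$ consists of the families $(m_x)_{x\in\mathrm{A}}\in\prod_{x}(\mathrm{A}_x^x)_i$ with $fm_x=(-1)^{ij}m_yf$ for all $x,y\in\mathrm{A}$, $f\in(\mathrm{A}_x^y)_j$. It is a graded algebra under objectwise composition. Abelianization: $[\mathrm{A},\mathrm{A}]\subseteq\oplus_x\mathrm{A}_x^x$ is the subspace spanned by the elements $fu-(-1)^{ij}uf$ for $x,y\in\mathrm{A}$, $u\in(\mathrm{A}_x^y)_i$, $f\in(\mathrm{A}_y^x)_j$, and $\mathrm{A}_{\mathrm{A}}=\oplus_x\mathrm{A}_x^x/[\mathrm{A},\mathrm{A}]$, which is a graded $\mathrm{A}^{\mathrm{A}}$-bimodule via composition. The map $\xi_p:\oplus_x\mathrm{A}_x^x\to\oplus_x\mathrm{A}_x^x$, $\xi_p(\sum_n f_n)=\sum_n f_n^p$ (with $f_n$ the degree $n$ component, and powers taken in the possibly non-unital algebra $\oplus_x\mathrm{A}_x^x$) induces a well-defined map $\xi_p:\mathrm{A}_{\mathrm{A}}\to\mathrm{A}_{\mathrm{A}}$.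 Let $T_r\mathrm{A}\subseteq\mathrm{A}_{\mathrm{A}}$ be the kernel of $\xi_p^r$ (a graded subspace). Define the graded subspace $K_{r,s}\mathrm{A}\subseteq\mathrm{A}^{\mathrm{A}}$ by $$(K_{r,s}\mathrm{A})_n=\{a\in\mathrm{A}^{\mathrm{A}}_n\mid a\,(T_r\mathrm{A})_{s-n}=(T_r\mathrm{A})_{s-n}\,a=0\}.$$ Also $K_r\mathrm{A}=\cap_{s\in\mathbb{Z}}K_{r,s}\mathrm{A}$ (the annihilator of $T_r\mathrm{A}$ in $\mathrm{A}^{\mathrm{A}}$), $R_s\mathrm{A}=\cap_{r\ge0}K_{r,s}\mathrm{A}$, $R\mathrm{A}=\cap_{r\ge0}K_r\mathrm{A}$. A functor $F:\mathrm{A}\to\mathrm{A}'$ is a degree preserving equivalence if it induces isomorphisms of graded spaces $\mathrm{A}_x^y\to(\mathrm{A}')_{Fx}^{Fy}$ for all $x,y\in\mathrm{A}$ and for every $x'\in\mathrm{A}'$ there are $x\in\mathrm{A}$ and an isomorphism $x'\to Fx$ in $\mathrm{A}'$ of degree zero. The induced map $\varphi_F$ is the one characterized by $\varphi_F(f)_{Fx}=F(f_x)$ for all $x\in\mathrm{A}$; equivalently $\varphi_F(f)_{x'}=\beta_{x'}^{-1}F(f_{F'x'})\beta_{x'}$ for a quasi-inverse $F'$ and a natural isomorphism $\beta:\mathrm{Id}_{\mathrm{A}'}\to FF'$ with degree zero components. *)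

theory Defs
  imports Complex_Main "HOL-Library.Function_Algebras" "HOL-Algebra.QuotRing"
begin

definition graded_sum :: "(int \<Rightarrow> 'a::ab_group_add set) \<Rightarrow> 'a set" where
  "graded_sum G = {(\<Sum>i | c i \<noteq> 0. c i) | c. (\<forall>i. c i \<in> G i) \<and> finite {i. c i \<noteq> 0}}"

definition decomposes :: "(int \<Rightarrow> 'a::ab_group_add set) \<Rightarrow> 'a \<Rightarrow> (int \<Rightarrow> 'a) \<Rightarrow> bool" where
  "decomposes G v c \<longleftrightarrow>
     (\<forall>i. c i \<in> G i) \<and> finite {i. c i \<noteq> 0} \<and> v = (\<Sum>i | c i \<noteq> 0. c i)"

text \<open>\<^term>\<open>V\<close> is the (internal) direct sum of the subspaces \<^term>\<open>G i\<close>.\<close>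

definition is_grading :: "('k::field \<Rightarrow> 'a::ab_group_add \<Rightarrow> 'a) \<Rightarrow> (int \<Rightarrow> 'a set) \<Rightarrow> 'a set \<Rightarrow> bool" where
  "is_grading sc G V \<longleftrightarrow>
     module.subspace sc V \<and> (\<forall>i. module.subspace sc (G i)) \<and>
     V = graded_sum G \<and> (\<forall>v\<in>V. \<exists>!c. decomposes G v c)"

definition component :: "(int \<Rightarrow> 'a::ab_group_add set) \<Rightarrow> 'a \<Rightarrow> int \<Rightarrow> 'a" where
  "component G v = (THE c. decomposes G v c)"

definition graded_algebra ::
  "('k::field \<Rightarrow> 'a::ab_group_add \<Rightarrow> 'a) \<Rightarrow> (int \<Rightarrow> 'a set) \<Rightarrow> 'a ring \<Rightarrow> bool" where
  "graded_algebra sc G R \<longleftrightarrow>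
     vector_space sc \<and> ring R \<and> add R = (+) \<and> zero R = 0 \<and>
     is_grading sc G (carrier R) \<and>
     (\<forall>c. \<forall>a\<in>carrier R. \<forall>b\<in>carrier R.
        sc c a \<otimes>\<^bsub>R\<^esub> b = sc c (a \<otimes>\<^bsub>R\<^esub> b) \<and> a \<otimes>\<^bsub>R\<^esub> sc c b = sc c (a \<otimes>\<^bsub>R\<^esub> b)) \<and>
     \<one>\<^bsub>R\<^esub> \<in> G 0 \<and>
     (\<forall>i j. \<forall>a\<in>G i. \<forall>b\<in>G j. a \<otimes>\<^bsub>R\<^esub> b \<in> G (i + j))"

definition graded_ideal ::
  "('k::field \<Rightarrow> 'a::ab_group_add \<Rightarrow> 'a) \<Rightarrow> (int \<Rightarrow> 'a set) \<Rightarrow> 'a ring \<Rightarrow> 'a set \<Rightarrow> bool" where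
  "graded_ideal sc G R I \<longleftrightarrow>
     ideal I R \<and> module.subspace sc I \<and> I = graded_sum (\<lambda>i. I \<inter> G i)"

definition graded_algebra_iso ::
  "('k::field \<Rightarrow> 'a::ab_group_add \<Rightarrow> 'a) \<Rightarrow> (int \<Rightarrow> 'a set) \<Rightarrow> 'a ring \<Rightarrow>
   ('k \<Rightarrow> 'b::ab_group_add \<Rightarrow> 'b) \<Rightarrow> (int \<Rightarrow> 'b set) \<Rightarrow> 'b ring \<Rightarrow> ('a \<Rightarrow> 'b) \<Rightarrow> bool" where
  "graded_algebra_iso sc G R sc' G' R' h \<longleftrightarrow>
     h \<in> ring_iso R R' \<and>
     (\<forall>c. \<forall>a\<in>carrier R. h (sc c a) = sc' c (h a)) \<and>
     (\<forall>i. h ` G i = G' i)"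

text \<open>
  The morphism spaces \<open>Hom A x y\<close> (morphisms from \<open>x\<close> to \<open>y\<close>) are subspaces of one ambient
  vector space \<open>'m\<close>. They need not be disjoint or independent, which is why composition carries
  its three objects: \<open>cmp A x y z g f\<close> is \<open>g\<close> after \<open>f\<close> for \<open>f\<close> from \<open>x\<close> to \<open>y\<close> and \<open>g\<close> from
  \<open>y\<close> to \<open>z\<close>. This is no restriction, since any family of vector spaces embeds in its direct sum.
\<close>

record ('k, 'o, 'm) gcat =
  Obj :: "'o set"
  Hom :: "'o \<Rightarrow> 'o \<Rightarrow> 'm set"
  Hom_deg :: "'o \<Rightarrow> 'o \<Rightarrow> int \<Rightarrow> 'm set"
  cmp :: "'o \<Rightarrow> 'o \<Rightarrow> 'o \<Rightarrow> 'm \<Rightarrow> 'm \<Rightarrow> 'm"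
  idn :: "'o \<Rightarrow> 'm"
  scl :: "'k \<Rightarrow> 'm \<Rightarrow> 'm"

definition linear_category :: "('k::field, 'o, 'm::ab_group_add) gcat \<Rightarrow> bool" where
  "linear_category A \<longleftrightarrow>
     vector_space (scl A) \<and>
     (\<forall>x\<in>Obj A. \<forall>y\<in>Obj A. module.subspace (scl A) (Hom A x y)) \<and>
     (\<forall>x\<in>Obj A. \<forall>y\<in>Obj A. \<forall>z\<in>Obj A. \<forall>f\<in>Hom A x y. \<forall>g\<in>Hom A y z.
        cmp A x y z g f \<in> Hom A x z \<and>
        (\<forall>f'\<in>Hom A x y. cmp A x y z g (f + f') = cmp A x y z g f + cmp A x y z g f') \<and>
        (\<forall>g'\<in>Hom A y z. cmp A x y z (g + g') f = cmp A x y z g f + cmp A x y z g' f) \<and>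
        (\<forall>c. cmp A x y z g (scl A c f) = scl A c (cmp A x y z g f) \<and>
             cmp A x y z (scl A c g) f = scl A c (cmp A x y z g f))) \<and>
     (\<forall>x\<in>Obj A. idn A x \<in> Hom A x x) \<and>
     (\<forall>x\<in>Obj A. \<forall>y\<in>Obj A. \<forall>f\<in>Hom A x y.
        cmp A x x y f (idn A x) = f \<and> cmp A x y y (idn A y) f = f) \<and>
     (\<forall>w\<in>Obj A. \<forall>x\<in>Obj A. \<forall>y\<in>Obj A. \<forall>z\<in>Obj A.
        \<forall>f\<in>Hom A w x. \<forall>g\<in>Hom A x y. \<forall>h\<in>Hom A y z.
        cmp A w y z h (cmp A w x y g f) = cmp A w x z (cmp A x y z h g) f)"

definition graded_category :: "('k::field, 'o, 'm::ab_group_add) gcat \<Rightarrow> bool" where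
  "graded_category A \<longleftrightarrow>
     linear_category A \<and>
     (\<forall>x\<in>Obj A. \<forall>y\<in>Obj A. is_grading (scl A) (Hom_deg A x y) (Hom A x y)) \<and>
     (\<forall>x\<in>Obj A. \<forall>y\<in>Obj A. \<forall>z\<in>Obj A. \<forall>i j. \<forall>f\<in>Hom_deg A x y i. \<forall>g\<in>Hom_deg A y z j.
        cmp A x y z g f \<in> Hom_deg A x z (i + j))"

definition koszul :: "int \<Rightarrow> int \<Rightarrow> 'k::field" where
  "koszul i j = (- 1) powi (i * j)"

text \<open>Objectwise operations on families of endomorphisms. Families are normalised to vanish
  outside \<^term>\<open>Obj A\<close>.\<close>

definition fscl :: "('k::field, 'o, 'm::ab_group_add) gcat \<Rightarrow> 'k \<Rightarrow> ('o \<Rightarrow> 'm) \<Rightarrow> 'o \<Rightarrow> 'm" where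
  "fscl A c m = (\<lambda>x. scl A c (m x))"

definition fmult :: "('k::field, 'o, 'm::ab_group_add) gcat \<Rightarrow> ('o \<Rightarrow> 'm) \<Rightarrow> ('o \<Rightarrow> 'm) \<Rightarrow> 'o \<Rightarrow> 'm" where
  "fmult A m n = (\<lambda>x. if x \<in> Obj A then cmp A x x x (m x) (n x) else 0)"

definition fone :: "('k::field, 'o, 'm::ab_group_add) gcat \<Rightarrow> 'o \<Rightarrow> 'm" where
  "fone A = (\<lambda>x. if x \<in> Obj A then idn A x else 0)"

definition center_deg :: "('k::field, 'o, 'm::ab_group_add) gcat \<Rightarrow> int \<Rightarrow> ('o \<Rightarrow> 'm) set" where
  "center_deg A i = {m.
     (\<forall>x\<in>Obj A. m x \<in> Hom_deg A x x i) \<and> (\<forall>x. x \<notin> Obj A \<longrightarrow> m x = 0) \<and>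
     (\<forall>x\<in>Obj A. \<forall>y\<in>Obj A. \<forall>j. \<forall>f\<in>Hom_deg A x y j.
        cmp A x x y f (m x) = scl A (koszul i j) (cmp A x y y (m y) f))}"

text \<open>The sum over all degrees is taken inside the product of the \<^term>\<open>Hom A x x\<close>; there it is
  automatically direct.\<close>

definition center :: "('k::field, 'o, 'm::ab_group_add) gcat \<Rightarrow> ('o \<Rightarrow> 'm) set" where
  "center A = graded_sum (center_deg A)"

definition center_ring :: "('k::field, 'o, 'm::ab_group_add) gcat \<Rightarrow> ('o \<Rightarrow> 'm) ring" where
  "center_ring A =
     \<lparr>carrier = center A, mult = fmult A, one = fone A, zero = 0, add = (+)\<rparr>"

definition endo_sum :: "('k::field, 'o, 'm::ab_group_add) gcat \<Rightarrow> ('o \<Rightarrow> 'm) set" where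
  "endo_sum A = {f. finite {x. f x \<noteq> 0} \<and> (\<forall>x\<in>Obj A. f x \<in> Hom A x x) \<and>
     (\<forall>x. x \<notin> Obj A \<longrightarrow> f x = 0)}"

definition endo_sum_deg :: "('k::field, 'o, 'm::ab_group_add) gcat \<Rightarrow> int \<Rightarrow> ('o \<Rightarrow> 'm) set" where
  "endo_sum_deg A i = {f \<in> endo_sum A. \<forall>x\<in>Obj A. f x \<in> Hom_deg A x x i}"

definition at_obj :: "'o \<Rightarrow> 'm::ab_group_add \<Rightarrow> 'o \<Rightarrow> 'm" where
  "at_obj x v = (\<lambda>z. if z = x then v else 0)"

definition commutators :: "('k::field, 'o, 'm::ab_group_add) gcat \<Rightarrow> ('o \<Rightarrow> 'm) set" where
  "commutators A = module.span (fscl A)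
     {at_obj x (cmp A x y x f u) - fscl A (koszul i j) (at_obj y (cmp A y x y u f)) | x y i j u f.
        x \<in> Obj A \<and> y \<in> Obj A \<and> u \<in> Hom_deg A x y i \<and> f \<in> Hom_deg A y x j}"

definition ab_class :: "('k::field, 'o, 'm::ab_group_add) gcat \<Rightarrow> ('o \<Rightarrow> 'm) \<Rightarrow> ('o \<Rightarrow> 'm) set" where
  "ab_class A f = (\<lambda>c. f + c) ` commutators A"

definition abel :: "('k::field, 'o, 'm::ab_group_add) gcat \<Rightarrow> ('o \<Rightarrow> 'm) set set" where
  "abel A = ab_class A ` endo_sum A"

definition abel_deg :: "('k::field, 'o, 'm::ab_group_add) gcat \<Rightarrow> int \<Rightarrow> ('o \<Rightarrow> 'm) set set" where
  "abel_deg A i = ab_class A ` endo_sum_deg A i"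

text \<open>The map on classes induced by a map \<^term>\<open>h\<close> on representatives; meaningful when the class of
  \<^term>\<open>h f\<close> depends only on the class of \<^term>\<open>f\<close>.\<close>

definition induced ::
  "('k::field, 'o, 'm::ab_group_add) gcat \<Rightarrow> (('o \<Rightarrow> 'm) \<Rightarrow> 'o \<Rightarrow> 'm) \<Rightarrow> ('o \<Rightarrow> 'm) set \<Rightarrow> ('o \<Rightarrow> 'm) set" where
  "induced A h X = the_elem ((\<lambda>f. ab_class A (h f)) ` X)"

definition left_act ::
  "('k::field, 'o, 'm::ab_group_add) gcat \<Rightarrow> ('o \<Rightarrow> 'm) \<Rightarrow> ('o \<Rightarrow> 'm) set \<Rightarrow> ('o \<Rightarrow> 'm) set" where
  "left_act A a = induced A (\<lambda>f. fmult A a f)"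

definition right_act ::
  "('k::field, 'o, 'm::ab_group_add) gcat \<Rightarrow> ('o \<Rightarrow> 'm) set \<Rightarrow> ('o \<Rightarrow> 'm) \<Rightarrow> ('o \<Rightarrow> 'm) set" where
  "right_act A X a = induced A (\<lambda>f. fmult A f a) X"

definition endo_component ::
  "('k::field, 'o, 'm::ab_group_add) gcat \<Rightarrow> ('o \<Rightarrow> 'm) \<Rightarrow> int \<Rightarrow> 'o \<Rightarrow> 'm" where
  "endo_component A f n = (\<lambda>x. if x \<in> Obj A then component (Hom_deg A x x) (f x) n else 0)"

text \<open>Powers with positive exponent only: the algebra \<^term>\<open>endo_sum A\<close> need not have a unit.\<close>

definition fpower :: "('k::field, 'o, 'm::ab_group_add) gcat \<Rightarrow> ('o \<Rightarrow> 'm) \<Rightarrow> nat \<Rightarrow> 'o \<Rightarrow> 'm" where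
  "fpower A f q = (fmult A f ^^ (q - 1)) f"

definition xi ::
  "('k::field, 'o, 'm::ab_group_add) gcat \<Rightarrow> nat \<Rightarrow> ('o \<Rightarrow> 'm) \<Rightarrow> 'o \<Rightarrow> 'm" where
  "xi A p f = (\<Sum>n | endo_component A f n \<noteq> 0. fpower A (endo_component A f n) p)"

definition T :: "('k::field, 'o, 'm::ab_group_add) gcat \<Rightarrow> nat \<Rightarrow> nat \<Rightarrow> ('o \<Rightarrow> 'm) set set" where
  "T A p r = {X \<in> abel A. (induced A (xi A p) ^^ r) X = ab_class A 0}"

definition T_deg ::
  "('k::field, 'o, 'm::ab_group_add) gcat \<Rightarrow> nat \<Rightarrow> nat \<Rightarrow> int \<Rightarrow> ('o \<Rightarrow> 'm) set set" where
  "T_deg A p r i = T A p r \<inter> abel_deg A i"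

definition Krs_deg ::
  "('k::field, 'o, 'm::ab_group_add) gcat \<Rightarrow> nat \<Rightarrow> nat \<Rightarrow> int \<Rightarrow> int \<Rightarrow> ('o \<Rightarrow> 'm) set" where
  "Krs_deg A p r s n = {a \<in> center_deg A n. \<forall>X\<in>T_deg A p r (s - n).
     left_act A a X = ab_class A 0 \<and> right_act A X a = ab_class A 0}"

definition Krs ::
  "('k::field, 'o, 'm::ab_group_add) gcat \<Rightarrow> nat \<Rightarrow> nat \<Rightarrow> int \<Rightarrow> ('o \<Rightarrow> 'm) set" where
  "Krs A p r s = graded_sum (Krs_deg A p r s)"

definition Kr :: "('k::field, 'o, 'm::ab_group_add) gcat \<Rightarrow> nat \<Rightarrow> nat \<Rightarrow> ('o \<Rightarrow> 'm) set" where
  "Kr A p r = (\<Inter>s. Krs A p r s)"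

definition Rs :: "('k::field, 'o, 'm::ab_group_add) gcat \<Rightarrow> nat \<Rightarrow> int \<Rightarrow> ('o \<Rightarrow> 'm) set" where
  "Rs A p s = (\<Inter>r. Krs A p r s)"

definition Rinf :: "('k::field, 'o, 'm::ab_group_add) gcat \<Rightarrow> nat \<Rightarrow> ('o \<Rightarrow> 'm) set" where
  "Rinf A p = (\<Inter>r. Kr A p r)"

text \<open>A functor is given by its object map \<open>Fo\<close> and its morphism maps \<open>Fm x y\<close>, defined on
  \<open>Hom A x y\<close>.\<close>

definition is_functor ::
  "('k::field, 'o, 'm::ab_group_add) gcat \<Rightarrow> ('k, 'o2, 'm2::ab_group_add) gcat \<Rightarrow>
   ('o \<Rightarrow> 'o2) \<Rightarrow> ('o \<Rightarrow> 'o \<Rightarrow> 'm \<Rightarrow> 'm2) \<Rightarrow> bool" where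
  "is_functor A A' Fo Fm \<longleftrightarrow>
     (\<forall>x\<in>Obj A. Fo x \<in> Obj A') \<and>
     (\<forall>x\<in>Obj A. \<forall>y\<in>Obj A. \<forall>f\<in>Hom A x y. Fm x y f \<in> Hom A' (Fo x) (Fo y) \<and>
        (\<forall>g\<in>Hom A x y. Fm x y (f + g) = Fm x y f + Fm x y g) \<and>
        (\<forall>c. Fm x y (scl A c f) = scl A' c (Fm x y f))) \<and>
     (\<forall>x\<in>Obj A. Fm x x (idn A x) = idn A' (Fo x)) \<and>
     (\<forall>x\<in>Obj A. \<forall>y\<in>Obj A. \<forall>z\<in>Obj A. \<forall>f\<in>Hom A x y. \<forall>g\<in>Hom A y z.
        Fm x z (cmp A x y z g f) = cmp A' (Fo x) (Fo y) (Fo z) (Fm y z g) (Fm x y f))"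

definition is_isomorphism ::
  "('k::field, 'o, 'm::ab_group_add) gcat \<Rightarrow> 'o \<Rightarrow> 'o \<Rightarrow> 'm \<Rightarrow> bool" where
  "is_isomorphism A x y f \<longleftrightarrow> f \<in> Hom A x y \<and>
     (\<exists>g\<in>Hom A y x. cmp A x y x g f = idn A x \<and> cmp A y x y f g = idn A y)"

definition degree_preserving_equivalence ::
  "('k::field, 'o, 'm::ab_group_add) gcat \<Rightarrow> ('k, 'o2, 'm2::ab_group_add) gcat \<Rightarrow>
   ('o \<Rightarrow> 'o2) \<Rightarrow> ('o \<Rightarrow> 'o \<Rightarrow> 'm \<Rightarrow> 'm2) \<Rightarrow> bool" where
  "degree_preserving_equivalence A A' Fo Fm \<longleftrightarrow>
     is_functor A A' Fo Fm \<and>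
     (\<forall>x\<in>Obj A. \<forall>y\<in>Obj A.
        bij_betw (Fm x y) (Hom A x y) (Hom A' (Fo x) (Fo y)) \<and>
        (\<forall>i. Fm x y ` Hom_deg A x y i = Hom_deg A' (Fo x) (Fo y) i)) \<and>
     (\<forall>x'\<in>Obj A'. \<exists>x\<in>Obj A. \<exists>b\<in>Hom_deg A' x' (Fo x) 0. is_isomorphism A' x' (Fo x) b)"

definition center_map_rel ::
  "('k::field, 'o, 'm::ab_group_add) gcat \<Rightarrow> ('k, 'o2, 'm2::ab_group_add) gcat \<Rightarrow>
   ('o \<Rightarrow> 'o2) \<Rightarrow> ('o \<Rightarrow> 'o \<Rightarrow> 'm \<Rightarrow> 'm2) \<Rightarrow> ('o \<Rightarrow> 'm) \<Rightarrow> ('o2 \<Rightarrow> 'm2) \<Rightarrow> bool" where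
  "center_map_rel A A' Fo Fm a b \<longleftrightarrow>
     b \<in> center A' \<and> (\<forall>x\<in>Obj A. b (Fo x) = Fm x x (a x))"

definition center_map ::
  "('k::field, 'o, 'm::ab_group_add) gcat \<Rightarrow> ('k, 'o2, 'm2::ab_group_add) gcat \<Rightarrow>
   ('o \<Rightarrow> 'o2) \<Rightarrow> ('o \<Rightarrow> 'o \<Rightarrow> 'm \<Rightarrow> 'm2) \<Rightarrow> ('o \<Rightarrow> 'm) \<Rightarrow> ('o2 \<Rightarrow> 'm2)" where
  "center_map A A' Fo Fm a = (THE b. center_map_rel A A' Fo Fm a b)"

end

(*
The centre acts on the abelianization, and f |-> f^p (for homogeneous f) descends to it because
p-th powers are additive modulo graded commutators: rotating a word of p letters of degree n changes
it only by a commutator (the sign (-1)^(n n (p-1)) is trivial, as p is odd or -1 = 1), so the mixed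
words in the expansion of (f + g)^p cancel. Moreover (f u)^p - (-1)^(i j) (u f)^p is again a
commutator, so p-th powers preserve commutators and T_r is contained in T_(r+1). For central a the
power (a f)^p is a central element times f^p, so the centre preserves T_r, and the K_(r,s) are ideals.

A degree preserving functor F pushes a family f of endomorphisms to the sum over x of F(f_x) placed
at F x. As F may identify objects, this is multiplicative only modulo commutators, but that suffices
to map T_r A to T_r A'. An equivalence and a quasi-inverse induce mutually inverse maps on
abelianizations because an endomorphism g is congruent to its conjugate b g b^(-1).
*)
theory Submission
  imports Defs
begin

subsection \<open>Graded sums\<close>

text \<open>Membership in \<open>K\<close> tests homogeneous classes only, and on a homogeneous
  family \<open>xi\<close> is the plain p-th power \<open>pw\<close>. Such a class also has
  inhomogeneous representatives, however, while p-th powers are additive modulo commutators only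
  within one degree. So the commutators must be known to be graded
  (\<open>commutators_graded_sum\<close>, \<open>commutators_homogeneous\<close>) before
  \<open>xi\<close> can be evaluated on classes. From then on \<open>Krs_deg_iff\<close> replaces
  classes by homogeneous \<open>f\<close> for which \<open>(pw ^^ r) f\<close> is a commutator. The
  ideals \<open>Kr\<close>, \<open>Rs\<close> and \<open>Rinf\<close> are intersections of graded
  sums. They are graded again because homogeneous decompositions in the centre are unique. The
  definition of a graded category does not place identities in degree zero, and an equivalence only
  provides isomorphisms of degree zero without speaking of their inverses. Both facts are derived by
  comparing homogeneous components. With them, conjugation by \<beta> introduces no Koszul
  sign.\<close>

lemma sum_fun_apply: "sum f S x = (\<Sum>i\<in>S. f i x)"
  by (induction S rule: infinite_finite_induct) auto

text \<open>The definition sums over the exact support, whereas constructions usually provide only a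
  finite set containing it, such as a shifted support or \<open>insert i S\<close>.\<close>

lemma decomposesI:
  assumes "\<And>i. c i \<in> G i" "finite S" "\<And>i. i \<notin> S \<Longrightarrow> c i = 0" "v = sum c S"
  shows "decomposes G v c"
proof -
  have "{i. c i \<noteq> 0} \<subseteq> S" using assms(3) by auto
  moreover from this have "sum c {i. c i \<noteq> 0} = sum c S"
    by (rule sum.mono_neutral_left[OF assms(2)]) auto
  ultimately show ?thesis
    unfolding decomposes_def using assms(1,2,4) finite_subset by auto
qed

lemma graded_sum_decomposes: "v \<in> graded_sum G \<longleftrightarrow> (\<exists>c. decomposes G v c)"
  by (auto simp: graded_sum_def decomposes_def)

lemma graded_sumI:
  assumes "\<And>i. i \<in> S \<Longrightarrow> c i \<in> G i" "finite S" "\<And>i. 0 \<in> G i"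
  shows "sum c S \<in> graded_sum G"
proof -
  have "decomposes G (sum c S) (\<lambda>i. if i \<in> S then c i else 0)"
    by (rule decomposesI[of _ _ S]) (use assms in auto)
  then show ?thesis by (auto simp: graded_sum_decomposes)
qed

lemma graded_sum_homogeneous:
  assumes "v \<in> G i" "\<And>i. 0 \<in> G i"
  shows "v \<in> graded_sum G"
  using graded_sumI[of "{i}" "\<lambda>_. v" G] assms by simp

lemma graded_sumE:
  assumes "v \<in> graded_sum G"
  obtains S c where "finite S" "\<And>i. c i \<in> G i" "\<And>i. i \<notin> S \<Longrightarrow> c i = 0" "v = sum c S"
  using assms unfolding graded_sum_def by blast

lemma graded_sum_mono:
  assumes "\<And>i. G i \<subseteq> H i"
  shows "graded_sum G \<subseteq> graded_sum H"
  using assms unfolding graded_sum_def by blast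

text \<open>Made for the map between centres, whose additivity is available only for genuine
  families of endomorphisms; hence \<open>h\<close> is asked to respect only sums with terms in the
  \<open>G i\<close>.\<close>

lemma graded_sum_image:
  assumes image: "\<And>i. h ` G i = H i" and zero: "\<And>i. 0 \<in> G i" "\<And>i. 0 \<in> H i"
    and sum: "\<And>S :: int set. \<And>c. (\<And>i. i \<in> S \<Longrightarrow> c i \<in> G i) \<Longrightarrow> h (sum c S) = (\<Sum>i\<in>S. h (c i))"
  shows "h ` graded_sum G = graded_sum H"
proof
  show "h ` graded_sum G \<subseteq> graded_sum H"
  proof
    fix w assume "w \<in> h ` graded_sum G"
    then obtain v where v: "v \<in> graded_sum G" "w = h v" by blast
    obtain S :: "int set" and c where c: "finite S" "\<And>i. c i \<in> G i" "v = sum c S"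
      using graded_sumE[OF v(1)] by metis
    have "w = (\<Sum>i\<in>S. h (c i))" using sum[OF c(2)] v(2) c(3) by simp
    also have "\<dots> \<in> graded_sum H" by (rule graded_sumI) (use c image zero in auto)
    finally show "w \<in> graded_sum H" .
  qed
  show "graded_sum H \<subseteq> h ` graded_sum G"
  proof
    fix w assume "w \<in> graded_sum H"
    then obtain S :: "int set" and d where d: "finite S" "\<And>i. d i \<in> H i" "w = sum d S"
      using graded_sumE by metis
    have "\<forall>i. \<exists>v. v \<in> G i \<and> d i = h v" using d(2) image by blast
    then obtain c where c: "\<And>i. c i \<in> G i" "\<And>i. d i = h (c i)" by metis
    then have "w = h (sum c S)" using sum d(3) by simp
    moreover have "sum c S \<in> graded_sum G" by (rule graded_sumI) (use c d zero in auto)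
    ultimately show "w \<in> h ` graded_sum G" by blast
  qed
qed

lemma (in module) subspace_graded_sum:
  assumes G: "\<And>i. subspace (G i)"
  shows "subspace (graded_sum G)"
proof (rule subspaceI)
  show "0 \<in> graded_sum G"
    using graded_sum_homogeneous[of 0 G] subspace_0[OF G] by blast
next
  fix u v assume "u \<in> graded_sum G" "v \<in> graded_sum G"
  obtain S c where c: "finite S" "\<And>i. c i \<in> G i" "\<And>i. i \<notin> S \<Longrightarrow> c i = 0" "u = sum c S"
    using graded_sumE[OF \<open>u \<in> graded_sum G\<close>] by metis
  obtain S' d where d: "finite S'" "\<And>i. d i \<in> G i" "\<And>i. i \<notin> S' \<Longrightarrow> d i = 0" "v = sum d S'"
    using graded_sumE[OF \<open>v \<in> graded_sum G\<close>] by metis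
  have "u = sum c (S \<union> S')" "v = sum d (S \<union> S')"
    using c d by (auto intro!: sum.mono_neutral_left)
  then have "u + v = (\<Sum>i\<in>S \<union> S'. c i + d i)" by (simp add: sum.distrib)
  moreover have "\<dots> \<in> graded_sum G"
    by (rule graded_sumI) (use c d G subspace_add subspace_0 in auto)
  ultimately show "u + v \<in> graded_sum G" by simp
next
  fix k u assume "u \<in> graded_sum G"
  obtain S c where c: "finite S" "\<And>i. c i \<in> G i" "\<And>i. i \<notin> S \<Longrightarrow> c i = 0" "u = sum c S"
    using graded_sumE[OF \<open>u \<in> graded_sum G\<close>] by metis
  have "k *s u = (\<Sum>i\<in>S. k *s c i)" using c by (simp add: scale_sum_right)
  moreover have "\<dots> \<in> graded_sum G"
    by (rule graded_sumI) (use c G subspace_scale subspace_0 in auto)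
  ultimately show "k *s u \<in> graded_sum G" by simp
qed

lemma (in module) graded_sum_subset:
  assumes "subspace V" "\<And>i. G i \<subseteq> V"
  shows "graded_sum G \<subseteq> V"
proof
  fix v assume "v \<in> graded_sum G"
  then obtain S :: "int set" and c where "\<And>i. c i \<in> G i" "v = sum c S"
    using graded_sumE by metis
  then show "v \<in> V" using subspace_sum[OF assms(1), of S c] assms(2) by blast
qed

text \<open>Uniqueness is given without the premise \<open>v \<in> V\<close>: an element with a
  decomposition lies in \<open>graded_sum G\<close>, which is \<open>V\<close>.\<close>

lemma is_gradingD:
  assumes "is_grading sc G V"
  shows "module.subspace sc V" "module.subspace sc (G i)" "V = graded_sum G"
    "\<And>v c d. decomposes G v c \<Longrightarrow> decomposes G v d \<Longrightarrow> c = d"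
proof -
  show "module.subspace sc V" "module.subspace sc (G i)" and V: "V = graded_sum G"
    using assms unfolding is_grading_def by blast+
  show "c = d" if "decomposes G v c" "decomposes G v d" for v c d
  proof -
    have "v \<in> V" using that(1) unfolding V graded_sum_decomposes by blast
    then have "\<exists>!c. decomposes G v c" using assms by (simp add: is_grading_def)
    then show ?thesis using that by blast
  qed
qed

lemma component_eq:
  assumes "is_grading sc G V" "decomposes G v c"
  shows "component G v = c"
  unfolding component_def using assms is_gradingD(4)[OF assms(1)] by (intro the_equality)

text \<open>Reduces the sign identities below to case distinctions on parity.\<close>

lemma koszul_if: "koszul i j = (if even i \<or> even j then 1 else - 1)"
  by (simp add: koszul_def power_int_minus_left)

lemma koszul_square [simp]: "koszul i j * koszul i j = 1"
  by (auto simp: koszul_if)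

lemma koszul_0 [simp]: "koszul 0 j = 1" "koszul i 0 = 1"
  by (auto simp: koszul_if)

subsection \<open>Graded categories\<close>

locale graded_cat =
  fixes A :: "('k::field, 'o, 'm::ab_group_add) gcat"
  assumes graded: "graded_category A"
begin

lemma lin: "linear_category A"
  using graded by (simp add: graded_category_def)

sublocale V: vector_space "scl A"
  using lin by (simp add: linear_category_def)

text \<open>\<open>V\<close> is the ambient space of morphisms, \<open>W\<close> the space of all
  functions from objects to morphisms. Centre, \<open>endo_sum A\<close> and commutators are
  subspaces of \<open>W\<close>.\<close>

sublocale W: vector_space "fscl A"
  by unfold_locales
    (auto simp: fscl_def fun_eq_iff V.scale_right_distrib V.scale_left_distrib)

lemma fscl_apply [simp]: "fscl A c f x = scl A c (f x)"
  by (simp add: fscl_def)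

context
  fixes x y assumes xy: "x \<in> Obj A" "y \<in> Obj A"
begin

lemma hom_subspace: "V.subspace (Hom A x y)"
  using lin xy by (simp add: linear_category_def)

lemma hom_grading: "is_grading (scl A) (Hom_deg A x y) (Hom A x y)"
  using graded xy by (simp add: graded_category_def)

lemma deg_subspace: "V.subspace (Hom_deg A x y i)"
  using is_gradingD(2)[OF hom_grading] .

lemma deg_hom: "f \<in> Hom_deg A x y i \<Longrightarrow> f \<in> Hom A x y"
  using is_gradingD(3)[OF hom_grading] V.subspace_0[OF deg_subspace]
  by (simp add: graded_sum_homogeneous)

lemmas hom_0 = V.subspace_0[OF hom_subspace]
  and hom_add = V.subspace_add[OF hom_subspace]
  and hom_scl = V.subspace_scale[OF hom_subspace]
  and hom_sum = V.subspace_sum[OF hom_subspace]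
  and deg_0 = V.subspace_0[OF deg_subspace]
  and deg_add = V.subspace_add[OF deg_subspace]
  and deg_scl = V.subspace_scale[OF deg_subspace]

lemma cmp_idn_right: "f \<in> Hom A x y \<Longrightarrow> cmp A x x y f (idn A x) = f"
  using lin xy by (simp add: linear_category_def)

lemma cmp_idn_left: "f \<in> Hom A x y \<Longrightarrow> cmp A x y y (idn A y) f = f"
  using lin xy by (simp add: linear_category_def)

lemma hom_decomp:
  assumes "f \<in> Hom A x y"
  obtains c where "decomposes (Hom_deg A x y) f c"
  using assms is_gradingD(3)[OF hom_grading] by (auto simp: graded_sum_decomposes)

lemmas hom_decomp_unique = is_gradingD(4)[OF hom_grading]
  and component_hom = component_eq[OF hom_grading]

end

lemma idn_hom: "x \<in> Obj A \<Longrightarrow> idn A x \<in> Hom A x x"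
  using lin by (simp add: linear_category_def)

context
  fixes x y z assumes xyz: "x \<in> Obj A" "y \<in> Obj A" "z \<in> Obj A"
begin

lemma cmp_hom: "f \<in> Hom A x y \<Longrightarrow> g \<in> Hom A y z \<Longrightarrow> cmp A x y z g f \<in> Hom A x z"
  using lin xyz by (simp add: linear_category_def)

lemma cmp_deg:
  "f \<in> Hom_deg A x y i \<Longrightarrow> g \<in> Hom_deg A y z j \<Longrightarrow> cmp A x y z g f \<in> Hom_deg A x z (i + j)"
  using graded xyz by (simp add: graded_category_def)

lemma cmp_add_right:
  "f \<in> Hom A x y \<Longrightarrow> f' \<in> Hom A x y \<Longrightarrow> g \<in> Hom A y z \<Longrightarrow>
    cmp A x y z g (f + f') = cmp A x y z g f + cmp A x y z g f'"
  using lin xyz by (simp add: linear_category_def)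

lemma cmp_add_left:
  "f \<in> Hom A x y \<Longrightarrow> g \<in> Hom A y z \<Longrightarrow> g' \<in> Hom A y z \<Longrightarrow>
    cmp A x y z (g + g') f = cmp A x y z g f + cmp A x y z g' f"
  using lin xyz by (simp add: linear_category_def)

lemma cmp_scl_right:
  "f \<in> Hom A x y \<Longrightarrow> g \<in> Hom A y z \<Longrightarrow> cmp A x y z g (scl A c f) = scl A c (cmp A x y z g f)"
  using lin xyz by (simp add: linear_category_def)

lemma cmp_scl_left:
  "f \<in> Hom A x y \<Longrightarrow> g \<in> Hom A y z \<Longrightarrow> cmp A x y z (scl A c g) f = scl A c (cmp A x y z g f)"
  using lin xyz by (simp add: linear_category_def)

lemma cmp_0_right: "g \<in> Hom A y z \<Longrightarrow> cmp A x y z g 0 = 0"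
  using cmp_scl_right[of 0 g 0] hom_0 xyz by simp

lemma cmp_0_left: "f \<in> Hom A x y \<Longrightarrow> cmp A x y z 0 f = 0"
  using cmp_scl_left[of f 0 0] hom_0 xyz by simp

lemma cmp_sum_right:
  assumes "g \<in> Hom A y z" "\<And>i. i \<in> S \<Longrightarrow> c i \<in> Hom A x y"
  shows "cmp A x y z g (sum c S) = (\<Sum>i\<in>S. cmp A x y z g (c i))"
  using assms(2)
  by (induction S rule: infinite_finite_induct)
    (auto simp: cmp_0_right assms(1) cmp_add_right hom_sum xyz)

lemma cmp_sum_left:
  assumes "f \<in> Hom A x y" "\<And>i. i \<in> S \<Longrightarrow> c i \<in> Hom A y z"
  shows "cmp A x y z (sum c S) f = (\<Sum>i\<in>S. cmp A x y z (c i) f)"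
  using assms(2)
  by (induction S rule: infinite_finite_induct)
    (auto simp: cmp_0_left assms(1) cmp_add_left hom_sum xyz)

end

lemma cmp_assoc:
  "w \<in> Obj A \<Longrightarrow> x \<in> Obj A \<Longrightarrow> y \<in> Obj A \<Longrightarrow> z \<in> Obj A \<Longrightarrow>
    f \<in> Hom A w x \<Longrightarrow> g \<in> Hom A x y \<Longrightarrow> h \<in> Hom A y z \<Longrightarrow>
    cmp A w x z (cmp A x y z h g) f = cmp A w y z h (cmp A w x y g f)"
  using lin by (simp add: linear_category_def)

section \<open>Identities and inverses in degree zero\<close>

lemma decomposes_homogeneous:
  assumes "x \<in> Obj A" "y \<in> Obj A" "f \<in> Hom_deg A x y i"
  shows "decomposes (Hom_deg A x y) f (\<lambda>n. if n = i then f else 0)"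
  by (rule decomposesI[of _ _ "{i}"]) (use assms deg_0 in auto)

text \<open>Composing with a homogeneous \<open>f\<close> acts on components and shifts degrees by
  \<open>i\<close>. Combined with uniqueness of decompositions, this allows an equation between
  composites to be read off degree by degree.\<close>

lemma decomposes_cmp_right:
  assumes xyz: "x \<in> Obj A" "y \<in> Obj A" "z \<in> Obj A"
    and f: "f \<in> Hom_deg A x y i" and g: "decomposes (Hom_deg A y z) g c"
  shows "decomposes (Hom_deg A x z) (cmp A x y z g f) (\<lambda>n. cmp A x y z (c (n - i)) f)"
proof (rule decomposesI[of _ _ "(\<lambda>n. n + i) ` {n. c n \<noteq> 0}"])
  show "cmp A x y z (c (n - i)) f \<in> Hom_deg A x z n" for n
    using cmp_deg[OF xyz f, of "c (n - i)" "n - i"] g by (simp add: decomposes_def)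
  show "cmp A x y z (c (n - i)) f = 0" if "n \<notin> (\<lambda>n. n + i) ` {n. c n \<noteq> 0}" for n
  proof -
    have "c (n - i) = 0" using that by (force simp: image_iff)
    then show ?thesis using cmp_0_left deg_hom xyz f by simp
  qed
  have ch: "c n \<in> Hom A y z" for n
    using g deg_hom[OF xyz(2,3), of "c n" n] by (simp add: decomposes_def)
  have "cmp A x y z g f = cmp A x y z (\<Sum>n | c n \<noteq> 0. c n) f"
    using g by (simp add: decomposes_def)
  also have "\<dots> = (\<Sum>n | c n \<noteq> 0. cmp A x y z (c n) f)"
    by (rule cmp_sum_left) (use xyz deg_hom[OF xyz(1,2) f] ch in auto)
  finally show "cmp A x y z g f =
      (\<Sum>n\<in>(\<lambda>n. n + i) ` {n. c n \<noteq> 0}. cmp A x y z (c (n - i)) f)"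
    by (subst sum.reindex) (auto simp: inj_on_def)
qed (use g in \<open>auto simp: decomposes_def\<close>)

text \<open>Let \<open>c 0\<close> be the degree zero component of the identity. Reading
  \<open>idn A x\<close> composed with \<open>c m\<close> in degree \<open>m\<close> shows that
  \<open>c 0\<close> fixes each component \<open>c m\<close>, hence fixes their sum, the identity.
  So \<open>c 0\<close> is the identity itself.\<close>

lemma idn_deg:
  assumes x: "x \<in> Obj A"
  shows "idn A x \<in> Hom_deg A x x 0"
proof -
  obtain c where c: "decomposes (Hom_deg A x x) (idn A x) c"
    using hom_decomp[OF x x idn_hom[OF x]] .
  then have ch: "c n \<in> Hom_deg A x x n" "c n \<in> Hom A x x" for n
    using deg_hom[OF x x] by (auto simp: decomposes_def)
  have "cmp A x x x (c (n - m)) (c m) = (if n = m then c m else 0)" for n m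
    using hom_decomp_unique[OF x x decomposes_cmp_right[OF x x x ch(1)[of m] c]
        decomposes_homogeneous[OF x x], of m]
      cmp_idn_left[OF x x] ch by (simp add: fun_eq_iff)
  from this[of m m for m] have *: "cmp A x x x (c 0) (c m) = c m" for m by simp
  have "c 0 = cmp A x x x (c 0) (idn A x)" using cmp_idn_right ch x by simp
  also have "\<dots> = (\<Sum>n | c n \<noteq> 0. cmp A x x x (c 0) (c n))"
    using cmp_sum_right[OF x x x ch(2)[of 0], of "{n. c n \<noteq> 0}" c] ch c
    by (simp add: decomposes_def)
  also have "\<dots> = idn A x" using * c by (simp add: decomposes_def)
  finally show ?thesis using ch(1)[of 0] by simp
qed

text \<open>The degree zero part of the equation \<open>g b = 1\<close> says that \<open>c 0\<close>
  is a left inverse of \<open>b\<close>, and a left inverse of an invertible morphism is its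
  inverse.\<close>

lemma inverse_deg:
  assumes xy: "x \<in> Obj A" "y \<in> Obj A" and b: "b \<in> Hom_deg A x y 0" and "is_isomorphism A x y b"
  obtains b' where "b' \<in> Hom_deg A y x 0" "cmp A x y x b' b = idn A x" "cmp A y x y b b' = idn A y"
proof -
  obtain g where g: "g \<in> Hom A y x" "cmp A x y x g b = idn A x" "cmp A y x y b g = idn A y"
    using assms(4) by (auto simp: is_isomorphism_def)
  obtain c where c: "decomposes (Hom_deg A y x) g c" using hom_decomp[OF xy(2,1) g(1)] .
  have "(\<lambda>n. cmp A x y x (c (n - 0)) b) = (\<lambda>n. if n = 0 then idn A x else 0)"
    using hom_decomp_unique[OF xy(1) xy(1)] decomposes_cmp_right[OF xy(1,2,1) b c] g(2)
      decomposes_homogeneous[OF xy(1,1) idn_deg[OF xy(1)]] by simp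
  from fun_cong[OF this, of 0] have c0: "cmp A x y x (c 0) b = idn A x" by simp
  have c0d: "c 0 \<in> Hom_deg A y x 0" using c by (simp add: decomposes_def)
  have "c 0 = cmp A y y x (c 0) (cmp A y x y b g)"
    using g(3) cmp_idn_right xy deg_hom c0d by simp
  also have "\<dots> = cmp A y x x (cmp A x y x (c 0) b) g"
    using cmp_assoc[OF xy(2,1,2,1) g(1)] deg_hom[OF _ _ b] deg_hom[OF _ _ c0d] xy by simp
  also have "\<dots> = g" using c0 cmp_idn_left xy g by simp
  finally show ?thesis using that[of "c 0"] c0 c0d g by simp
qed

end

context graded_cat
begin

subsection \<open>The centre as a graded algebra\<close>

text \<open>The product of all endomorphism algebras. It contains both the centre and
  \<open>endo_sum A\<close>, so the laws of \<open>fmult\<close> proved for it serve the algebra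
  structure and the two actions at once.\<close>

definition fam :: "('o \<Rightarrow> 'm) set" where
  "fam = {m. (\<forall>x\<in>Obj A. m x \<in> Hom A x x) \<and> (\<forall>x. x \<notin> Obj A \<longrightarrow> m x = 0)}"

text \<open>With infinitely many objects \<open>fam\<close> need not be the sum of these subspaces;
  only uniqueness of decompositions is available.\<close>

definition fdeg :: "int \<Rightarrow> ('o \<Rightarrow> 'm) set" where
  "fdeg i = {m. (\<forall>x\<in>Obj A. m x \<in> Hom_deg A x x i) \<and> (\<forall>x. x \<notin> Obj A \<longrightarrow> m x = 0)}"

lemma fdeg_fam: "f \<in> fdeg i \<Longrightarrow> f \<in> fam"
  using deg_hom by (auto simp: fam_def fdeg_def)

lemma famD: "f \<in> fam \<Longrightarrow> x \<in> Obj A \<Longrightarrow> f x \<in> Hom A x x"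
  by (simp add: fam_def)

lemma fam_outside: "f \<in> fam \<Longrightarrow> x \<notin> Obj A \<Longrightarrow> f x = 0"
  by (simp add: fam_def)

lemma fdegD: "f \<in> fdeg i \<Longrightarrow> x \<in> Obj A \<Longrightarrow> f x \<in> Hom_deg A x x i"
  by (simp add: fdeg_def)

lemma fam_subspace: "W.subspace fam"
  by (rule W.subspaceI) (auto simp: fam_def hom_0 hom_add hom_scl)

lemma fdeg_subspace: "W.subspace (fdeg i)"
  by (rule W.subspaceI) (auto simp: fdeg_def deg_0 deg_add deg_scl)

lemma fmult_fam: "f \<in> fam \<Longrightarrow> g \<in> fam \<Longrightarrow> fmult A f g \<in> fam"
  by (auto simp: fam_def fmult_def cmp_hom)

lemma fmult_fdeg: "f \<in> fdeg i \<Longrightarrow> g \<in> fdeg j \<Longrightarrow> fmult A f g \<in> fdeg (i + j)"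
  using cmp_deg by (fastforce simp: fdeg_def fmult_def add.commute)

lemma fmult_add_left:
  "f \<in> fam \<Longrightarrow> f' \<in> fam \<Longrightarrow> g \<in> fam \<Longrightarrow> fmult A (f + f') g = fmult A f g + fmult A f' g"
  by (auto simp: fam_def fmult_def cmp_add_left)

lemma fmult_add_right:
  "f \<in> fam \<Longrightarrow> g \<in> fam \<Longrightarrow> g' \<in> fam \<Longrightarrow> fmult A f (g + g') = fmult A f g + fmult A f g'"
  by (auto simp: fam_def fmult_def cmp_add_right)

lemma fmult_diff_right:
  "f \<in> fam \<Longrightarrow> g \<in> fam \<Longrightarrow> g' \<in> fam \<Longrightarrow> fmult A f (g - g') = fmult A f g - fmult A f g'"
  using fmult_add_right[of f "g - g'" g'] W.subspace_diff[OF fam_subspace] by simp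

lemma fmult_scl_left:
  "f \<in> fam \<Longrightarrow> g \<in> fam \<Longrightarrow> fmult A (fscl A c f) g = fscl A c (fmult A f g)"
  by (auto simp: fam_def fmult_def cmp_scl_left)

lemma fmult_scl_right:
  "f \<in> fam \<Longrightarrow> g \<in> fam \<Longrightarrow> fmult A f (fscl A c g) = fscl A c (fmult A f g)"
  by (auto simp: fam_def fmult_def cmp_scl_right)

lemma fmult_assoc:
  "f \<in> fam \<Longrightarrow> g \<in> fam \<Longrightarrow> h \<in> fam \<Longrightarrow> fmult A (fmult A f g) h = fmult A f (fmult A g h)"
  by (auto simp: fam_def fmult_def cmp_assoc)

lemma fmult_0_left: "f \<in> fam \<Longrightarrow> fmult A 0 f = 0"
  by (auto simp: fam_def fmult_def cmp_0_left)

lemma fmult_0_right: "f \<in> fam \<Longrightarrow> fmult A f 0 = 0"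
  by (auto simp: fam_def fmult_def cmp_0_right)

lemma fmult_sum_left:
  assumes "f \<in> fam" "\<And>i. i \<in> S \<Longrightarrow> c i \<in> fam"
  shows "fmult A (sum c S) f = (\<Sum>i\<in>S. fmult A (c i) f)"
  using assms(2)
  by (induction S rule: infinite_finite_induct)
    (auto simp: fmult_0_left assms(1) fmult_add_left W.subspace_sum[OF fam_subspace])

lemma fmult_sum_right:
  assumes "f \<in> fam" "\<And>i. i \<in> S \<Longrightarrow> c i \<in> fam"
  shows "fmult A f (sum c S) = (\<Sum>i\<in>S. fmult A f (c i))"
  using assms(2)
  by (induction S rule: infinite_finite_induct)
    (auto simp: fmult_0_right assms(1) fmult_add_right W.subspace_sum[OF fam_subspace])

lemma fone_fdeg: "fone A \<in> fdeg 0"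
  by (simp add: fone_def fdeg_def idn_deg)

lemma fmult_fone: "f \<in> fam \<Longrightarrow> fmult A (fone A) f = f" "f \<in> fam \<Longrightarrow> fmult A f (fone A) = f"
  by (auto simp: fam_def fmult_def fone_def cmp_idn_left cmp_idn_right)

lemma decomposes_fdeg:
  assumes "decomposes fdeg v c" "x \<in> Obj A"
  shows "decomposes (Hom_deg A x x) (v x) (\<lambda>i. c i x)"
  by (rule decomposesI[of _ _ "{i. c i \<noteq> 0}"])
    (use assms in \<open>auto simp: decomposes_def fdeg_def sum_fun_apply\<close>)

text \<open>Evaluation at an object reduces this to uniqueness in its endomorphism space. It yields
  directness of the grading both for the centre and for the commutators.\<close>

lemma decomposes_fdeg_unique:
  assumes "decomposes fdeg v c" "decomposes fdeg v d"
  shows "c = d"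
proof (intro ext)
  fix i x
  show "c i x = d i x"
  proof (cases "x \<in> Obj A")
    case True
    then show ?thesis
      using hom_decomp_unique[OF True True decomposes_fdeg[OF assms(1) True]
          decomposes_fdeg[OF assms(2) True]] by (simp add: fun_eq_iff)
  next
    case False
    then show ?thesis using assms by (simp add: decomposes_def fdeg_def)
  qed
qed

lemma center_deg_iff:
  "m \<in> center_deg A i \<longleftrightarrow> m \<in> fdeg i \<and>
     (\<forall>x\<in>Obj A. \<forall>y\<in>Obj A. \<forall>j. \<forall>f\<in>Hom_deg A x y j.
        cmp A x x y f (m x) = scl A (koszul i j) (cmp A x y y (m y) f))"
  by (auto simp: center_deg_def fdeg_def)

lemma center_deg_fdeg: "m \<in> center_deg A i \<Longrightarrow> m \<in> fdeg i"
  by (simp add: center_deg_iff)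

lemma center_deg_fam: "m \<in> center_deg A i \<Longrightarrow> m \<in> fam"
  using center_deg_fdeg fdeg_fam by blast

lemma center_deg_commute:
  "m \<in> center_deg A i \<Longrightarrow> x \<in> Obj A \<Longrightarrow> y \<in> Obj A \<Longrightarrow> f \<in> Hom_deg A x y j \<Longrightarrow>
    cmp A x x y f (m x) = scl A (koszul i j) (cmp A x y y (m y) f)"
  by (simp add: center_deg_iff)

lemma center_deg_fmult_commute:
  assumes "m \<in> center_deg A i" "f \<in> fdeg j"
  shows "fmult A f m = fscl A (koszul i j) (fmult A m f)"
  using assms center_deg_commute[OF assms(1)] by (auto simp: fmult_def fdeg_def fun_eq_iff)

lemma center_deg_subspace: "W.subspace (center_deg A i)"
proof (rule W.subspaceI)
  show "0 \<in> center_deg A i"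
    using W.subspace_0[OF fdeg_subspace] cmp_0_left cmp_0_right deg_hom
    by (auto simp: center_deg_iff)
  show "u + v \<in> center_deg A i" if uv: "u \<in> center_deg A i" "v \<in> center_deg A i" for u v
    unfolding center_deg_iff
  proof (intro conjI ballI allI)
    fix x y j f assume *: "x \<in> Obj A" "y \<in> Obj A" "f \<in> Hom_deg A x y j"
    have "u x \<in> Hom A x x" "u y \<in> Hom A y y" "v x \<in> Hom A x x" "v y \<in> Hom A y y" "f \<in> Hom A x y"
      using uv * center_deg_fam famD deg_hom by blast+
    then show "cmp A x x y f ((u + v) x) = scl A (koszul i j) (cmp A x y y ((u + v) y) f)"
      using uv * by (simp add: cmp_add_left cmp_add_right center_deg_commute V.scale_right_distrib)
  qed (use uv W.subspace_add[OF fdeg_subspace] center_deg_fdeg in blast)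
  show "fscl A c u \<in> center_deg A i" if u: "u \<in> center_deg A i" for c u
    unfolding center_deg_iff
  proof (intro conjI ballI allI)
    fix x y j f assume *: "x \<in> Obj A" "y \<in> Obj A" "f \<in> Hom_deg A x y j"
    have "u x \<in> Hom A x x" "u y \<in> Hom A y y" "f \<in> Hom A x y"
      using u * center_deg_fam famD deg_hom by blast+
    then show "cmp A x x y f (fscl A c u x) = scl A (koszul i j) (cmp A x y y (fscl A c u y) f)"
      using u * by (simp add: cmp_scl_left cmp_scl_right center_deg_commute mult.commute)
  qed (use u W.subspace_scale[OF fdeg_subspace] center_deg_fdeg in blast)
qed

text \<open>Moving \<open>f\<close> past \<open>a\<close> and then past \<open>b\<close> collects
  the signs \<open>koszul i n\<close> and \<open>koszul j n\<close>, whose product is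
  \<open>koszul (i + j) n\<close>.\<close>

lemma center_deg_mult:
  assumes ab: "a \<in> center_deg A i" "b \<in> center_deg A j"
  shows "fmult A a b \<in> center_deg A (i + j)"
  unfolding center_deg_iff
proof (intro conjI ballI allI)
  show "fmult A a b \<in> fdeg (i + j)" using ab center_deg_fdeg fmult_fdeg by blast
  fix x y n f assume xy: "x \<in> Obj A" "y \<in> Obj A" and f: "f \<in> Hom_deg A x y n"
  have h: "a x \<in> Hom A x x" "a y \<in> Hom A y y" "b x \<in> Hom A x x" "b y \<in> Hom A y y" "f \<in> Hom A x y"
    using ab xy f center_deg_fam famD deg_hom by blast+
  have "cmp A x x y f (cmp A x x x (a x) (b x)) = cmp A x x y (cmp A x x y f (a x)) (b x)"
    using cmp_assoc xy h by simp
  also have "\<dots> = scl A (koszul i n) (cmp A x x y (cmp A x y y (a y) f) (b x))"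
    using center_deg_commute[OF ab(1) xy f] cmp_scl_left cmp_hom xy h by simp
  also have "\<dots> = scl A (koszul i n) (cmp A x y y (a y) (cmp A x x y f (b x)))"
    using cmp_assoc xy h by simp
  also have "\<dots> = scl A (koszul i n * koszul j n) (cmp A x y y (a y) (cmp A x y y (b y) f))"
    using center_deg_commute[OF ab(2) xy f] cmp_scl_right cmp_hom xy h by simp
  also have "\<dots> = scl A (koszul (i + j) n) (cmp A x y y (cmp A y y y (a y) (b y)) f)"
    using cmp_assoc xy h by (auto simp: koszul_if)
  finally show "cmp A x x y f (fmult A a b x) = scl A (koszul (i + j) n) (cmp A x y y (fmult A a b y) f)"
    using xy by (simp add: fmult_def)
qed

lemma fone_center: "fone A \<in> center_deg A 0"
  unfolding center_deg_iff using fone_fdeg cmp_idn_left cmp_idn_right deg_hom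
  by (auto simp: fone_def)

lemma center_deg_center: "a \<in> center_deg A i \<Longrightarrow> a \<in> center A"
  unfolding center_def using graded_sum_homogeneous W.subspace_0[OF center_deg_subspace] by blast

lemma center_subspace: "W.subspace (center A)"
  unfolding center_def by (rule W.subspace_graded_sum) (rule center_deg_subspace)

end

lemmas fun_apply = plus_fun_apply zero_fun_apply minus_apply uminus_apply

text \<open>The simplifier would otherwise eta-expand sums of families.\<close>

declare fun_apply [simp del]

context graded_cat
begin

declare fscl_apply [simp del]

lemma center_induct [consumes 1, case_names homogeneous add]:
  assumes "a \<in> center A"
    and "\<And>i a. a \<in> center_deg A i \<Longrightarrow> P a"
    and "\<And>a b. a \<in> center A \<Longrightarrow> b \<in> center A \<Longrightarrow> P a \<Longrightarrow> P b \<Longrightarrow> P (a + b)"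
  shows "P a"
proof -
  obtain S :: "int set" and c where c: "finite S" "\<And>i. c i \<in> center_deg A i" "a = sum c S"
    using graded_sumE[OF assms(1)[unfolded center_def]] by metis
  from c(1) have "P (sum c S)"
  proof (induction S rule: finite_induct)
    case empty
    show ?case using assms(2)[OF W.subspace_0[OF center_deg_subspace]] by simp
  next
    case (insert i S)
    have "P (c i + sum c S)"
      using assms(3)[OF center_deg_center[OF c(2)] _ assms(2)[OF c(2)] insert.IH]
        W.subspace_sum[OF center_subspace, of S c] center_deg_center[OF c(2)] by simp
    then show ?case using insert by simp
  qed
  then show ?thesis using c(3) by simp
qed

lemma center_fam: "a \<in> center A \<Longrightarrow> a \<in> fam"
  by (induction rule: center_induct) (use center_deg_fam W.subspace_add[OF fam_subspace] in auto)

text \<open>Against a morphism of degree zero every Koszul sign is 1, so inhomogeneous central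
  elements commute too. This is applied to the isomorphisms relating a functor and its
  quasi-inverse.\<close>

lemma center_commute_0:
  assumes "m \<in> center A" and xy: "x \<in> Obj A" "y \<in> Obj A" and f: "f \<in> Hom_deg A x y 0"
  shows "cmp A x x y f (m x) = cmp A x y y (m y) f"
  using assms(1)
proof (induction rule: center_induct)
  case (homogeneous i m)
  then show ?case using center_deg_commute[OF homogeneous xy f] by simp
next
  case (add m n)
  then show ?case
    using famD[OF center_fam] xy deg_hom[OF xy f] by (simp add: fun_apply cmp_add_left cmp_add_right)
qed

lemma center_mult:
  assumes "a \<in> center A" "b \<in> center A"
  shows "fmult A a b \<in> center A"
  using assms(1)
proof (induction rule: center_induct)
  case (homogeneous i a)
  show ?case
    using assms(2)
  proof (induction rule: center_induct)
    case (homogeneous j b)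
    then show ?case using center_deg_mult \<open>a \<in> center_deg A i\<close> center_deg_center by blast
  next
    case (add b b')
    then show ?case using fmult_add_right center_fam center_deg_fam[OF homogeneous]
        W.subspace_add[OF center_subspace] by simp
  qed
next
  case (add a a')
  then show ?case
    using fmult_add_left center_fam assms(2) W.subspace_add[OF center_subspace]
    by simp
qed

lemma center_grading: "is_grading (fscl A) (center_deg A) (center A)"
proof -
  have "decomposes fdeg v c" if "decomposes (center_deg A) v c" for v c
    using that center_deg_fdeg by (auto simp: decomposes_def)
  then have "\<exists>!c. decomposes (center_deg A) v c" if "v \<in> center A" for v
    using that decomposes_fdeg_unique unfolding center_def graded_sum_decomposes by blast
  then show ?thesis
    using center_subspace center_deg_subspace by (simp add: is_grading_def center_def)
qed

lemma center_ring_simps [simp]: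
  "carrier (center_ring A) = center A" "mult (center_ring A) = fmult A"
  "one (center_ring A) = fone A" "zero (center_ring A) = 0" "add (center_ring A) = (+)"
  by (simp_all add: center_ring_def)

lemma ring_center: "ring (center_ring A)"
proof (rule ringI)
  show "abelian_group (center_ring A)"
  proof (rule abelian_groupI)
    fix a assume "a \<in> carrier (center_ring A)"
    then show "\<exists>b\<in>carrier (center_ring A). b \<oplus>\<^bsub>center_ring A\<^esub> a = \<zero>\<^bsub>center_ring A\<^esub>"
      using W.subspace_neg[OF center_subspace] by (intro bexI[of _ "- a"]) auto
  qed (use W.subspace_0[OF center_subspace] W.subspace_add[OF center_subspace] in
      \<open>auto simp: add.assoc add.commute\<close>)
  show "monoid (center_ring A)"
    by unfold_locales
      (auto simp: center_mult fmult_assoc center_fam fmult_fone center_deg_center[OF fone_center])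
qed (auto simp: fmult_add_left fmult_add_right center_fam)

lemma graded_algebra_center: "graded_algebra (fscl A) (center_deg A) (center_ring A)"
  unfolding graded_algebra_def
  using W.vector_space_axioms ring_center center_grading fone_center center_deg_mult
  by (auto simp: fmult_scl_left fmult_scl_right center_fam)

section \<open>Graded ideals of the centre\<close>

text \<open>Left multiplication by homogeneous elements is enough to check: graded commutativity of
  the centre gives the other side up to sign, and additivity gives inhomogeneous factors.\<close>

lemma graded_ideal_graded_sum:
  assumes sub: "\<And>n. W.subspace (H n)" and H: "\<And>n. H n \<subseteq> center_deg A n"
    and mult: "\<And>m n a h. a \<in> center_deg A m \<Longrightarrow> h \<in> H n \<Longrightarrow> fmult A a h \<in> H (m + n)"
  shows "graded_ideal (fscl A) (center_deg A) (center_ring A) (graded_sum H)" (is "graded_ideal _ _ ?R ?I")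
proof -
  have I: "W.subspace ?I" by (rule W.subspace_graded_sum) (rule sub)
  have HI: "h \<in> ?I" if "h \<in> H n" for h n
    using graded_sum_homogeneous[of h H n, OF that] W.subspace_0[OF sub] by blast
  have IC: "?I \<subseteq> center A"
    unfolding center_def using H by (rule graded_sum_mono)
  have add: "u + v \<in> ?I" if "u \<in> ?I" "v \<in> ?I" for u v
    using W.subspace_add[OF I] that .
  have right: "fmult A h a \<in> H (m + n)" if "a \<in> center_deg A m" "h \<in> H n" for a h m n
    using center_deg_fmult_commute[OF that(1) center_deg_fdeg] mult[OF that] H that(2)
      W.subspace_scale[OF sub] by fastforce
  have absorb: "fmult A a h \<in> ?I \<and> fmult A h a \<in> ?I" if "a \<in> center A" "h \<in> ?I" for a h
    using that(1)
  proof (induction rule: center_induct)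
    case (homogeneous m a)
    obtain S :: "int set" and c where c: "finite S" "\<And>i. c i \<in> H i" "h = sum c S"
      using graded_sumE[OF \<open>h \<in> ?I\<close>] by metis
    have cf: "c i \<in> fam" for i using c(2) H center_deg_fam by blast
    have "fmult A a h = (\<Sum>i\<in>S. fmult A a (c i))" "fmult A h a = (\<Sum>i\<in>S. fmult A (c i) a)"
      unfolding c(3) using center_deg_fam[OF homogeneous] cf
      by (simp_all add: fmult_sum_left fmult_sum_right)
    then show ?case
      using mult[OF homogeneous c(2)] right[OF homogeneous c(2)] HI W.subspace_sum[OF I] by metis
  next
    case (add a b)
    have "h \<in> fam" using that(2) IC center_fam by blast
    with add show ?case
      by (simp add: fmult_add_left fmult_add_right center_fam W.subspace_add[OF I])
  qed
  interpret ring ?R by (rule ring_center)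
  \<comment> \<open>The ring is built on the addition of the type, but its additive inverse is
    defined through the ring; the two negatives have to be identified.\<close>
  have neg: "\<ominus>\<^bsub>?R\<^esub> a = - a" if "a \<in> center A" for a
    using minus_equality[of "- a" a] that W.subspace_neg[OF center_subspace] by simp
  have "ideal ?I ?R"
  proof (rule idealI)
    show "subgroup ?I (add_monoid ?R)"
    proof (rule subgroup.intro)
      fix x assume x: "x \<in> ?I"
      then have "inv\<^bsub>add_monoid ?R\<^esub> x = - x" using neg IC by (auto simp: a_inv_def)
      then show "inv\<^bsub>add_monoid ?R\<^esub> x \<in> ?I" using W.subspace_neg[OF I x] by simp
    qed (use IC add W.subspace_0[OF I] in auto)
  qed (use ring_center absorb in auto)
  moreover have "?I = graded_sum (\<lambda>i. ?I \<inter> center_deg A i)"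
  proof
    show "?I \<subseteq> graded_sum (\<lambda>i. ?I \<inter> center_deg A i)"
      by (rule graded_sum_mono) (use HI H in blast)
    show "graded_sum (\<lambda>i. ?I \<inter> center_deg A i) \<subseteq> ?I"
      by (rule W.graded_sum_subset[OF I]) blast
  qed
  ultimately show ?thesis using I by (simp add: graded_ideal_def)
qed

text \<open>An element of the intersection decomposes inside each \<open>I i\<close>. All these are
  decompositions in the centre, hence they agree, and their common components lie in every
  \<open>I i\<close>.\<close>

lemma graded_ideal_INT:
  assumes I: "\<And>i. graded_ideal (fscl A) (center_deg A) (center_ring A) (I i)"
  shows "graded_ideal (fscl A) (center_deg A) (center_ring A) (\<Inter>i. I i)"
proof -
  interpret ring "center_ring A" by (rule ring_center)
  have 1: "ideal (\<Inter>i. I i) (center_ring A)"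
    using i_Intersect[of "range I"] I by (auto simp: graded_ideal_def)
  have 2: "W.subspace (\<Inter>i. I i)"
    using I by (intro W.subspace_Int) (auto simp: graded_ideal_def)
  have "v \<in> graded_sum (\<lambda>n. (\<Inter>i. I i) \<inter> center_deg A n)" if v: "v \<in> (\<Inter>i. I i)" for v
  proof -
    have "\<exists>c. decomposes (\<lambda>n. I i \<inter> center_deg A n) v c" for i
      using I[of i] v graded_sum_decomposes[of v "\<lambda>n. I i \<inter> center_deg A n"]
      by (auto simp: graded_ideal_def)
    then obtain c where c: "\<And>i. decomposes (\<lambda>n. I i \<inter> center_deg A n) v (c i)" by metis
    then have "decomposes (center_deg A) v (c i)" for i
      using c[of i] by (auto simp: decomposes_def)
    \<comment> \<open>Since all the decompositions coincide, an arbitrary index may name the common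
      one.\<close>
    then have "c i = c undefined" for i
      using is_gradingD(4)[OF center_grading] by blast
    then have "decomposes (\<lambda>n. (\<Inter>i. I i) \<inter> center_deg A n) v (c undefined)"
      using c unfolding decomposes_def by (auto; metis)
    then show ?thesis by (auto simp: graded_sum_decomposes)
  qed
  moreover have "graded_sum (\<lambda>n. (\<Inter>i. I i) \<inter> center_deg A n) \<subseteq> (\<Inter>i. I i)"
    
    by (rule W.graded_sum_subset[OF 2]) blast
  ultimately have "(\<Inter>i. I i) = graded_sum (\<lambda>n. (\<Inter>i. I i) \<inter> center_deg A n)" by blast
  then show ?thesis using 1 2 by (simp add: graded_ideal_def)
qed

end

subsection \<open>Commutators\<close>

text \<open>The premise \<open>f x = v\<close> keeps the link with the given \<open>f\<close>, so
  that a pointwise property such as the degree of its values is available for each summand.\<close>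

lemma finite_support_induct [consumes 1, case_names zero add]:
  fixes f :: "'o \<Rightarrow> 'm::ab_group_add"
  assumes "finite {x. f x \<noteq> 0}"
    and "P 0" and "\<And>x v g. f x = v \<Longrightarrow> P g \<Longrightarrow> P (at_obj x v + g)"
  shows "P f"
proof -
  have "P (\<Sum>x\<in>S. at_obj x (f x))" if "finite S" for S
    using that
  proof (induction S rule: finite_induct)
    case (insert x S)
    then show ?case using assms(3)[OF refl insert.IH, of x] by simp
  qed (use assms(2) in simp)
  from this[OF assms(1)] have "P (\<Sum>x | f x \<noteq> 0. at_obj x (f x))" .
  moreover have "(\<Sum>x | f x \<noteq> 0. at_obj x (f x)) = f"
    using assms(1) by (auto simp: fun_eq_iff sum_fun_apply at_obj_def sum.delta')
  ultimately show ?thesis by simp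
qed

lemma at_obj_add: "at_obj x (u + v) = at_obj x u + at_obj x v"
  by (auto simp: at_obj_def fun_apply)

lemma at_obj_0 [simp]: "at_obj x 0 = 0"
  by (auto simp: at_obj_def fun_apply)

context graded_cat
begin

lemma fscl_at_obj: "fscl A c (at_obj x v) = at_obj x (scl A c v)"
  by (auto simp: at_obj_def fscl_apply)

lemma endo_sum_iff: "f \<in> endo_sum A \<longleftrightarrow> finite {x. f x \<noteq> 0} \<and> f \<in> fam"
  by (auto simp: endo_sum_def fam_def)

lemma endo_sum_deg_iff: "f \<in> endo_sum_deg A i \<longleftrightarrow> finite {x. f x \<noteq> 0} \<and> f \<in> fdeg i"
  using deg_hom by (auto simp: endo_sum_deg_def endo_sum_def fdeg_def)

lemma endo_sum_fam: "f \<in> endo_sum A \<Longrightarrow> f \<in> fam"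
  by (simp add: endo_sum_iff)

lemma endo_sum_deg_fdeg: "f \<in> endo_sum_deg A i \<Longrightarrow> f \<in> fdeg i"
  by (simp add: endo_sum_deg_iff)

lemma endo_sum_deg_fam: "f \<in> endo_sum_deg A i \<Longrightarrow> f \<in> fam"
  using endo_sum_deg_fdeg fdeg_fam by blast

lemma endo_sum_deg_endo_sum: "f \<in> endo_sum_deg A i \<Longrightarrow> f \<in> endo_sum A"
  by (simp add: endo_sum_deg_def)

lemma endo_sum_subspace: "W.subspace (endo_sum A)"
proof (rule W.subspaceI)
  show "0 \<in> endo_sum A" using W.subspace_0[OF fam_subspace] by (simp add: endo_sum_iff fun_apply)
  show "f + g \<in> endo_sum A" if "f \<in> endo_sum A" "g \<in> endo_sum A" for f g
  proof -
    have "{x. (f + g) x \<noteq> 0} \<subseteq> {x. f x \<noteq> 0} \<union> {x. g x \<noteq> 0}" by (auto simp: fun_apply)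
    then show ?thesis
      using that W.subspace_add[OF fam_subspace] finite_subset by (fastforce simp: endo_sum_iff)
  qed
  show "fscl A c f \<in> endo_sum A" if "f \<in> endo_sum A" for c f
  proof -
    have "{x. fscl A c f x \<noteq> 0} \<subseteq> {x. f x \<noteq> 0}" by (auto simp: fscl_apply)
    then show ?thesis
      using that W.subspace_scale[OF fam_subspace] finite_subset by (fastforce simp: endo_sum_iff)
  qed
qed

lemma endo_sum_deg_subspace: "W.subspace (endo_sum_deg A i)"
proof -
  have "endo_sum_deg A i = endo_sum A \<inter> fdeg i"
    using fdeg_fam by (auto simp: endo_sum_iff endo_sum_deg_iff)
  then show ?thesis using W.subspace_inter[OF endo_sum_subspace fdeg_subspace] by simp
qed

text \<open>Finite support is inherited from \<open>g\<close>; the factor \<open>f\<close> may be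
  any homogeneous family, in particular a central one.\<close>

lemma endo_sum_deg_fmult:
  assumes "f \<in> fdeg i" "g \<in> endo_sum_deg A j"
  shows "fmult A f g \<in> endo_sum_deg A (i + j)" "fmult A g f \<in> endo_sum_deg A (j + i)"
proof -
  have "{x. fmult A f g x \<noteq> 0} \<subseteq> {x. g x \<noteq> 0}" "{x. fmult A g f x \<noteq> 0} \<subseteq> {x. g x \<noteq> 0}"
    using famD[OF fdeg_fam[OF assms(1)]] by (auto simp: fmult_def cmp_0_right cmp_0_left)
  then show "fmult A f g \<in> endo_sum_deg A (i + j)" "fmult A g f \<in> endo_sum_deg A (j + i)"
    using fmult_fdeg[OF assms(1) endo_sum_deg_fdeg[OF assms(2)]]
      fmult_fdeg[OF endo_sum_deg_fdeg[OF assms(2)] assms(1)] assms(2) finite_subset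
    unfolding endo_sum_deg_iff by blast+
qed

lemma at_obj_endo_sum_deg:
  "x \<in> Obj A \<Longrightarrow> f \<in> Hom_deg A x x i \<Longrightarrow> at_obj x f \<in> endo_sum_deg A i"
  by (auto simp: endo_sum_deg_iff fdeg_def at_obj_def deg_0)

lemma fmult_at_obj:
  assumes "x \<in> Obj A" "f \<in> Hom A x x" "g \<in> Hom A x x"
  shows "fmult A (at_obj x f) (at_obj x g) = at_obj x (cmp A x x x f g)"
  using assms hom_0 by (auto simp: fmult_def at_obj_def fun_eq_iff cmp_0_right)

lemma endo_sum_deg_induct [consumes 1, case_names zero add]:
  assumes "f \<in> endo_sum_deg A i" and "P 0"
    and "\<And>x v g. x \<in> Obj A \<Longrightarrow> v \<in> Hom_deg A x x i \<Longrightarrow> g \<in> endo_sum_deg A i \<Longrightarrow> P g \<Longrightarrow>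
      P (at_obj x v + g)"
  shows "P f"
proof -
  have f: "f \<in> fdeg i" and "finite {x. f x \<noteq> 0}" using assms(1) by (auto simp: endo_sum_deg_iff)
  from this(2) have "P f \<and> f \<in> endo_sum_deg A i"
  proof (induction rule: finite_support_induct)
    case zero
    show ?case using assms(2) W.subspace_0[OF endo_sum_deg_subspace] by simp
  next
    case (add x v g)
    show ?case
    proof (cases "x \<in> Obj A")
      case True
      have "v \<in> Hom_deg A x x i" using fdegD[OF f True] add(1) by simp
      then show ?thesis
        using assms(3)[OF True] at_obj_endo_sum_deg[OF True] add(2)
          W.subspace_add[OF endo_sum_deg_subspace] by simp
    next
      case False
      then have "v = 0" using f add(1) by (auto simp: fdeg_def)
      then show ?thesis using add(2) by simp
    qed
  qed
  then show ?thesis by simp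
qed

section \<open>The grading of the commutators\<close>

text \<open>The generators of \<open>commutators A\<close> sorted by total degree, which is what
  makes their span graded.\<close>

definition commutator_gens :: "int \<Rightarrow> ('o \<Rightarrow> 'm) set" where
  "commutator_gens n =
     {at_obj x (cmp A x y x f u) - fscl A (koszul i j) (at_obj y (cmp A y x y u f)) | x y i j u f.
        x \<in> Obj A \<and> y \<in> Obj A \<and> u \<in> Hom_deg A x y i \<and> f \<in> Hom_deg A y x j \<and> i + j = n}"

lemma commutator_gensE:
  assumes "c \<in> commutator_gens n"
  obtains x y i j u f where "x \<in> Obj A" "y \<in> Obj A" "u \<in> Hom_deg A x y i"
    "f \<in> Hom_deg A y x j" "i + j = n"
    "c = at_obj x (cmp A x y x f u) - fscl A (koszul i j) (at_obj y (cmp A y x y u f))"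
  using assms unfolding commutator_gens_def mem_Collect_eq
  by (elim exE conjE) (rule that)

definition commutators_deg :: "int \<Rightarrow> ('o \<Rightarrow> 'm) set" where
  "commutators_deg n = W.span (commutator_gens n)"

lemma commutators_span: "commutators A = W.span (\<Union>n. commutator_gens n)"
  unfolding commutators_def commutator_gens_def by (rule arg_cong[where f = W.span]) blast

lemma commutators_subspace: "W.subspace (commutators A)"
  by (simp add: commutators_span)

lemma commutators_deg_subspace: "W.subspace (commutators_deg n)"
  by (simp add: commutators_deg_def)

lemma commutators_deg_commutators: "commutators_deg n \<subseteq> commutators A"
  unfolding commutators_deg_def commutators_span by (rule W.span_mono) blast

lemma commutator_in_commutators_deg:
  assumes "x \<in> Obj A" "y \<in> Obj A" "u \<in> Hom_deg A x y i" "f \<in> Hom_deg A y x j"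
  shows "at_obj x (cmp A x y x f u) - fscl A (koszul i j) (at_obj y (cmp A y x y u f))
    \<in> commutators_deg (i + j)"
  unfolding commutators_deg_def commutator_gens_def
  by (rule W.span_base) (use assms in blast)

lemmas commutator_in_commutators = commutators_deg_commutators[THEN subsetD, OF commutator_in_commutators_deg]

lemma commutators_deg_endo_sum_deg: "commutators_deg n \<subseteq> endo_sum_deg A n"
  unfolding commutators_deg_def
proof (rule W.span_minimal[OF _ endo_sum_deg_subspace])
  have "at_obj x (cmp A x y x f u) - fscl A (koszul i j) (at_obj y (cmp A y x y u f))
      \<in> endo_sum_deg A (i + j)"
    if *: "x \<in> Obj A" "y \<in> Obj A" "u \<in> Hom_deg A x y i" "f \<in> Hom_deg A y x j" for x y i j u f
  proof -
    have "cmp A x y x f u \<in> Hom_deg A x x (i + j)" "cmp A y x y u f \<in> Hom_deg A y y (i + j)"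
      using cmp_deg[OF *(1,2,1,3,4)] cmp_deg[OF *(2,1,2,4,3)] by (simp_all add: add.commute)
    then show ?thesis
      using * by (intro W.subspace_diff[OF endo_sum_deg_subspace]
          W.subspace_scale[OF endo_sum_deg_subspace] at_obj_endo_sum_deg)
  qed
  then show "commutator_gens n \<subseteq> endo_sum_deg A n" by (auto simp: commutator_gens_def)
qed

lemma commutators_graded_sum: "commutators A = graded_sum commutators_deg"
proof
  show "commutators A \<subseteq> graded_sum commutators_deg"
    unfolding commutators_span
  proof (rule W.span_minimal)
    show "(\<Union>n. commutator_gens n) \<subseteq> graded_sum commutators_deg"
    proof
      fix v assume "v \<in> (\<Union>n. commutator_gens n)"
      then obtain n where "v \<in> commutators_deg n" unfolding commutators_deg_def using W.span_base by blast
      then show "v \<in> graded_sum commutators_deg"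
        by (rule graded_sum_homogeneous) (rule W.subspace_0[OF commutators_deg_subspace])
    qed
  qed (rule W.subspace_graded_sum, rule commutators_deg_subspace)
  show "graded_sum commutators_deg \<subseteq> commutators A"
    by (rule W.graded_sum_subset[OF commutators_subspace commutators_deg_commutators])
qed

lemma commutators_endo_sum: "commutators A \<subseteq> endo_sum A"
  unfolding commutators_graded_sum
  by (rule W.graded_sum_subset[OF endo_sum_subspace])
    (use commutators_deg_endo_sum_deg endo_sum_deg_endo_sum in blast)

text \<open>A priori, generators of other degrees could be involved in \<open>c\<close>. Comparing
  its decomposition along \<open>commutators_deg\<close> with the trivial one excludes them. This is
  needed because \<open>pw\<close> is controlled only on sums within one degree.\<close>

lemma commutators_homogeneous:
  assumes "c \<in> commutators A" "c \<in> fdeg n"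
  shows "c \<in> commutators_deg n"
proof -
  obtain d where d: "decomposes commutators_deg c d"
    using assms(1) unfolding commutators_graded_sum graded_sum_decomposes by blast
  have "decomposes fdeg c d"
    using d commutators_deg_endo_sum_deg endo_sum_deg_fdeg unfolding decomposes_def by blast
  moreover have "decomposes fdeg c (\<lambda>m. if m = n then c else 0)"
    by (rule decomposesI[of _ _ "{n}"]) (use assms W.subspace_0[OF fdeg_subspace] in auto)
  ultimately have "d = (\<lambda>m. if m = n then c else 0)" by (rule decomposes_fdeg_unique)
  then have "d n = c" by simp
  then show ?thesis using d unfolding decomposes_def by metis
qed

text \<open>Splitting \<open>f\<close> into families supported at one object turns each term into a
  generator. The factor \<open>u\<close> may have infinite support, so any \<open>word_prod\<close>
  can take its place, even that of the empty word.\<close>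

lemma fmult_commutator:
  assumes "f \<in> endo_sum_deg A j" "u \<in> fdeg i"
  shows "fmult A f u - fscl A (koszul i j) (fmult A u f) \<in> commutators A"
  using assms(1)
proof (induction rule: endo_sum_deg_induct)
  case zero
  then show ?case
    using fmult_0_left fmult_0_right fdeg_fam[OF assms(2)] W.subspace_0[OF commutators_subspace]
    by simp
next
  case (add x v g)
  have v: "at_obj x v \<in> fam" and g: "g \<in> fam" and u: "u \<in> fam"
    using at_obj_endo_sum_deg add(1-3) endo_sum_deg_fam assms fdeg_fam by blast+
  have "fmult A (at_obj x v) u = at_obj x (cmp A x x x v (u x))"
    "fmult A u (at_obj x v) = at_obj x (cmp A x x x (u x) v)"
    using add(1) famD[OF u] by (auto simp: fmult_def at_obj_def fun_eq_iff cmp_0_left cmp_0_right)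
  then have "fmult A (at_obj x v) u - fscl A (koszul i j) (fmult A u (at_obj x v)) \<in> commutators A"
    using commutator_in_commutators[OF add(1,1) fdegD[OF assms(2) add(1)] add(2)] by simp
  from W.subspace_add[OF commutators_subspace this add.IH] show ?case
    using u v g by (simp add: fmult_add_left fmult_add_right W.scale_right_distrib add_diff_add)
qed

subsection \<open>Powers modulo commutators\<close>

text \<open>The empty word is the unit of \<open>fam\<close>, which need not lie in
  \<open>endo_sum A\<close>. It makes products of words uniform, while \<open>fpower\<close> has to
  begin with exponent 1.\<close>

definition word_prod :: "('o \<Rightarrow> 'm) list \<Rightarrow> 'o \<Rightarrow> 'm" where
  "word_prod ws = foldr (fmult A) ws (fone A)"

lemma word_prod_simps [simp]:
  "word_prod [] = fone A" "word_prod (f # fs) = fmult A f (word_prod fs)"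
  by (simp_all add: word_prod_def)

lemma word_prod_fam: "set fs \<subseteq> fam \<Longrightarrow> word_prod fs \<in> fam"
  by (induction fs) (auto simp: fmult_fam fdeg_fam[OF fone_fdeg])

lemma word_prod_fdeg: "set fs \<subseteq> fdeg n \<Longrightarrow> word_prod fs \<in> fdeg (int (length fs) * n)"
proof (induction fs)
  case (Cons f fs)
  then show ?case using fmult_fdeg[of f n "word_prod fs"] by (simp add: distrib_right)
qed (simp add: fone_fdeg)

lemma word_prod_append:
  "set fs \<subseteq> fam \<Longrightarrow> set gs \<subseteq> fam \<Longrightarrow> word_prod (fs @ gs) = fmult A (word_prod fs) (word_prod gs)"
  by (induction fs) (auto simp: fmult_fone word_prod_fam fmult_assoc)

abbreviation fpow :: "('o \<Rightarrow> 'm) \<Rightarrow> nat \<Rightarrow> 'o \<Rightarrow> 'm" where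
  "fpow f q \<equiv> word_prod (replicate q f)"

lemma fpow_fam: "f \<in> fam \<Longrightarrow> fpow f q \<in> fam"
  by (rule word_prod_fam) auto

lemma fpower_eq_fpow:
  assumes "q > 0" "f \<in> fam"
  shows "fpower A f q = fpow f q"
proof -
  have "(fmult A f ^^ n) f = fpow f (Suc n)" for n
    by (induction n) (use assms(2) fmult_fone in auto)
  from this[of "q - 1"] show ?thesis using assms(1) by (simp add: fpower_def del: replicate_Suc)
qed

text \<open>The noncommutative expansion of a power: a boolean word records which summand is taken
  from each factor, \<open>True\<close> standing for \<open>f\<close>.\<close>

lemma fpow_add:
  assumes f: "f \<in> fam" and g: "g \<in> fam"
  shows "fpow (f + g) q = (\<Sum>w | length w = q. word_prod (map (\<lambda>b. if b then f else g) w))"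
    (is "_ = sum ?P _")
proof (induction q)
  case (Suc q)
  have P: "?P w \<in> fam" for w by (rule word_prod_fam) (use f g in auto)
  have fin: "finite {w :: bool list. length w = q}"
    using finite_lists_length_eq[of "UNIV :: bool set"] by simp
  have "{w :: bool list. length w = Suc q} =
      (#) True ` {w. length w = q} \<union> (#) False ` {w. length w = q}"
    by (auto simp: length_Suc_conv)
  then have "sum ?P {w. length w = Suc q} =
      sum ?P ((#) True ` {w. length w = q}) + sum ?P ((#) False ` {w. length w = q})"
    using fin by (simp only:) (intro sum.union_disjoint, auto)
  also have "\<dots> = (\<Sum>w | length w = q. fmult A f (?P w)) + (\<Sum>w | length w = q. fmult A g (?P w))"
    by (simp add: sum.reindex)
  also have "\<dots> = fmult A (f + g) (sum ?P {w. length w = q})"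
    using f g P W.subspace_sum[OF fam_subspace, of _ ?P]
    by (simp add: fmult_add_left fmult_sum_right)
  finally show ?case using Suc by simp
qed simp

section \<open>Classes modulo commutators and central multiplication\<close>

lemma ab_class_eq_iff: "ab_class A f = ab_class A g \<longleftrightarrow> f - g \<in> commutators A"
proof
  have "f + 0 \<in> ab_class A f"
    unfolding ab_class_def using W.subspace_0[OF commutators_subspace] by blast
  moreover assume "ab_class A f = ab_class A g"
  ultimately show "f - g \<in> commutators A" by (auto simp: ab_class_def)
next
  assume *: "f - g \<in> commutators A"
  have "f + c \<in> ab_class A g" "g + c \<in> ab_class A f" if "c \<in> commutators A" for c
  proof -
    have "(f - g) + c \<in> commutators A" "c - (f - g) \<in> commutators A"
      using W.subspace_add[OF commutators_subspace * that]
        W.subspace_diff[OF commutators_subspace that *] by simp_all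
    then show "f + c \<in> ab_class A g" "g + c \<in> ab_class A f"
      unfolding ab_class_def by (force simp: image_iff algebra_simps)+
  qed
  then show "ab_class A f = ab_class A g" by (auto simp: ab_class_def)
qed

lemma ab_class_eq_0: "ab_class A f = ab_class A 0 \<longleftrightarrow> f \<in> commutators A"
  using ab_class_eq_iff[of f 0] by simp

text \<open>\<open>the_elem\<close> needs a singleton. The hypothesis provides it by letting
  \<open>f + c\<close> run through all representatives of the class.\<close>

lemma induced_ab_class:
  assumes "\<And>c. c \<in> commutators A \<Longrightarrow> h (f + c) - g \<in> commutators A"
  shows "induced A h (ab_class A f) = ab_class A g"
proof -
  have "(\<lambda>f. ab_class A (h f)) ` ab_class A f = {ab_class A g}"
    using assms W.subspace_0[OF commutators_subspace] ab_class_eq_iff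
    unfolding ab_class_def[of A f] image_image by blast
  then show ?thesis by (simp add: induced_def)
qed

text \<open>Multiplying the generator of \<open>u\<close> and \<open>f\<close> by \<open>a\<close>
  gives the generator of \<open>u\<close> and \<open>a f\<close>: sliding \<open>a\<close> past
  \<open>u\<close> changes the sign exactly as the larger degree of \<open>a f\<close> requires. The
  product \<open>c a\<close> is then handled on homogeneous components, where it is
  \<open>a c\<close> up to sign.\<close>

lemma center_deg_mult_commutators:
  assumes a: "a \<in> center_deg A n" and "c \<in> commutators A"
  shows "fmult A a c \<in> commutators A" "fmult A c a \<in> commutators A"
proof -
  note C = commutators_subspace
  have gens: "fmult A a c \<in> commutators A" if gen: "c \<in> commutator_gens m" for c m
  proof -
    obtain x y i j u f where x: "x \<in> Obj A" and y: "y \<in> Obj A"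
      and u: "u \<in> Hom_deg A x y i" and f: "f \<in> Hom_deg A y x j"
      and c: "c = at_obj x (cmp A x y x f u) - fscl A (koszul i j) (at_obj y (cmp A y x y u f))"
      using gen by (rule commutator_gensE)
    note h = deg_hom[OF x y u] deg_hom[OF y x f]
      famD[OF center_deg_fam[OF a] x] famD[OF center_deg_fam[OF a] y]
    have af: "cmp A y x x (a x) f \<in> Hom_deg A y x (j + n)"
      using cmp_deg[OF y x x f fdegD[OF center_deg_fdeg[OF a] x]] .
    have *: "cmp A y x y u (cmp A y x x (a x) f) = scl A (koszul n i) (cmp A y y y (a y) (cmp A y x y u f))"
    proof -
      have "cmp A y x y u (cmp A y x x (a x) f) = cmp A y x y (cmp A x x y u (a x)) f"
        using cmp_assoc x y h by simp
      also have "\<dots> = scl A (koszul n i) (cmp A y y y (a y) (cmp A y x y u f))"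
        using center_deg_commute[OF a x y u] cmp_scl_left cmp_assoc cmp_hom x y h by simp
      finally show ?thesis .
    qed
    have at: "fmult A a (at_obj z w) = at_obj z (cmp A z z z (a z) w)" if "z \<in> Obj A" for z w
      using that famD[OF center_deg_fam[OF a]]
      by (auto simp: fmult_def at_obj_def fun_eq_iff cmp_0_right)
    have "at_obj x (cmp A x y x f u) \<in> fam" "at_obj y (cmp A y x y u f) \<in> fam"
      using cmp_hom x y h by (auto simp: fam_def at_obj_def hom_0)
    then have "fmult A a c = at_obj x (cmp A x y x (cmp A y x x (a x) f) u)
        - fscl A (koszul i j) (at_obj y (cmp A y y y (a y) (cmp A y x y u f)))"
      using center_deg_fam[OF a] at x y W.subspace_scale[OF fam_subspace] cmp_assoc h
      by (simp add: c fmult_diff_right fmult_scl_right)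
    also have "\<dots> = at_obj x (cmp A x y x (cmp A y x x (a x) f) u)
        - fscl A (koszul i (j + n)) (at_obj y (cmp A y x y u (cmp A y x x (a x) f)))"
      \<comment> \<open>Here \<open>koszul i (j + n)\<close> times the sign
        \<open>koszul n i\<close> from sliding \<open>a\<close> past \<open>u\<close> equals
        \<open>koszul i j\<close>.\<close>
      unfolding * by (auto simp: fscl_at_obj koszul_if)
    also have "\<dots> \<in> commutators A" using commutator_in_commutators[OF x y u af] .
    finally show ?thesis .
  qed
  have left: "fmult A a c \<in> commutators A" if "c \<in> commutators A" for c
  proof -
    have "c \<in> fam \<and> fmult A a c \<in> commutators A"
      using that unfolding commutators_span
    proof (induction rule: W.span_induct_alt)
      case base
      show ?case using fmult_0_right[OF center_deg_fam[OF a]] W.subspace_0[OF fam_subspace]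
          W.subspace_0[OF C] by (simp add: commutators_span)
    next
      case (step k d e)
      have "d \<in> commutators A" using step(1) W.span_base by (simp add: commutators_span)
      then have "d \<in> fam" using commutators_endo_sum endo_sum_fam by blast
      then show ?case using step gens center_deg_fam[OF a]
          W.subspace_add[OF fam_subspace] W.subspace_scale[OF fam_subspace]
          W.subspace_add[OF C] W.subspace_scale[OF C]
        by (auto simp: fmult_add_right fmult_scl_right simp flip: commutators_span)
    qed
    then show ?thesis by simp
  qed
  show "fmult A a c \<in> commutators A" using left assms(2) .
  \<comment> \<open>The exchange of \<open>c\<close> and \<open>a\<close> has a sign depending on
    the degree, so \<open>c\<close> is split first.\<close>
  obtain S :: "int set" and d where d: "\<And>i. d i \<in> commutators_deg i" "c = sum d S"
    using assms(2) graded_sumE unfolding commutators_graded_sum by metis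
  have fdeg: "d i \<in> fdeg i" for i
    using d(1) commutators_deg_endo_sum_deg endo_sum_deg_fdeg by blast
  then have "fmult A c a = (\<Sum>i\<in>S. fscl A (koszul n i) (fmult A a (d i)))"
    unfolding d(2) using fmult_sum_left[OF center_deg_fam[OF a], of S d]
      center_deg_fmult_commute[OF a fdeg] fdeg_fam[OF fdeg] by simp
  moreover have "fmult A a (d i) \<in> commutators A" for i
    using left d(1) commutators_deg_commutators by blast
  ultimately show "fmult A c a \<in> commutators A"
    by (auto intro!: W.subspace_sum[OF C] W.subspace_scale[OF C])
qed

section \<open>Powers of products\<close>

lemma fpow_scl: "f \<in> fam \<Longrightarrow> fpow (fscl A c f) q = fscl A (c ^ q) (fpow f q)"
  using W.subspace_scale[OF fam_subspace]
  by (induction q) (simp_all add: fmult_scl_left fmult_scl_right fpow_fam mult.commute)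

text \<open>The witness \<open>b\<close> is the q-th power of \<open>a\<close> up to sign. Later
  steps use only that it is central and homogeneous, so sign and degree stay existential.\<close>

lemma fpow_center_mult:
  assumes a: "a \<in> center_deg A m" and f: "f \<in> fdeg j"
  shows "\<exists>b n. b \<in> center_deg A n \<and> fpow (fmult A a f) q = fmult A b (fpow f q)"
proof (induction q)
  case 0
  show ?case using fone_center fmult_fone(1)[OF fdeg_fam[OF fone_fdeg]] by auto
next
  case (Suc q)
  then obtain b n where b: "b \<in> center_deg A n" "fpow (fmult A a f) q = fmult A b (fpow f q)" by blast
  have fam: "a \<in> fam" "b \<in> fam" "f \<in> fam" "fpow f q \<in> fam"
    using a b(1) f center_deg_fam fdeg_fam fpow_fam by blast+
  have "fpow (fmult A a f) (Suc q) = fmult A (fmult A a f) (fmult A b (fpow f q))"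
    using b(2) by simp
  also have "\<dots> = fmult A a (fmult A (fmult A f b) (fpow f q))"
    using fam fmult_fam by (simp add: fmult_assoc)
  also have "\<dots> = fmult A (fscl A (koszul n j) (fmult A a b)) (fpow f (Suc q))"
    using fam fmult_fam center_deg_fmult_commute[OF b(1) f]
    by (simp add: fmult_assoc fmult_scl_left fmult_scl_right)
  finally show ?case
    using W.subspace_scale[OF center_deg_subspace center_deg_mult[OF a b(1)]] by blast
qed

text \<open>With \<open>v = u (f u)^q\<close> one has \<open>(f u)^(q+1) = f v\<close> and
  \<open>(u f)^(q+1) = v f\<close>. The powers are thus again the two halves of a commutator
  generator.\<close>

lemma fpow_at_obj_cmp:
  assumes xy: "x \<in> Obj A" "y \<in> Obj A" and u: "u \<in> Hom_deg A x y i" and f: "f \<in> Hom_deg A y x j"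
  shows "\<exists>v\<in>Hom_deg A x y (i + int q * (i + j)).
    fpow (at_obj x (cmp A x y x f u)) (Suc q) = at_obj x (cmp A x y x f v) \<and>
    fpow (at_obj y (cmp A y x y u f)) (Suc q) = at_obj y (cmp A y x y v f)"
proof (induction q)
  case 0
  have "at_obj x (cmp A x y x f u) \<in> fam" "at_obj y (cmp A y x y u f) \<in> fam"
    using cmp_hom xy deg_hom[OF xy u] deg_hom[OF xy(2,1) f] by (auto simp: fam_def at_obj_def hom_0)
  then show ?case using u by (auto simp: fmult_fone)
next
  case (Suc q)
  then obtain v where v: "v \<in> Hom_deg A x y (i + int q * (i + j))"
    "fpow (at_obj x (cmp A x y x f u)) (Suc q) = at_obj x (cmp A x y x f v)"
    "fpow (at_obj y (cmp A y x y u f)) (Suc q) = at_obj y (cmp A y x y v f)" by blast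
  define w where "w = cmp A x x y u (cmp A x y x f v)"
  note h = deg_hom[OF xy u] deg_hom[OF xy(2,1) f] deg_hom[OF xy v(1)]
  have "w \<in> Hom_deg A x y (i + int q * (i + j) + j + i)"
    unfolding w_def by (rule cmp_deg[OF xy(1,1,2) cmp_deg[OF xy xy(1) v(1) f] u])
  moreover have "i + int q * (i + j) + j + i = i + int (Suc q) * (i + j)" by (simp add: algebra_simps)
  moreover have "fpow (at_obj x (cmp A x y x f u)) (Suc (Suc q)) = at_obj x (cmp A x y x f w)"
  proof -
    have "fpow (at_obj x (cmp A x y x f u)) (Suc (Suc q)) =
        fmult A (at_obj x (cmp A x y x f u)) (at_obj x (cmp A x y x f v))"
      unfolding v(2)[symmetric] by simp
    then show ?thesis using xy h cmp_hom by (simp add: fmult_at_obj w_def cmp_assoc)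
  qed
  moreover have "fpow (at_obj y (cmp A y x y u f)) (Suc (Suc q)) = at_obj y (cmp A y x y w f)"
  proof -
    have "fpow (at_obj y (cmp A y x y u f)) (Suc (Suc q)) =
        fmult A (at_obj y (cmp A y x y u f)) (at_obj y (cmp A y x y v f))"
      unfolding v(3)[symmetric] by simp
    then show ?thesis using xy h cmp_hom by (simp add: fmult_at_obj w_def cmp_assoc)
  qed
  ultimately show ?case by metis
qed

end

locale graded_cat_char = graded_cat A
  for A :: "('k::field, 'o, 'm::ab_group_add) gcat" +
  fixes p :: nat
  assumes char: "CHAR('k) = p" and p_pos: "p > 0"
begin

lemma of_nat_p [simp]: "of_nat p = (0 :: 'k)"
  using of_nat_CHAR[where 'a = 'k] by (simp add: char)

lemma of_nat_nonzero: "0 < k \<Longrightarrow> k < p \<Longrightarrow> of_nat k \<noteq> (0 :: 'k)"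
  using of_nat_eq_0_iff_char_dvd[of k, where 'a = 'k] by (auto simp: char dest: dvd_imp_le)

text \<open>If \<open>p = 2 m\<close>, then \<open>m < p\<close> is nonzero in the field, which
  forces \<open>2 = 0\<close>. So either all signs are trivial or \<open>p - 1\<close> is even, and
  this dichotomy settles every sign involving \<open>p\<close>.\<close>

lemma even_p_minus_1:
  assumes "even p"
  shows "- 1 = (1 :: 'k)"
proof -
  from assms obtain m where m: "p = 2 * m" by blast
  then have "of_nat 2 * of_nat m = (0 :: 'k)" using of_nat_p by (metis of_nat_mult)
  moreover have "of_nat m \<noteq> (0 :: 'k)" using of_nat_nonzero m p_pos by simp
  ultimately have "1 + 1 = (0 :: 'k)" by simp
  then show ?thesis by (simp add: eq_neg_iff_add_eq_0 neg_eq_iff_add_eq_0)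
qed

lemma word_prod_rotate1:
  assumes "set fs \<subseteq> endo_sum_deg A n" "length fs = p"
  shows "word_prod fs - word_prod (rotate1 fs) \<in> commutators A"
proof (cases fs)
  case (Cons f gs)
  have f: "f \<in> endo_sum_deg A n" and gs: "set gs \<subseteq> fdeg n"
    using assms(1) endo_sum_deg_fdeg by (auto simp: Cons)
  have fam: "f \<in> fam" "set gs \<subseteq> fam" using f gs endo_sum_deg_fam fdeg_fam by blast+
  have "koszul (int (length gs) * n) n = (1 :: 'k)"
    using assms(2) even_p_minus_1 by (cases "even p") (auto simp: Cons koszul_if)
  then have "fmult A f (word_prod gs) - fmult A (word_prod gs) f \<in> commutators A"
    using fmult_commutator[OF f word_prod_fdeg[OF gs]] by simp
  then show ?thesis using fam by (simp add: Cons word_prod_append fmult_fone)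
qed (use W.subspace_0[OF commutators_subspace] in simp)

lemma word_prod_rotate:
  assumes "set fs \<subseteq> endo_sum_deg A n" "length fs = p"
  shows "word_prod fs - word_prod (rotate i fs) \<in> commutators A"
proof (induction i)
  case (Suc i)
  have "word_prod (rotate i fs) - word_prod (rotate1 (rotate i fs)) \<in> commutators A"
    by (rule word_prod_rotate1) (use assms in auto)
  from W.subspace_add[OF commutators_subspace Suc this] show ?case by simp
qed (use W.subspace_0[OF commutators_subspace] in simp)

text \<open>The sum \<open>S\<close> of the words with \<open>k\<close> letters \<open>f\<close> satisfies \<open>k S = \<Sum>\<^sub>i S\<^sub>i\<close>, where
  \<open>S\<^sub>i\<close> runs over the words with an \<open>f\<close> in position \<open>i\<close>. Rotating the words shows that all
  \<open>S\<^sub>i\<close> agree modulo commutators, whence \<open>k S = p S\<^sub>0 = 0\<close>.\<close>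

lemma sum_mixed_words:
  assumes f: "f \<in> endo_sum_deg A n" and g: "g \<in> endo_sum_deg A n" and k: "0 < k" "k < p"
  shows "(\<Sum>w | length w = p \<and> count_list w True = k. word_prod (map (\<lambda>b. if b then f else g) w))
    \<in> commutators A"
proof -
  define P where "P = (\<lambda>w. word_prod (map (\<lambda>b. if b then f else g) w))"
  define W where "W = {w. length w = p \<and> count_list w True = k}"
  \<comment> \<open>The indicator of a letter \<open>f\<close> in position \<open>i\<close>, valued
    in the field so that it can serve as a coefficient.\<close>
  define N where "N = (\<lambda>w i. if w ! i then 1 else (0 :: 'k))"
  have "finite {w :: bool list. length w = p}"
    using finite_lists_length_eq[of "UNIV :: bool set"] by simp
  then have fin: "finite W" by (rule rev_finite_subset) (auto simp: W_def)
  have rot: "(\<Sum>w\<in>W. fscl A (N w i) (P w)) - (\<Sum>w\<in>W. fscl A (N w 0) (P w)) \<in> commutators A"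
    if i: "i < p" for i
  proof -
    have count_rotate1: "count_list (rotate1 w) b = count_list w b" for w :: "bool list" and b
      by (cases w) auto
    have count: "count_list (rotate i w) b = count_list w b" for w :: "bool list" and b
      by (induction i) (auto simp: count_rotate1)
    have "rotate i ` W \<subseteq> W" by (auto simp: W_def count)
    moreover have inj: "inj_on (rotate i) W"
      by (rule inj_on_subset[OF inj_fn[OF inj_rotate1, of i, folded rotate_def]]) simp
    \<comment> \<open>Rotation keeps length and letter counts, so it permutes \<open>W\<close>. It
      moves the letter in position \<open>i\<close> to position 0, which turns the weight
      \<open>N w 0\<close> into \<open>N w i\<close>.\<close>
    ultimately have "bij_betw (rotate i) W W"
      using endo_inj_surj[OF fin] by (auto simp: bij_betw_def)
    then have "(\<Sum>w\<in>W. fscl A (N w 0) (P w)) = (\<Sum>w\<in>W. fscl A (N (rotate i w) 0) (P (rotate i w)))"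
      using sum.reindex_bij_betw[of "rotate i" W W "\<lambda>w. fscl A (N w 0) (P w)"] by simp
    also have "\<dots> = (\<Sum>w\<in>W. fscl A (N w i) (P (rotate i w)))"
      using i by (intro sum.cong) (auto simp: W_def N_def nth_rotate)
    finally have "(\<Sum>w\<in>W. fscl A (N w i) (P w)) - (\<Sum>w\<in>W. fscl A (N w 0) (P w)) =
        (\<Sum>w\<in>W. fscl A (N w i) (P w - P (rotate i w)))"
      by (simp add: sum_subtractf W.scale_right_diff_distrib)
    moreover have "P w - P (rotate i w) \<in> commutators A" if "w \<in> W" for w
      using word_prod_rotate[of "map (\<lambda>b. if b then f else g) w" n i] f g that
      by (auto simp: P_def W_def rotate_map)
    ultimately show ?thesis
      using W.subspace_sum[OF commutators_subspace, of W]
        W.subspace_scale[OF commutators_subspace] by simp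
  qed
  have N_sum: "(\<Sum>i<p. N w i) = of_nat k" if "w \<in> W" for w
  proof -
    have "count_list v True = card {i. i < length v \<and> v ! i}" for v
      using length_filter_conv_card[of "(=) True" v] by (simp add: count_list_eq_length_filter)
    then have "k = card {i. i < p \<and> w ! i}" using that by (auto simp: W_def)
    then show ?thesis
      by (simp add: N_def sum.If_cases) (rule arg_cong[where f = "\<lambda>S. of_nat (card S)"], auto)
  qed
  have "fscl A (of_nat k) (sum P W) = (\<Sum>w\<in>W. fscl A (\<Sum>i<p. N w i) (P w))"
    using N_sum by (simp add: W.scale_sum_right)
  also have "\<dots> = (\<Sum>i<p. \<Sum>w\<in>W. fscl A (N w i) (P w))"
    unfolding W.scale_sum_left by (rule sum.swap)
  \<comment> \<open>The subtracted term does not depend on \<open>i\<close>; it is taken away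
    \<open>p\<close> times in total, which is zero in characteristic \<open>p\<close>.\<close>
  also have "\<dots> = (\<Sum>i<p. (\<Sum>w\<in>W. fscl A (N w i) (P w)) - (\<Sum>w\<in>W. fscl A (N w 0) (P w)))"
    by (simp add: sum_subtractf W.sum_constant_scale)
  also have "\<dots> \<in> commutators A"
    by (rule W.subspace_sum[OF commutators_subspace]) (use rot in simp)
  finally have "fscl A (inverse (of_nat k)) (fscl A (of_nat k) (sum P W)) \<in> commutators A"
    by (rule W.subspace_scale[OF commutators_subspace])
  then show ?thesis using of_nat_nonzero[OF k] by (simp add: P_def W_def)
qed

lemma fpow_p_add:
  assumes f: "f \<in> endo_sum_deg A n" and g: "g \<in> endo_sum_deg A n"
  shows "fpow (f + g) p - (fpow f p + fpow g p) \<in> commutators A"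
proof -
  define P where "P = (\<lambda>w. word_prod (map (\<lambda>b. if b then f else g) w))"
  define Q where "Q = (\<lambda>k. \<Sum>w | length w = p \<and> count_list w True = k. P w)"
  have fin: "finite {w :: bool list. length w = p}"
    using finite_lists_length_eq[of "UNIV :: bool set"] by simp
  have length: "length w = count_list w True + count_list w False" for w by (induction w) auto
  have count0: "w = replicate (length w) (\<not> b)" if "count_list w b = 0" for w b
    using that by (induction w) (auto split: if_splits)
  have replicate: "count_list (replicate n b) c = (if b = c then n else 0)" for n and b c :: bool
    by (induction n) auto
  have "fpow (f + g) p = sum P {w. length w = p}"
    using fpow_add f g endo_sum_deg_fam unfolding P_def by blast
  \<comment> \<open>The words are grouped by their number \<open>k\<close> of letters
    \<open>f\<close>. The extreme values 0 and \<open>p\<close> give the pure powers of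
    \<open>g\<close> and \<open>f\<close>.\<close>
  also have "\<dots> = (\<Sum>k\<le>p. \<Sum>w\<in>{w \<in> {w. length w = p}. count_list w True = k}. P w)"
    by (rule sum.group[symmetric]) (use fin in \<open>auto simp: length\<close>)
  also have "\<dots> = (\<Sum>k\<le>p. Q k)" by (simp add: Q_def)
  also have "{..p} = insert 0 (insert p {0<..<p})" using p_pos by auto
  finally have "fpow (f + g) p = Q 0 + (Q p + sum Q {0<..<p})" using p_pos by simp
  moreover have "{w. length w = p \<and> count_list w True = 0} = {replicate p False}"
    "{w. length w = p \<and> count_list w True = p} = {replicate p True}"
    using count0[of _ True] count0[of _ False] length by (auto simp: replicate)
  then have "Q 0 = fpow g p" "Q p = fpow f p" by (simp_all add: Q_def P_def)
  moreover have "sum Q {0<..<p} \<in> commutators A"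
    by (rule W.subspace_sum[OF commutators_subspace])
      (use sum_mixed_words[OF f g] in \<open>simp add: Q_def P_def\<close>)
  ultimately show ?thesis by simp
qed

section \<open>The p-th power map modulo commutators\<close>

abbreviation pw :: "('o \<Rightarrow> 'm) \<Rightarrow> 'o \<Rightarrow> 'm" where
  "pw f \<equiv> fpower A f p"

lemma pw_fpow: "f \<in> fam \<Longrightarrow> pw f = fpow f p"
  using fpower_eq_fpow p_pos by blast

lemma pw_0: "pw 0 = 0"
proof -
  have "fpow 0 p = 0"
    using p_pos fmult_0_left[OF fpow_fam] W.subspace_0[OF fam_subspace] by (cases p) auto
  then show ?thesis using pw_fpow W.subspace_0[OF fam_subspace] by simp
qed

lemma pw_deg:
  assumes "f \<in> endo_sum_deg A n"
  shows "pw f \<in> endo_sum_deg A (int p * n)"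
proof -
  \<comment> \<open>One factor is split off to provide finite support; of \<open>fpow f q\<close>
    only membership in \<open>fdeg\<close> is known at this point.\<close>
  obtain q where q: "p = Suc q" using p_pos gr0_implies_Suc by blast
  have "set (replicate q f) \<subseteq> fdeg n" using assms endo_sum_deg_fdeg by auto
  from word_prod_fdeg[OF this] have "fpow f p \<in> endo_sum_deg A (n + int q * n)"
    using endo_sum_deg_fmult(2)[OF _ assms] by (simp add: q)
  then show ?thesis using pw_fpow endo_sum_deg_fam[OF assms] by (simp add: q distrib_right)
qed

lemma pw_scl: "f \<in> fam \<Longrightarrow> pw (fscl A c f) = fscl A (c ^ p) (pw f)"
  using pw_fpow fpow_scl W.subspace_scale[OF fam_subspace] by simp

lemma pw_add:
  assumes "f \<in> endo_sum_deg A n" "g \<in> endo_sum_deg A n"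
  shows "pw (f + g) - (pw f + pw g) \<in> commutators A"
  using fpow_p_add[OF assms] assms endo_sum_deg_fam pw_fpow W.subspace_add[OF fam_subspace] by simp

text \<open>Modulo commutators the power of \<open>X + z Y\<close> is the sum of the powers of
  \<open>X\<close> and \<open>z Y\<close>. By \<open>fpow_at_obj_cmp\<close> this is the generator
  of \<open>v\<close> and \<open>f\<close>, once the sign \<open>z ^ p\<close> is seen to
  match.\<close>

lemma pw_commutator_gen:
  assumes "g \<in> commutator_gens n"
  shows "pw g \<in> commutators A"
proof -
  obtain x y i j u f where xy: "x \<in> Obj A" "y \<in> Obj A"
    and u: "u \<in> Hom_deg A x y i" and f: "f \<in> Hom_deg A y x j" and n: "i + j = n"
    and g: "g = at_obj x (cmp A x y x f u) - fscl A (koszul i j) (at_obj y (cmp A y x y u f))"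
    using assms by (rule commutator_gensE)
  obtain q where q: "p = Suc q" using p_pos gr0_implies_Suc by blast
  define X where "X = at_obj x (cmp A x y x f u)"
  define Y where "Y = at_obj y (cmp A y x y u f)"
  have X: "X \<in> endo_sum_deg A n"
    using at_obj_endo_sum_deg[OF xy(1) cmp_deg[OF xy xy(1) u f]] n by (simp add: X_def)
  have Y: "Y \<in> endo_sum_deg A n"
    using at_obj_endo_sum_deg[OF xy(2) cmp_deg[OF xy(2,1,2) f u]] n by (simp add: Y_def add.commute)
  obtain v where v: "v \<in> Hom_deg A x y (i + int q * (i + j))"
    "fpow X p = at_obj x (cmp A x y x f v)" "fpow Y p = at_obj y (cmp A y x y v f)"
    using fpow_at_obj_cmp[OF xy u f, of q] unfolding q X_def Y_def by blast
  define z :: 'k where "z = - koszul i j"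
  \<comment> \<open>For odd \<open>p\<close> the number \<open>q\<close> is even, so the degree of
    \<open>v\<close> has the parity of \<open>i\<close>, and an odd power keeps the sign
    \<open>z\<close>. For even \<open>p\<close> all signs are 1.\<close>
  have z: "z ^ p = - koszul (i + int q * (i + j)) j"
    using even_p_minus_1 by (cases "even p") (auto simp: z_def q koszul_if)
  have "pw X = at_obj x (cmp A x y x f v)" "pw (fscl A z Y) = fscl A (z ^ p) (at_obj y (cmp A y x y v f))"
    using pw_scl pw_fpow X Y endo_sum_deg_fam v by simp_all
  then have *: "pw X + pw (fscl A z Y) \<in> commutators A"
    using commutator_in_commutators[OF xy v(1) f] by (simp add: z)
  have "g = X + fscl A z Y" by (simp add: g X_def Y_def z_def)
  then have "pw g - (pw X + pw (fscl A z Y)) \<in> commutators A"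
    using pw_add[OF X W.subspace_scale[OF endo_sum_deg_subspace Y]] by simp
  from W.subspace_add[OF commutators_subspace this *] show ?thesis by simp
qed

text \<open>Within one degree \<open>pw\<close> is Frobenius-semilinear modulo commutators, which
  reduces the claim to generators. The induction also carries membership in
  \<open>endo_sum_deg A n\<close>, the domain of that additivity.\<close>

lemma pw_commutators_deg:
  assumes "c \<in> commutators_deg n"
  shows "pw c \<in> commutators A"
proof -
  note C = commutators_subspace
  have "c \<in> endo_sum_deg A n \<and> pw c \<in> commutators A"
    using assms unfolding commutators_deg_def
  proof (induction rule: W.span_induct_alt)
    case base
    show ?case using pw_0 W.subspace_0[OF C] W.subspace_0[OF endo_sum_deg_subspace] by simp
  next
    case (step k d e)
    have d: "d \<in> endo_sum_deg A n"
      using step(1) commutators_deg_endo_sum_deg W.span_base unfolding commutators_deg_def by blast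
    then have kd: "fscl A k d \<in> endo_sum_deg A n" by (rule W.subspace_scale[OF endo_sum_deg_subspace])
    have e: "e \<in> endo_sum_deg A n" "pw e \<in> commutators A" using step(2) by blast+
    have "pw (fscl A k d) \<in> commutators A"
      using pw_scl[OF endo_sum_deg_fam[OF d]] pw_commutator_gen[OF step(1)] W.subspace_scale[OF C] by simp
    from W.subspace_add[OF C pw_add[OF kd e(1)] W.subspace_add[OF C this e(2)]]
    show ?case using W.subspace_add[OF endo_sum_deg_subspace kd e(1)] by simp
  qed
  then show ?thesis by simp
qed

lemma pw_commutators:
  assumes "c \<in> commutators A" "c \<in> endo_sum_deg A n"
  shows "pw c \<in> commutators A"
  using pw_commutators_deg[OF commutators_homogeneous[OF assms(1) endo_sum_deg_fdeg[OF assms(2)]]] .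

lemma pw_cong:
  assumes f: "f \<in> endo_sum_deg A n" and g: "g \<in> endo_sum_deg A n" and fg: "f - g \<in> commutators A"
  shows "pw f - pw g \<in> commutators A"
proof -
  have d: "f - g \<in> endo_sum_deg A n" by (rule W.subspace_diff[OF endo_sum_deg_subspace f g])
  from W.subspace_add[OF commutators_subspace pw_add[OF g d] pw_commutators[OF fg d]]
  show ?thesis by simp
qed

lemma endo_component_decomposes:
  assumes "decomposes fdeg f c"
  shows "endo_component A f n = c n"
proof
  fix x
  show "endo_component A f n x = c n x"
    using component_hom[OF _ _ decomposes_fdeg[OF assms]] assms
    by (auto simp: endo_component_def decomposes_def fdeg_def)
qed

subsection \<open>The annihilators \<open>K\<^sub>r\<^sub>,\<^sub>s\<close>\<close>

text \<open>Representatives \<open>f + c\<close> of the class of a homogeneous \<open>f\<close> may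
  be inhomogeneous. Each component of \<open>c\<close> is a commutator, so \<open>pw_cong\<close>
  applies separately in every degree.\<close>

lemma xi_cong:
  assumes f: "f \<in> endo_sum_deg A i" and c: "c \<in> commutators A"
  shows "xi A p (f + c) - pw f \<in> commutators A"
proof -
  obtain S d where S: "finite S" and d: "\<And>n. d n \<in> commutators_deg n" "\<And>n. n \<notin> S \<Longrightarrow> d n = 0" "c = sum d S"
    using c graded_sumE[of c commutators_deg] unfolding commutators_graded_sum by metis
  define F where "F = (\<lambda>n. if n = i then f else 0)"
  have F: "F n \<in> endo_sum_deg A n" for n
    using f W.subspace_0[OF endo_sum_deg_subspace] by (simp add: F_def)
  have dE: "d n \<in> endo_sum_deg A n" for n using d(1) commutators_deg_endo_sum_deg by blast
  have sums: "sum F (insert i S) = f" "sum d (insert i S) = c" "(\<Sum>n\<in>insert i S. pw (F n)) = pw f"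
    using S d(2,3) by (auto simp: F_def pw_0 if_distrib[of pw] sum.insert_if sum.neutral
        intro: sum.mono_neutral_right cong: if_cong)
  have "decomposes fdeg (f + c) (\<lambda>n. F n + d n)"
  proof (rule decomposesI[of _ _ "insert i S"])
    show "F n + d n \<in> fdeg n" for n
      by (rule W.subspace_add[OF fdeg_subspace endo_sum_deg_fdeg[OF F] endo_sum_deg_fdeg[OF dE]])
  qed (use S d(2) sums in \<open>auto simp: F_def sum.distrib\<close>)
  from endo_component_decomposes[OF this]
  have "xi A p (f + c) = (\<Sum>n | F n + d n \<noteq> 0. pw (F n + d n))" by (simp add: xi_def)
  \<comment> \<open>Extending the range is harmless because \<open>pw 0 = 0\<close>.\<close>
  also have "\<dots> = (\<Sum>n\<in>insert i S. pw (F n + d n))"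
    by (rule sum.mono_neutral_left) (use S d(2) pw_0 in \<open>auto simp: F_def split: if_splits\<close>)
  finally have "xi A p (f + c) - pw f = (\<Sum>n\<in>insert i S. pw (F n + d n) - pw (F n))"
    using sums(3) by (simp add: sum_subtractf)
  also have "\<dots> \<in> commutators A"
  proof (rule W.subspace_sum[OF commutators_subspace])
    show "pw (F n + d n) - pw (F n) \<in> commutators A" for n
      by (rule pw_cong[OF W.subspace_add[OF endo_sum_deg_subspace F dE] F])
        (use d(1) commutators_deg_commutators in auto)
  qed
  finally show ?thesis .
qed

lemma induced_xi: "f \<in> endo_sum_deg A i \<Longrightarrow> induced A (xi A p) (ab_class A f) = ab_class A (pw f)"
  by (intro induced_ab_class xi_cong)

lemma pw_funpow_deg:
  "f \<in> endo_sum_deg A i \<Longrightarrow> (pw ^^ r) f \<in> endo_sum_deg A (int p ^ r * i)"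
  by (induction r) (use pw_deg in \<open>auto simp: mult.assoc\<close>)

lemma induced_xi_funpow:
  assumes "f \<in> endo_sum_deg A i"
  shows "(induced A (xi A p) ^^ r) (ab_class A f) = ab_class A ((pw ^^ r) f)"
  by (induction r) (use induced_xi[OF pw_funpow_deg[OF assms]] in auto)

lemma T_deg_iff:
  "X \<in> T_deg A p r i \<longleftrightarrow>
    (\<exists>f\<in>endo_sum_deg A i. X = ab_class A f \<and> (pw ^^ r) f \<in> commutators A)"
proof -
  have "ab_class A f \<in> T A p r \<longleftrightarrow> (pw ^^ r) f \<in> commutators A" if "f \<in> endo_sum_deg A i" for f
    using induced_xi_funpow[OF that] endo_sum_deg_endo_sum[OF that]
    by (simp add: T_def abel_def ab_class_eq_0)
  then show ?thesis unfolding T_deg_def abel_deg_def by blast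
qed

lemma left_act_ab_class:
  assumes a: "a \<in> center_deg A n" and f: "f \<in> endo_sum A"
  shows "left_act A a (ab_class A f) = ab_class A (fmult A a f)"
  unfolding left_act_def
proof (rule induced_ab_class)
  fix c assume c: "c \<in> commutators A"
  have "fmult A a (f + c) - fmult A a f = fmult A a c"
    using fmult_add_right center_deg_fam[OF a] endo_sum_fam f c commutators_endo_sum by fastforce
  then show "fmult A a (f + c) - fmult A a f \<in> commutators A"
    using center_deg_mult_commutators(1)[OF a c] by simp
qed

lemma right_act_ab_class:
  assumes a: "a \<in> center_deg A n" and f: "f \<in> endo_sum A"
  shows "right_act A (ab_class A f) a = ab_class A (fmult A f a)"
  unfolding right_act_def
proof (rule induced_ab_class)
  fix c assume c: "c \<in> commutators A"
  have "fmult A (f + c) a - fmult A f a = fmult A c a"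
    using fmult_add_left center_deg_fam[OF a] endo_sum_fam f c commutators_endo_sum by fastforce
  then show "fmult A (f + c) a - fmult A f a \<in> commutators A"
    using center_deg_mult_commutators(2)[OF a c] by simp
qed

section \<open>The annihilators degree by degree\<close>

text \<open>For homogeneous \<open>f\<close> the products \<open>f a\<close> and \<open>a f\<close>
  differ by an invertible sign, so both annihilation conditions amount to the same condition on a
  representative.\<close>

lemma Krs_deg_iff:
  "a \<in> Krs_deg A p r s n \<longleftrightarrow> a \<in> center_deg A n \<and>
    (\<forall>f\<in>endo_sum_deg A (s - n). (pw ^^ r) f \<in> commutators A \<longrightarrow> fmult A a f \<in> commutators A)"
proof (cases "a \<in> center_deg A n")
  case True
  have act: "left_act A a (ab_class A f) = ab_class A 0 \<and> right_act A (ab_class A f) a = ab_class A 0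
      \<longleftrightarrow> fmult A a f \<in> commutators A"
    if "f \<in> endo_sum_deg A (s - n)" for f
  proof -
    have "fmult A f a = fscl A (koszul n (s - n)) (fmult A a f)"
      by (rule center_deg_fmult_commute[OF True endo_sum_deg_fdeg[OF that]])
    then have "fmult A f a \<in> commutators A \<longleftrightarrow> fmult A a f \<in> commutators A"
      using W.subspace_scale[OF commutators_subspace, of _ "koszul n (s - n)"] by fastforce
    then show ?thesis
      using left_act_ab_class[OF True] right_act_ab_class[OF True] endo_sum_deg_endo_sum[OF that]
      by (auto simp: ab_class_eq_0)
  qed
  have "a \<in> Krs_deg A p r s n \<longleftrightarrow> (\<forall>f\<in>endo_sum_deg A (s - n). (pw ^^ r) f \<in> commutators A \<longrightarrow>
      left_act A a (ab_class A f) = ab_class A 0 \<and> right_act A (ab_class A f) a = ab_class A 0)"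
    using True by (auto simp: Krs_deg_def T_deg_iff)
  then show ?thesis using True act by simp
qed (simp add: Krs_deg_def)

lemma Krs_deg_center_deg: "Krs_deg A p r s n \<subseteq> center_deg A n"
  by (auto simp: Krs_deg_def)

lemma Krs_deg_subspace: "W.subspace (Krs_deg A p r s n)"
proof (rule W.subspaceI)
  note C = commutators_subspace and Z = center_deg_subspace
  show "0 \<in> Krs_deg A p r s n"
    using W.subspace_0[OF C] W.subspace_0[OF Z] fmult_0_left endo_sum_deg_fam
    by (simp add: Krs_deg_iff)
  fix a assume a: "a \<in> Krs_deg A p r s n"
  then have af: "a \<in> fam" using Krs_deg_center_deg center_deg_fam by blast
  show "fscl A c a \<in> Krs_deg A p r s n" for c
    unfolding Krs_deg_iff
  proof (intro conjI ballI impI)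
    fix f assume "f \<in> endo_sum_deg A (s - n)" "(pw ^^ r) f \<in> commutators A"
    then have "f \<in> fam" "fmult A a f \<in> commutators A"
      using a endo_sum_deg_fam by (auto simp: Krs_deg_iff)
    then show "fmult A (fscl A c a) f \<in> commutators A"
      using fmult_scl_left[OF af] W.subspace_scale[OF C] by simp
  qed (use a W.subspace_scale[OF Z] in \<open>simp add: Krs_deg_iff\<close>)
  fix b assume b: "b \<in> Krs_deg A p r s n"
  then have bf: "b \<in> fam" using Krs_deg_center_deg center_deg_fam by blast
  show "a + b \<in> Krs_deg A p r s n"
    unfolding Krs_deg_iff
  proof (intro conjI ballI impI)
    fix f assume "f \<in> endo_sum_deg A (s - n)" "(pw ^^ r) f \<in> commutators A"
    then have "f \<in> fam" "fmult A a f \<in> commutators A" "fmult A b f \<in> commutators A"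
      using a b endo_sum_deg_fam by (auto simp: Krs_deg_iff)
    then show "fmult A (a + b) f \<in> commutators A"
      using fmult_add_left[OF af bf] W.subspace_add[OF C] by simp
  qed (use a b W.subspace_add[OF Z] in \<open>simp add: Krs_deg_iff\<close>)
qed

lemma pw_funpow_center_mult:
  assumes a: "a \<in> center_deg A m" and f: "f \<in> endo_sum_deg A j"
  shows "\<exists>b n. b \<in> center_deg A n \<and> (pw ^^ r) (fmult A a f) = fmult A b ((pw ^^ r) f)"
proof (induction r)
  case 0
  show ?case using a by auto
next
  case (Suc r)
  then obtain b n where b: "b \<in> center_deg A n" "(pw ^^ r) (fmult A a f) = fmult A b ((pw ^^ r) f)"
    by blast
  have "(pw ^^ r) f \<in> fdeg (int p ^ r * j)" using pw_funpow_deg[OF f] endo_sum_deg_fdeg by blast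
  from fpow_center_mult[OF b(1) this, of p] show ?case
    using pw_fpow[OF fmult_fam] center_deg_fam[OF b(1)] fdeg_fam[OF \<open>(pw ^^ r) f \<in> _\<close>] b(2) pw_fpow
    by simp
qed

text \<open>Up to sign, \<open>(a h) f\<close> is \<open>h (a f)\<close>. Multiplication by
  \<open>a\<close> keeps \<open>f\<close> in the kernel of the iterated power map and raises its
  degree from \<open>s - (m + n)\<close> to \<open>s - n\<close>, the degree in which
  \<open>h\<close> annihilates.\<close>

lemma Krs_deg_mult:
  assumes a: "a \<in> center_deg A m" and h: "h \<in> Krs_deg A p r s n"
  shows "fmult A a h \<in> Krs_deg A p r s (m + n)"
  unfolding Krs_deg_iff
proof (intro conjI ballI impI)
  have hc: "h \<in> center_deg A n" using h by (simp add: Krs_deg_iff)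
  show "fmult A a h \<in> center_deg A (m + n)" by (rule center_deg_mult[OF a hc])
  fix f assume f: "f \<in> endo_sum_deg A (s - (m + n))" and "(pw ^^ r) f \<in> commutators A"
  then have "(pw ^^ r) (fmult A a f) \<in> commutators A"
    using pw_funpow_center_mult[OF a f, of r] center_deg_mult_commutators(1) by auto
  moreover have "fmult A a f \<in> endo_sum_deg A (s - n)"
    using endo_sum_deg_fmult(1)[OF center_deg_fdeg[OF a] f] by simp
  ultimately have "fmult A h (fmult A a f) \<in> commutators A" using h by (simp add: Krs_deg_iff)
  then have "fmult A (fmult A h a) f \<in> commutators A"
    using fmult_assoc center_deg_fam[OF a] center_deg_fam[OF hc] endo_sum_deg_fam[OF f] by simp
  moreover have "fmult A (fmult A a h) f = fscl A (koszul n m) (fmult A (fmult A h a) f)"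
    using center_deg_fmult_commute[OF hc center_deg_fdeg[OF a]] fmult_scl_left[OF fmult_fam]
      center_deg_fam[OF a] center_deg_fam[OF hc] endo_sum_deg_fam[OF f] by simp
  ultimately show "fmult A (fmult A a h) f \<in> commutators A"
    using W.subspace_scale[OF commutators_subspace] by simp
qed

text \<open>For \<open>r = 0\<close> the tested \<open>f\<close> are themselves commutators, and
  these are stable under central multiplication.\<close>

lemma Krs_deg_0: "Krs_deg A p 0 s n = center_deg A n"
  using center_deg_mult_commutators(1) by (auto simp: Krs_deg_iff)

lemma Krs_deg_Suc: "Krs_deg A p (Suc r) s n \<subseteq> Krs_deg A p r s n"
  using pw_commutators pw_funpow_deg by (fastforce simp: Krs_deg_iff)

lemma graded_ideal_Krs: "graded_ideal (fscl A) (center_deg A) (center_ring A) (Krs A p r s)"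
  unfolding Krs_def
  by (rule graded_ideal_graded_sum[OF Krs_deg_subspace Krs_deg_center_deg Krs_deg_mult])

lemma Krs_0: "Krs A p 0 s = center A"
  unfolding Krs_def center_def by (rule arg_cong[where f = graded_sum]) (simp add: fun_eq_iff Krs_deg_0)

lemma Krs_Suc: "Krs A p (Suc r) s \<subseteq> Krs A p r s"
  unfolding Krs_def by (rule graded_sum_mono) (rule Krs_deg_Suc)

end

subsection \<open>Functors\<close>

text \<open>Asks only that degrees are respected, so that it covers an equivalence and its
  quasi-inverse alike.\<close>

locale graded_functor =
  A: graded_cat_char A p + B: graded_cat_char B p
  for A :: "('k::field, 'o, 'm::ab_group_add) gcat"
    and B :: "('k, 'o2, 'm2::ab_group_add) gcat"
    and p :: nat +
  fixes Fo :: "'o \<Rightarrow> 'o2" and Fm :: "'o \<Rightarrow> 'o \<Rightarrow> 'm \<Rightarrow> 'm2"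
  assumes is_functor: "is_functor A B Fo Fm"
    and F_deg: "\<lbrakk>x \<in> Obj A; y \<in> Obj A; f \<in> Hom_deg A x y i\<rbrakk> \<Longrightarrow> Fm x y f \<in> Hom_deg B (Fo x) (Fo y) i"
begin

lemma F_obj: "x \<in> Obj A \<Longrightarrow> Fo x \<in> Obj B"
  using is_functor by (simp add: is_functor_def)

lemma F_hom: "x \<in> Obj A \<Longrightarrow> y \<in> Obj A \<Longrightarrow> f \<in> Hom A x y \<Longrightarrow> Fm x y f \<in> Hom B (Fo x) (Fo y)"
  using is_functor by (simp add: is_functor_def)

lemma F_add:
  "x \<in> Obj A \<Longrightarrow> y \<in> Obj A \<Longrightarrow> f \<in> Hom A x y \<Longrightarrow> g \<in> Hom A x y \<Longrightarrow>
    Fm x y (f + g) = Fm x y f + Fm x y g"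
  using is_functor by (simp add: is_functor_def)

lemma F_scl:
  "x \<in> Obj A \<Longrightarrow> y \<in> Obj A \<Longrightarrow> f \<in> Hom A x y \<Longrightarrow> Fm x y (scl A c f) = scl B c (Fm x y f)"
  using is_functor by (simp add: is_functor_def)

lemma F_idn: "x \<in> Obj A \<Longrightarrow> Fm x x (idn A x) = idn B (Fo x)"
  using is_functor by (simp add: is_functor_def)

lemma F_cmp:
  "x \<in> Obj A \<Longrightarrow> y \<in> Obj A \<Longrightarrow> z \<in> Obj A \<Longrightarrow> f \<in> Hom A x y \<Longrightarrow> g \<in> Hom A y z \<Longrightarrow>
    Fm x z (cmp A x y z g f) = cmp B (Fo x) (Fo y) (Fo z) (Fm y z g) (Fm x y f)"
  using is_functor by (simp add: is_functor_def)

lemma F_0: "x \<in> Obj A \<Longrightarrow> y \<in> Obj A \<Longrightarrow> Fm x y 0 = 0"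
  using F_scl[of x y 0 0] A.hom_0 by simp

section \<open>Push-forward of families of endomorphisms\<close>

definition push :: "('o \<Rightarrow> 'm) \<Rightarrow> 'o2 \<Rightarrow> 'm2" where
  "push f = (\<Sum>x | f x \<noteq> 0. at_obj (Fo x) (Fm x x (f x)))"

text \<open>The supports of \<open>f\<close>, \<open>g\<close> and \<open>f + g\<close> may differ;
  sums over one common finite set of objects can be compared term by term.\<close>

lemma push_eq:
  assumes "finite S" "S \<subseteq> Obj A" "{x. f x \<noteq> 0} \<subseteq> S"
  shows "push f = (\<Sum>x\<in>S. at_obj (Fo x) (Fm x x (f x)))"
  unfolding push_def
  by (rule sum.mono_neutral_left) (use assms F_0 in auto)

lemma endo_sum_support: "f \<in> endo_sum A \<Longrightarrow> finite {x. f x \<noteq> 0} \<and> {x. f x \<noteq> 0} \<subseteq> Obj A"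
  by (auto simp: endo_sum_def)

lemma push_add:
  assumes f: "f \<in> endo_sum A" and g: "g \<in> endo_sum A"
  shows "push (f + g) = push f + push g"
proof -
  define S where "S = {x. f x \<noteq> 0} \<union> {x. g x \<noteq> 0}"
  have S: "finite S" "S \<subseteq> Obj A" using endo_sum_support[OF f] endo_sum_support[OF g] by (auto simp: S_def)
  have "{x. f x \<noteq> 0} \<subseteq> S" "{x. g x \<noteq> 0} \<subseteq> S" "{x. (f + g) x \<noteq> 0} \<subseteq> S"
    by (auto simp: S_def fun_apply)
  note eqs = this[THEN push_eq[OF S]]
  have "(f + g) x = f x + g x" "f x \<in> Hom A x x" "g x \<in> Hom A x x" if "x \<in> S" for x
    using that S(2) A.famD[OF A.endo_sum_fam] f g by (auto simp: fun_apply)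
  then show ?thesis using S(2) unfolding eqs sum.distrib[symmetric] at_obj_add[symmetric]
    by (intro sum.cong) (auto simp: F_add subset_iff)
qed

lemma push_scl:
  assumes f: "f \<in> endo_sum A"
  shows "push (fscl A c f) = fscl B c (push f)"
proof -
  define S where "S = {x. f x \<noteq> 0}"
  have S: "finite S" "S \<subseteq> Obj A" using endo_sum_support[OF f] by (auto simp: S_def)
  have "{x. f x \<noteq> 0} \<subseteq> S" "{x. fscl A c f x \<noteq> 0} \<subseteq> S" by (auto simp: S_def A.fscl_apply)
  note eqs = this[THEN push_eq[OF S]]
  have "f x \<in> Hom A x x" if "x \<in> S" for x
    using that S(2) A.famD[OF A.endo_sum_fam] f by auto
  then show ?thesis using S(2) unfolding eqs B.W.scale_sum_right
    by (intro sum.cong) (auto simp: F_scl A.fscl_apply B.fscl_at_obj subset_iff)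
qed

lemma push_0: "push 0 = 0"
  by (simp add: push_def fun_apply)

lemma push_diff:
  assumes "f \<in> endo_sum A" "g \<in> endo_sum A"
  shows "push (f - g) = push f - push g"
  using push_add[OF A.W.subspace_diff[OF A.endo_sum_subspace assms] assms(2)] by simp

lemma push_at_obj:
  assumes "x \<in> Obj A"
  shows "push (at_obj x v) = at_obj (Fo x) (Fm x x v)"
proof -
  have "push (at_obj x v) = (\<Sum>z\<in>{x}. at_obj (Fo z) (Fm z z (at_obj x v z)))"
    by (rule push_eq) (use assms in \<open>auto simp: at_obj_def\<close>)
  then show ?thesis by (simp add: at_obj_def)
qed

lemma push_deg:
  assumes "f \<in> endo_sum_deg A i"
  shows "push f \<in> endo_sum_deg B i"
  unfolding push_def
proof (rule B.W.subspace_sum[OF B.endo_sum_deg_subspace])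
  fix x assume "x \<in> {x. f x \<noteq> 0}"
  then have x: "x \<in> Obj A" using endo_sum_support[OF A.endo_sum_deg_endo_sum[OF assms]] by blast
  then show "at_obj (Fo x) (Fm x x (f x)) \<in> endo_sum_deg B i"
    by (intro B.at_obj_endo_sum_deg F_obj F_deg A.fdegD[OF A.endo_sum_deg_fdeg[OF assms]])
qed

lemma push_commutators:
  assumes "c \<in> commutators A"
  shows "push c \<in> commutators B"
proof -
  have gens: "push g \<in> commutators B" if gen: "g \<in> A.commutator_gens n" for g n
  proof -
    obtain x y i j u f where xy: "x \<in> Obj A" "y \<in> Obj A"
      and u: "u \<in> Hom_deg A x y i" and f: "f \<in> Hom_deg A y x j"
      and g: "g = at_obj x (cmp A x y x f u) - fscl A (koszul i j) (at_obj y (cmp A y x y u f))"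
      using gen by (rule A.commutator_gensE)
    have "at_obj x (cmp A x y x f u) \<in> endo_sum A" "at_obj y (cmp A y x y u f) \<in> endo_sum A"
      using A.at_obj_endo_sum_deg[OF xy(1) A.cmp_deg[OF xy xy(1) u f]]
        A.at_obj_endo_sum_deg[OF xy(2) A.cmp_deg[OF xy(2,1,2) f u]] A.endo_sum_deg_endo_sum by blast+
    then have "push g = at_obj (Fo x) (Fm x x (cmp A x y x f u)) -
        fscl B (koszul i j) (at_obj (Fo y) (Fm y y (cmp A y x y u f)))"
      using A.W.subspace_scale[OF A.endo_sum_subspace] xy by (simp add: g push_diff push_scl push_at_obj)
    also have "\<dots> \<in> commutators B"
      using B.commutator_in_commutators[OF F_obj[OF xy(1)] F_obj[OF xy(2)] F_deg[OF xy u] F_deg[OF xy(2,1) f]]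
        F_cmp xy A.deg_hom[OF xy u] A.deg_hom[OF xy(2,1) f] by simp
    finally show ?thesis .
  qed
  have "c \<in> endo_sum A \<and> push c \<in> commutators B"
    using assms unfolding A.commutators_span
  proof (induction rule: A.W.span_induct_alt)
    case base
    show ?case using push_0 A.W.subspace_0[OF A.endo_sum_subspace] B.W.subspace_0[OF B.commutators_subspace]
      by simp
  next
    case (step k d e)
    obtain n where d: "d \<in> A.commutator_gens n" using step(1) by blast
    have dE: "d \<in> endo_sum A"
      using A.commutators_endo_sum A.W.span_base[OF step(1)] unfolding A.commutators_span by blast
    have eE: "e \<in> endo_sum A" "push e \<in> commutators B" using step(2) by blast+
    note kd = A.W.subspace_scale[OF A.endo_sum_subspace dE, of k]
    have "push (fscl A k d + e) = fscl B k (push d) + push e"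
      using push_add[OF kd eE(1)] push_scl[OF dE] by simp
    then show ?case
      using A.W.subspace_add[OF A.endo_sum_subspace kd eE(1)] gens[OF d] eE(2)
        B.W.subspace_add[OF B.commutators_subspace] B.W.subspace_scale[OF B.commutators_subspace] by simp
  qed
  then show ?thesis by simp
qed

text \<open>A projection formula. It is exact even if \<open>Fo\<close> identifies objects, since
  \<open>b\<close> has a single value at their common image and multiplies all contributions there
  by it.\<close>

lemma push_fmult:
  assumes a: "a \<in> A.fam" and b: "b \<in> B.fam" and f: "f \<in> endo_sum A"
    and ab: "\<And>x. x \<in> Obj A \<Longrightarrow> b (Fo x) = Fm x x (a x)"
  shows "push (fmult A a f) = fmult B b (push f)"
proof -
  define S where "S = {x. f x \<noteq> 0}"
  have S: "finite S" "S \<subseteq> Obj A" using endo_sum_support[OF f] by (auto simp: S_def)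
  have "{x. f x \<noteq> 0} \<subseteq> S" "{x. fmult A a f x \<noteq> 0} \<subseteq> S"
    using A.famD[OF a] by (auto simp: S_def fmult_def A.cmp_0_right)
  note eqs = this[THEN push_eq[OF S]]
  have fh: "f x \<in> Hom A x x" if "x \<in> S" for x
    using that S(2) A.famD[OF A.endo_sum_fam] f by auto
  have at: "at_obj (Fo x) (Fm x x (f x)) \<in> B.fam" if "x \<in> S" for x
    using F_obj F_hom fh[OF that] that S(2) B.hom_0 by (auto simp: B.fam_def at_obj_def)
  have "fmult B b (at_obj (Fo x) (Fm x x (f x))) = at_obj (Fo x) (Fm x x (fmult A a f x))"
    if x: "x \<in> S" for x
  proof -
    have xO: "x \<in> Obj A" using x S by blast
    then show ?thesis
      using ab[OF xO] F_obj[OF xO] F_cmp[OF xO xO xO fh[OF x] A.famD[OF a xO]] B.famD[OF b]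
      by (auto simp: fmult_def at_obj_def fun_eq_iff B.cmp_0_right)
  qed
  then show ?thesis
    unfolding eqs using B.fmult_sum_right[OF b, of S "\<lambda>x. at_obj (Fo x) (Fm x x (f x))"] at by simp
qed

text \<open>With only one object involved nothing is identified, and functoriality gives an exact
  equality.\<close>

lemma push_pw_at_obj:
  assumes x: "x \<in> Obj A" and v: "v \<in> Hom A x x"
  shows "push (A.pw (at_obj x v)) = B.pw (push (at_obj x v))"
proof -
  have at: "at_obj x v \<in> A.fam" "at_obj (Fo x) (Fm x x v) \<in> B.fam"
    using x v F_obj F_hom A.hom_0 B.hom_0 by (auto simp: A.fam_def B.fam_def at_obj_def)
  have "\<exists>w\<in>Hom A x x. A.fpow (at_obj x v) (Suc q) = at_obj x w \<and>
      B.fpow (at_obj (Fo x) (Fm x x v)) (Suc q) = at_obj (Fo x) (Fm x x w)" for q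
  proof (induction q)
    case 0
    show ?case using v at by (auto simp: A.fmult_fone B.fmult_fone)
  next
    case (Suc q)
    then obtain w where w: "w \<in> Hom A x x" "A.fpow (at_obj x v) (Suc q) = at_obj x w"
      "B.fpow (at_obj (Fo x) (Fm x x v)) (Suc q) = at_obj (Fo x) (Fm x x w)" by blast
    have "A.fpow (at_obj x v) (Suc (Suc q)) = fmult A (at_obj x v) (at_obj x w)"
      "B.fpow (at_obj (Fo x) (Fm x x v)) (Suc (Suc q)) =
        fmult B (at_obj (Fo x) (Fm x x v)) (at_obj (Fo x) (Fm x x w))"
      unfolding w(2,3)[symmetric] by simp_all
    moreover have "\<dots> = at_obj (Fo x) (Fm x x (cmp A x x x v w))"
      using B.fmult_at_obj F_obj F_hom x v w(1) F_cmp by simp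
    ultimately show ?case
      using A.fmult_at_obj[OF x v w(1)] A.cmp_hom[OF x x x w(1) v] by metis
  qed
  \<comment> \<open>The powers above are indexed by \<open>Suc q\<close>, so \<open>p\<close>
    corresponds to \<open>q = p - 1\<close>.\<close>
  from this[of "p - 1"] show ?thesis
    using A.p_pos A.pw_fpow[OF at(1)] B.pw_fpow[OF at(2)] push_at_obj[OF x]
    by (auto simp del: replicate_Suc)
qed

text \<open>Objects with the same image create mixed words in \<open>B\<close> that have no
  counterpart in \<open>A\<close>. As \<open>pw\<close> is additive modulo commutators in both
  categories, the case of a single object suffices.\<close>

lemma push_pw:
  assumes "f \<in> endo_sum_deg A n"
  shows "push (A.pw f) - B.pw (push f) \<in> commutators B"
  using assms
proof (induction rule: A.endo_sum_deg_induct)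
  case zero
  show ?case using A.pw_0 B.pw_0 push_0 B.W.subspace_0[OF B.commutators_subspace] by simp
next
  case (add x v g)
  define h where "h = at_obj x v"
  have h: "h \<in> endo_sum_deg A n" using A.at_obj_endo_sum_deg add by (simp add: h_def)
  have hp: "push (A.pw h) = B.pw (push h)"
    using push_pw_at_obj[OF add(1) A.deg_hom[OF add(1,1,2)]] by (simp add: h_def)
  have E: "h \<in> endo_sum A" "g \<in> endo_sum A" "A.pw h \<in> endo_sum A" "A.pw g \<in> endo_sum A"
    "A.pw (h + g) \<in> endo_sum A"
    using h add(3) A.W.subspace_add[OF A.endo_sum_deg_subspace h add(3)] A.pw_deg
      A.endo_sum_deg_endo_sum by blast+
  have 1: "push (A.pw (h + g)) - (B.pw (push h) + push (A.pw g)) \<in> commutators B"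
    using push_commutators[OF A.pw_add[OF h add(3)]] hp E A.W.subspace_add[OF A.endo_sum_subspace]
    by (simp add: push_diff push_add)
  have 2: "B.pw (push h + push g) - (B.pw (push h) + B.pw (push g)) \<in> commutators B"
    by (rule B.pw_add[OF push_deg[OF h] push_deg[OF add(3)]])
  note B.W.subspace_diff[OF B.commutators_subspace B.W.subspace_add[OF B.commutators_subspace 1 add.IH] 2]
  moreover have "push (A.pw (h + g)) - (B.pw (push h) + push (A.pw g)) + (push (A.pw g) - B.pw (push g))
      - (B.pw (push h + push g) - (B.pw (push h) + B.pw (push g))) =
      push (A.pw (h + g)) - B.pw (push (h + g))"
    unfolding push_add[OF E(1,2)] by simp
  ultimately show ?case by (simp add: h_def)
qed

lemma push_pw_funpow:
  assumes f: "f \<in> endo_sum_deg A n"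
  shows "push ((A.pw ^^ r) f) - (B.pw ^^ r) (push f) \<in> commutators B"
proof (induction r)
  case 0
  show ?case using B.W.subspace_0[OF B.commutators_subspace] by simp
next
  case (Suc r)
  note h = A.pw_funpow_deg[OF f, of r]
  have "B.pw (push ((A.pw ^^ r) f)) - B.pw ((B.pw ^^ r) (push f)) \<in> commutators B"
    by (rule B.pw_cong[OF push_deg[OF h] B.pw_funpow_deg[OF push_deg[OF f]] Suc])
  from B.W.subspace_add[OF B.commutators_subspace push_pw[OF h] this] show ?case by simp
qed

lemma push_pw_funpow_commutators:
  assumes f: "f \<in> endo_sum_deg A n" and "(A.pw ^^ r) f \<in> commutators A"
  shows "(B.pw ^^ r) (push f) \<in> commutators B"
  using B.W.subspace_diff[OF B.commutators_subspace push_commutators[OF assms(2)] push_pw_funpow[OF f, of r]]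
  by simp

end

section \<open>Functors with a section up to isomorphism\<close>

text \<open>One half of an equivalence; interchanging the functors gives the other half. Naturality
  is required for endomorphisms only, because \<open>push\<close> sees nothing else.\<close>

locale graded_functor_section =
  F: graded_functor A B p Fo Fm + G: graded_functor B A p Go Gm
  for A :: "('k::field, 'o, 'm::ab_group_add) gcat"
    and B :: "('k, 'o2, 'm2::ab_group_add) gcat"
    and p Fo Fm Go Gm +
  fixes \<beta> \<beta>' :: "'o2 \<Rightarrow> 'm2"
  assumes \<beta>: "y \<in> Obj B \<Longrightarrow> \<beta> y \<in> Hom_deg B y (Fo (Go y)) 0"
    and \<beta>': "y \<in> Obj B \<Longrightarrow> \<beta>' y \<in> Hom_deg B (Fo (Go y)) y 0"
    and inverse: "y \<in> Obj B \<Longrightarrow> cmp B y (Fo (Go y)) y (\<beta>' y) (\<beta> y) = idn B y"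
      "y \<in> Obj B \<Longrightarrow> cmp B (Fo (Go y)) y (Fo (Go y)) (\<beta> y) (\<beta>' y) = idn B (Fo (Go y))"
    and natural: "y \<in> Obj B \<Longrightarrow> f \<in> Hom B y y \<Longrightarrow> cmp B y y (Fo (Go y)) (\<beta> y) f =
      cmp B y (Fo (Go y)) (Fo (Go y)) (Fm (Go y) (Go y) (Gm y y f)) (\<beta> y)"
begin

lemma push_push:
  assumes "g \<in> endo_sum_deg B n"
  shows "g - F.push (G.push g) \<in> commutators B"
  using assms
proof (induction rule: F.B.endo_sum_deg_induct)
  case zero
  show ?case using F.push_0 G.push_0 F.B.W.subspace_0[OF F.B.commutators_subspace] by simp
next
  case (add y v g)
  note y = add(1) and v = F.B.deg_hom[OF add(1,1,2)]
  define z where "z = Fo (Go y)"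
  have z: "z \<in> Obj B" using y G.F_obj F.F_obj by (simp add: z_def)
  define w where "w = Fm (Go y) (Go y) (Gm y y v)"
  have w: "w \<in> Hom B z z" using y v G.F_obj G.F_hom F.F_hom by (simp add: w_def z_def)
  have b: "\<beta> y \<in> Hom_deg B y z 0" "\<beta>' y \<in> Hom_deg B z y 0" using \<beta>[OF y] \<beta>'[OF y] by (simp_all add: z_def)
  note bh = F.B.deg_hom[OF y z b(1)] F.B.deg_hom[OF z y b(2)]
  \<comment> \<open>With \<open>u = \<beta> v\<close>, composing with \<open>\<beta>'\<close> on one
    side gives \<open>v\<close> and on the other side its conjugate \<open>w\<close>. Their
    difference is a generator, with sign 1 because \<open>\<beta>'\<close> has degree zero.\<close>
  define u where "u = cmp B y y z (\<beta> y) v"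
  have u: "u \<in> Hom_deg B y z n" using F.B.cmp_deg[OF y y z add(2) b(1)] by (simp add: u_def)
  have "cmp B y z y (\<beta>' y) u = v"
    using inverse(1)[OF y] F.B.cmp_assoc[OF y y z y v bh] F.B.cmp_idn_left[OF y y v]
    by (simp add: u_def z_def)
  moreover have "cmp B z y z u (\<beta>' y) = w"
    using natural[OF y v] inverse(2)[OF y] F.B.cmp_assoc[OF z y z z bh(2,1) w] F.B.cmp_idn_right[OF z z w]
    by (simp add: u_def z_def w_def)
  ultimately have 1: "at_obj y v - at_obj z w \<in> commutators B"
    using F.B.commutator_in_commutators[OF y z u b(2)] by simp
  have E: "at_obj y v \<in> endo_sum B" "g \<in> endo_sum B"
    using F.B.at_obj_endo_sum_deg[OF y add(2)] add(3) F.B.endo_sum_deg_endo_sum by blast+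
  have E': "G.push (at_obj y v) \<in> endo_sum A" "G.push g \<in> endo_sum A"
    using G.push_deg F.B.at_obj_endo_sum_deg[OF y add(2)] add(3) F.A.endo_sum_deg_endo_sum by blast+
  have "F.push (G.push (at_obj y v + g)) = at_obj z w + F.push (G.push g)"
    using G.push_add[OF E] F.push_add[OF E'] G.push_at_obj[OF y] F.push_at_obj G.F_obj[OF y]
    by (simp add: z_def w_def)
  then have "at_obj y v + g - F.push (G.push (at_obj y v + g)) =
      (at_obj y v - at_obj z w) + (g - F.push (G.push g))" by simp
  then show ?case
    using F.B.W.subspace_add[OF F.B.commutators_subspace 1 add.IH] by (simp only:)
qed

text \<open>A test element \<open>f\<close> of \<open>B\<close> is pushed to \<open>A\<close> by
  \<open>G\<close>, where \<open>a\<close> annihilates it. Pushing back by \<open>F\<close> shows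
  that \<open>b\<close> annihilates \<open>F.push (G.push f)\<close>, which is congruent to
  \<open>f\<close>.\<close>

lemma Krs_deg_transfer:
  assumes a: "a \<in> Krs_deg A p r s n" and b: "b \<in> center_deg B n"
    and ab: "\<And>x. x \<in> Obj A \<Longrightarrow> b (Fo x) = Fm x x (a x)"
  shows "b \<in> Krs_deg B p r s n"
  unfolding F.B.Krs_deg_iff
proof (intro conjI ballI impI)
  fix f assume f: "f \<in> endo_sum_deg B (s - n)" and "(F.B.pw ^^ r) f \<in> commutators B"
  note g = G.push_deg[OF f]
  have ac: "a \<in> center_deg A n" using a by (simp add: F.A.Krs_deg_iff)
  have "(F.A.pw ^^ r) (G.push f) \<in> commutators A"
    by (rule G.push_pw_funpow_commutators[OF f]) fact
  then have "fmult A a (G.push f) \<in> commutators A" using a g by (simp add: F.A.Krs_deg_iff)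
  then have "F.push (fmult A a (G.push f)) \<in> commutators B" by (rule F.push_commutators)
  then have 1: "fmult B b (F.push (G.push f)) \<in> commutators B"
    using F.push_fmult[OF F.A.center_deg_fam[OF ac] F.B.center_deg_fam[OF b]
        F.A.endo_sum_deg_endo_sum[OF g] ab] by simp
  have "fmult B b (f - F.push (G.push f)) \<in> commutators B"
    by (rule F.B.center_deg_mult_commutators(1)[OF b push_push[OF f]])
  then have "fmult B b f - fmult B b (F.push (G.push f)) \<in> commutators B"
    using F.B.fmult_diff_right[OF F.B.center_deg_fam[OF b]] F.B.endo_sum_deg_fam[OF f]
      F.B.endo_sum_deg_fam[OF F.push_deg[OF g]] by simp
  from F.B.W.subspace_add[OF F.B.commutators_subspace this 1] show "fmult B b f \<in> commutators B"
    by simp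
qed (rule b)

end

subsection \<open>Equivalences\<close>

text \<open>\<open>Go\<close>, \<open>\<beta>\<close> and \<open>\<beta>'\<close> result from
  choosing, for each object of \<open>B\<close>, an isomorphism provided by essential surjectivity.
  The quasi-inverse on morphisms is then forced by full faithfulness and constructed below.\<close>

locale graded_equivalence =
  A: graded_cat_char A p + B: graded_cat_char B p
  for A :: "('k::field, 'o, 'm::ab_group_add) gcat"
    and B :: "('k, 'o2, 'm2::ab_group_add) gcat"
    and p :: nat +
  fixes Fo :: "'o \<Rightarrow> 'o2" and Fm :: "'o \<Rightarrow> 'o \<Rightarrow> 'm \<Rightarrow> 'm2"
    and Go :: "'o2 \<Rightarrow> 'o" and \<beta> \<beta>' :: "'o2 \<Rightarrow> 'm2"
  assumes equivalence: "degree_preserving_equivalence A B Fo Fm"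
    and Go: "y \<in> Obj B \<Longrightarrow> Go y \<in> Obj A"
    and \<beta>: "y \<in> Obj B \<Longrightarrow> \<beta> y \<in> Hom_deg B y (Fo (Go y)) 0"
    and \<beta>': "y \<in> Obj B \<Longrightarrow> \<beta>' y \<in> Hom_deg B (Fo (Go y)) y 0"
    and inverse: "y \<in> Obj B \<Longrightarrow> cmp B y (Fo (Go y)) y (\<beta>' y) (\<beta> y) = idn B y"
      "y \<in> Obj B \<Longrightarrow> cmp B (Fo (Go y)) y (Fo (Go y)) (\<beta> y) (\<beta>' y) = idn B (Fo (Go y))"
begin

sublocale F: graded_functor A B p Fo Fm
  proof unfold_locales
  show "is_functor A B Fo Fm"
    using equivalence by (simp add: degree_preserving_equivalence_def)
  show "Fm x y f \<in> Hom_deg B (Fo x) (Fo y) i"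
    if "x \<in> Obj A" "y \<in> Obj A" "f \<in> Hom_deg A x y i" for x y f i
  proof -
    have "Fm x y ` Hom_deg A x y i = Hom_deg B (Fo x) (Fo y) i"
      using equivalence that by (simp add: degree_preserving_equivalence_def)
    then show ?thesis using that(3) by blast
  qed
qed

section \<open>Full faithfulness\<close>

definition Finv :: "'o \<Rightarrow> 'o \<Rightarrow> 'm2 \<Rightarrow> 'm" where
  "Finv x y = inv_into (Hom A x y) (Fm x y)"

context
  fixes x y assumes xy: "x \<in> Obj A" "y \<in> Obj A"
begin

lemma F_bij: "bij_betw (Fm x y) (Hom A x y) (Hom B (Fo x) (Fo y))"
  using equivalence xy by (simp add: degree_preserving_equivalence_def)

lemma F_inj: "f \<in> Hom A x y \<Longrightarrow> g \<in> Hom A x y \<Longrightarrow> Fm x y f = Fm x y g \<Longrightarrow> f = g"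
  using F_bij by (auto simp: bij_betw_def inj_on_def)

lemma Finv_hom: "g \<in> Hom B (Fo x) (Fo y) \<Longrightarrow> Finv x y g \<in> Hom A x y"
  using F_bij unfolding Finv_def bij_betw_def by (metis inv_into_into)

lemma F_Finv: "g \<in> Hom B (Fo x) (Fo y) \<Longrightarrow> Fm x y (Finv x y g) = g"
  using F_bij unfolding Finv_def bij_betw_def by (metis f_inv_into_f)

lemma Finv_deg:
  assumes "g \<in> Hom_deg B (Fo x) (Fo y) i"
  shows "Finv x y g \<in> Hom_deg A x y i"
proof -
  have "Fm x y ` Hom_deg A x y i = Hom_deg B (Fo x) (Fo y) i"
    using equivalence xy by (simp add: degree_preserving_equivalence_def)
  then obtain f where f: "f \<in> Hom_deg A x y i" "g = Fm x y f" using assms by blast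
  then have "Finv x y g = f"
    using F_inj[OF Finv_hom] F_Finv F.F_hom xy A.deg_hom[OF xy f(1)] by simp
  then show ?thesis using f by simp
qed

end

section \<open>The quasi-inverse functor\<close>

abbreviation FG :: "'o2 \<Rightarrow> 'o2" where "FG y \<equiv> Fo (Go y)"

lemma FG: "y \<in> Obj B \<Longrightarrow> FG y \<in> Obj B"
  by (intro F.F_obj Go)

lemma \<beta>_hom: "y \<in> Obj B \<Longrightarrow> \<beta> y \<in> Hom B y (FG y)"
  by (rule B.deg_hom[OF _ _ \<beta>]) (auto intro: FG)

lemma \<beta>'_hom: "y \<in> Obj B \<Longrightarrow> \<beta>' y \<in> Hom B (FG y) y"
  by (rule B.deg_hom[OF _ _ \<beta>']) (auto intro: FG)

lemma cancel_\<beta>'_\<beta>: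
  "y \<in> Obj B \<Longrightarrow> w \<in> Obj B \<Longrightarrow> f \<in> Hom B w y \<Longrightarrow> cmp B w (FG y) y (\<beta>' y) (cmp B w y (FG y) (\<beta> y) f) = f"
  using B.cmp_assoc[of w y "FG y" y f "\<beta> y" "\<beta>' y"] FG \<beta>_hom \<beta>'_hom inverse(1) B.cmp_idn_left by simp

text \<open>The value that naturality of \<open>\<beta>\<close> forces on the image of
  \<open>g\<close> under the composite of the quasi-inverse and \<open>F\<close>.\<close>

definition conj :: "'o2 \<Rightarrow> 'o2 \<Rightarrow> 'm2 \<Rightarrow> 'm2" where
  "conj y z g = cmp B (FG y) z (FG z) (\<beta> z) (cmp B (FG y) y z g (\<beta>' y))"

definition Gm :: "'o2 \<Rightarrow> 'o2 \<Rightarrow> 'm2 \<Rightarrow> 'm" where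
  "Gm y z g = Finv (Go y) (Go z) (conj y z g)"

context
  fixes y z assumes yz: "y \<in> Obj B" "z \<in> Obj B"
begin

lemma conj_hom: "g \<in> Hom B y z \<Longrightarrow> conj y z g \<in> Hom B (FG y) (FG z)"
  unfolding conj_def using yz FG \<beta>_hom \<beta>'_hom B.cmp_hom by simp

lemma conj_deg:
  assumes "g \<in> Hom_deg B y z i"
  shows "conj y z g \<in> Hom_deg B (FG y) (FG z) i"
  using B.cmp_deg[OF FG[OF yz(1)] yz(2) FG[OF yz(2)]
      B.cmp_deg[OF FG[OF yz(1)] yz \<beta>'[OF yz(1)] assms] \<beta>[OF yz(2)]]
  by (simp add: conj_def)

lemma conj_natural:
  "g \<in> Hom B y z \<Longrightarrow> cmp B y (FG y) (FG z) (conj y z g) (\<beta> y) = cmp B y z (FG z) (\<beta> z) g"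
  unfolding conj_def using yz FG \<beta>_hom \<beta>'_hom B.cmp_hom inverse(1) B.cmp_idn_right
  by (simp add: B.cmp_assoc)

lemma F_Gm: "g \<in> Hom B y z \<Longrightarrow> Fm (Go y) (Go z) (Gm y z g) = conj y z g"
  unfolding Gm_def using F_Finv conj_hom Go yz by simp

lemma Gm_hom: "g \<in> Hom B y z \<Longrightarrow> Gm y z g \<in> Hom A (Go y) (Go z)"
  unfolding Gm_def using Finv_hom conj_hom Go yz by simp

lemma Gm_deg: "g \<in> Hom_deg B y z i \<Longrightarrow> Gm y z g \<in> Hom_deg A (Go y) (Go z) i"
  unfolding Gm_def using Finv_deg conj_deg Go yz by simp

text \<open>By faithfulness, identities for \<open>Gm\<close> can be checked after applying
  \<open>F\<close>, where they concern conjugates.\<close>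

lemma Gm_eqI:
  "g \<in> Hom B y z \<Longrightarrow> f \<in> Hom A (Go y) (Go z) \<Longrightarrow> Fm (Go y) (Go z) f = conj y z g \<Longrightarrow> Gm y z g = f"
  using F_inj[OF Go[OF yz(1)] Go[OF yz(2)] Gm_hom] F_Gm by simp

end

lemma G_functor: "graded_functor B A p Go Gm"
proof unfold_locales
  show "is_functor B A Go Gm"
    unfolding is_functor_def
  proof (intro conjI ballI allI)
    fix y z f assume yz: "y \<in> Obj B" "z \<in> Obj B" and f: "f \<in> Hom B y z"
    note h = FG[OF yz(1)] FG[OF yz(2)] \<beta>_hom[OF yz(1)] \<beta>'_hom[OF yz(1)] \<beta>_hom[OF yz(2)] \<beta>'_hom[OF yz(2)]
    show "Gm y z f \<in> Hom A (Go y) (Go z)" by (rule Gm_hom[OF yz f])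
    show "Gm y z (f + g) = Gm y z f + Gm y z g" if g: "g \<in> Hom B y z" for g
    proof (rule Gm_eqI[OF yz B.hom_add[OF yz f g] A.hom_add[OF Go[OF yz(1)] Go[OF yz(2)] Gm_hom[OF yz f] Gm_hom[OF yz g]]])
      show "Fm (Go y) (Go z) (Gm y z f + Gm y z g) = conj y z (f + g)"
        using F.F_add Go yz Gm_hom[OF yz] F_Gm[OF yz] f g h B.cmp_hom
        by (simp add: conj_def B.cmp_add_left B.cmp_add_right)
    qed
    show "Gm y z (scl B c f) = scl A c (Gm y z f)" for c
    proof (rule Gm_eqI[OF yz B.hom_scl[OF yz f] A.hom_scl[OF Go[OF yz(1)] Go[OF yz(2)] Gm_hom[OF yz f]]])
      show "Fm (Go y) (Go z) (scl A c (Gm y z f)) = conj y z (scl B c f)"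
        using F.F_scl Go yz Gm_hom[OF yz] F_Gm[OF yz] f h B.cmp_hom
        by (simp add: conj_def B.cmp_scl_left B.cmp_scl_right)
    qed
  next
    fix y assume y: "y \<in> Obj B"
    show "Gm y y (idn B y) = idn A (Go y)"
    proof (rule Gm_eqI[OF y y B.idn_hom[OF y] A.idn_hom[OF Go[OF y]]])
      show "Fm (Go y) (Go y) (idn A (Go y)) = conj y y (idn B y)"
        using F.F_idn[OF Go[OF y]] inverse(2)[OF y] B.cmp_idn_left[OF FG[OF y] y \<beta>'_hom[OF y]]
        by (simp add: conj_def)
    qed
  next
    fix x y z f g
    assume xyz: "x \<in> Obj B" "y \<in> Obj B" "z \<in> Obj B" and f: "f \<in> Hom B x y" and g: "g \<in> Hom B y z"
    note G = Go[OF xyz(1)] Go[OF xyz(2)] Go[OF xyz(3)]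
    note h = FG[OF xyz(1)] FG[OF xyz(2)] FG[OF xyz(3)]
      \<beta>'_hom[OF xyz(1)] \<beta>_hom[OF xyz(2)] \<beta>'_hom[OF xyz(2)] \<beta>_hom[OF xyz(3)]
    note Gf = Gm_hom[OF xyz(1,2) f] and Gg = Gm_hom[OF xyz(2,3) g]
    show "Gm x z (cmp B x y z g f) = cmp A (Go x) (Go y) (Go z) (Gm y z g) (Gm x y f)"
    proof (rule Gm_eqI[OF xyz(1,3) B.cmp_hom[OF xyz f g] A.cmp_hom[OF G Gf Gg]])
      have "Fm (Go x) (Go z) (cmp A (Go x) (Go y) (Go z) (Gm y z g) (Gm x y f)) =
          cmp B (FG x) (FG y) (FG z) (conj y z g) (conj x y f)"
        using F.F_cmp[OF G Gf Gg] F_Gm[OF xyz(1,2) f] F_Gm[OF xyz(2,3) g] by simp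
      also have "\<dots> = conj x z (cmp B x y z g f)"
        unfolding conj_def using xyz f g h B.cmp_hom
        by (simp add: B.cmp_assoc cancel_\<beta>'_\<beta>)
      finally show "Fm (Go x) (Go z) (cmp A (Go x) (Go y) (Go z) (Gm y z g) (Gm x y f)) =
          conj x z (cmp B x y z g f)" .
    qed
  qed (rule Go)
qed (rule Gm_deg)

lemma F_section: "graded_functor_section A B p Fo Fm Go Gm \<beta> \<beta>'"
proof -
  interpret G: graded_functor B A p Go Gm by (rule G_functor)
  show ?thesis
    by unfold_locales (use \<beta> \<beta>' inverse F_Gm conj_natural in simp_all)
qed

section \<open>The isomorphisms from objects of \<open>A\<close> to their images under the
  composite\<close>

text \<open>Chosen so that \<open>F\<close> maps \<open>\<alpha> x\<close> to
  \<open>\<beta> (Fo x)\<close>. Invertibility and naturality then follow from those of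
  \<open>\<beta>\<close>, as \<open>F\<close> is faithful.\<close>

definition \<alpha> :: "'o \<Rightarrow> 'm" where "\<alpha> x = Finv x (Go (Fo x)) (\<beta> (Fo x))"

definition \<alpha>' :: "'o \<Rightarrow> 'm" where "\<alpha>' x = Finv (Go (Fo x)) x (\<beta>' (Fo x))"

context
  fixes x assumes x: "x \<in> Obj A"
begin

lemma GF: "Go (Fo x) \<in> Obj A"
  by (intro Go F.F_obj x)

lemma \<alpha>: "\<alpha> x \<in> Hom_deg A x (Go (Fo x)) 0" "\<alpha>' x \<in> Hom_deg A (Go (Fo x)) x 0"
  unfolding \<alpha>_def \<alpha>'_def using Finv_deg \<beta> \<beta>' x GF F.F_obj by simp_all

lemmas \<alpha>_hom = A.deg_hom[OF x GF \<alpha>(1)] A.deg_hom[OF GF x \<alpha>(2)]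

lemma F_\<alpha>: "Fm x (Go (Fo x)) (\<alpha> x) = \<beta> (Fo x)" "Fm (Go (Fo x)) x (\<alpha>' x) = \<beta>' (Fo x)"
  unfolding \<alpha>_def \<alpha>'_def using F_Finv \<beta>_hom \<beta>'_hom x GF F.F_obj by simp_all

end

lemma G_section: "graded_functor_section B A p Go Gm Fo Fm \<alpha> \<alpha>'"
proof -
  interpret G: graded_functor B A p Go Gm by (rule G_functor)
  show ?thesis
  proof unfold_locales
    fix x assume x: "x \<in> Obj A"
    note GF = GF[OF x] and Fx = F.F_obj[OF x]
    show "\<alpha> x \<in> Hom_deg A x (Go (Fo x)) 0" "\<alpha>' x \<in> Hom_deg A (Go (Fo x)) x 0" by (fact \<alpha>[OF x])+
    show "cmp A x (Go (Fo x)) x (\<alpha>' x) (\<alpha> x) = idn A x"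
      by (rule F_inj[OF x x A.cmp_hom[OF x GF x \<alpha>_hom[OF x]] A.idn_hom[OF x]])
        (use F.F_cmp[OF x GF x \<alpha>_hom[OF x]] F_\<alpha>[OF x] F.F_idn[OF x] inverse(1)[OF Fx] in simp)
    show "cmp A (Go (Fo x)) x (Go (Fo x)) (\<alpha> x) (\<alpha>' x) = idn A (Go (Fo x))"
      by (rule F_inj[OF GF GF A.cmp_hom[OF GF x GF \<alpha>_hom(2,1)[OF x]] A.idn_hom[OF GF]])
        (use F.F_cmp[OF GF x GF \<alpha>_hom(2,1)[OF x]] F_\<alpha>[OF x] F.F_idn[OF GF] inverse(2)[OF Fx] in simp)
    fix f assume f: "f \<in> Hom A x x"
    note Ff = F.F_hom[OF x x f]
    note GFf = Gm_hom[OF Fx Fx Ff]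
    show "cmp A x x (Go (Fo x)) (\<alpha> x) f =
        cmp A x (Go (Fo x)) (Go (Fo x)) (Gm (Fo x) (Fo x) (Fm x x f)) (\<alpha> x)"
      by (rule F_inj[OF x GF A.cmp_hom[OF x x GF f \<alpha>_hom(1)[OF x]]
            A.cmp_hom[OF x GF GF \<alpha>_hom(1)[OF x] GFf]])
        (use F.F_cmp[OF x x GF f \<alpha>_hom(1)[OF x]] F.F_cmp[OF x GF GF \<alpha>_hom(1)[OF x] GFf]
          F_\<alpha>[OF x] F_Gm[OF Fx Fx Ff] conj_natural[OF Fx Fx Ff] in simp)
  qed
qed

section \<open>The induced map on centres\<close>

text \<open>The explicit formula in terms of a quasi-inverse. It is identified afterwards with
  \<open>center_map\<close>, which is characterized by its values at the objects \<open>Fo x\<close>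
  and thus independent of the choices.\<close>

definition ext :: "('o \<Rightarrow> 'm) \<Rightarrow> 'o2 \<Rightarrow> 'm2" where
  "ext a = (\<lambda>y. if y \<in> Obj B then cmp B y (FG y) y (\<beta>' y) (cmp B y (FG y) (FG y)
     (Fm (Go y) (Go y) (a (Go y))) (\<beta> y)) else 0)"

lemma ext_add: "a \<in> A.fam \<Longrightarrow> b \<in> A.fam \<Longrightarrow> ext (a + b) = ext a + ext b"
  using A.famD Go FG \<beta>_hom \<beta>'_hom F.F_hom B.cmp_hom
  by (simp add: ext_def fun_eq_iff fun_apply F.F_add B.cmp_add_left B.cmp_add_right)

text \<open>The conjugate \<open>g\<close> of \<open>f\<close> is the image under \<open>F\<close>
  of \<open>Gm y z f\<close>, so centrality of \<open>a\<close> lets it pass the images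
  \<open>u\<close> and \<open>v\<close> of \<open>a\<close>. Passing \<open>\<beta>'\<close> and
  \<open>\<beta>\<close> is plain naturality, and the only sign is the one from
  \<open>a\<close>.\<close>

lemma ext_center_deg:
  assumes a: "a \<in> center_deg A i"
  shows "ext a \<in> center_deg B i"
  unfolding B.center_deg_iff
proof (intro conjI ballI allI)
  have Fa: "Fm (Go y) (Go y) (a (Go y)) \<in> Hom_deg B (FG y) (FG y) i" if y: "y \<in> Obj B" for y
    by (intro F.F_deg A.fdegD[OF A.center_deg_fdeg[OF a]] Go y)
  note Fah = B.deg_hom[OF FG FG Fa]
  show "ext a \<in> B.fdeg i"
    using B.cmp_deg[OF _ FG _ B.cmp_deg[OF _ FG FG \<beta> Fa] \<beta>'] by (simp add: B.fdeg_def ext_def)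
  fix y z j f assume yz: "y \<in> Obj B" "z \<in> Obj B" and f: "f \<in> Hom_deg B y z j"
  note fh = B.deg_hom[OF yz f]
  note G = Go[OF yz(1)] Go[OF yz(2)] and FGs = FG[OF yz(1)] FG[OF yz(2)]
  note b = \<beta>_hom[OF yz(1)] \<beta>'_hom[OF yz(1)] \<beta>_hom[OF yz(2)] \<beta>'_hom[OF yz(2)]
  define u where "u = Fm (Go y) (Go y) (a (Go y))"
  define v where "v = Fm (Go z) (Go z) (a (Go z))"
  define g where "g = conj y z f"
  have uv: "u \<in> Hom B (FG y) (FG y)" "v \<in> Hom B (FG z) (FG z)" "g \<in> Hom B (FG y) (FG z)"
    using Fah yz conj_hom[OF yz fh] by (simp_all add: u_def v_def g_def)
  have aG: "a (Go y) \<in> Hom A (Go y) (Go y)" "a (Go z) \<in> Hom A (Go z) (Go z)"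
    using A.famD[OF A.center_deg_fam[OF a]] G by blast+
  have gu: "cmp B (FG y) (FG y) (FG z) g u = scl B (koszul i j) (cmp B (FG y) (FG z) (FG z) v g)"
    using A.center_deg_commute[OF a G Gm_deg[OF yz f]] F.F_cmp[OF G(1,1,2) aG(1) Gm_hom[OF yz fh]]
      F.F_cmp[OF G(1,2,2) Gm_hom[OF yz fh] aG(2)] F_Gm[OF yz fh]
      F.F_scl[OF G A.cmp_hom[OF G(1,2,2) Gm_hom[OF yz fh] aG(2)]]
    by (simp add: u_def v_def g_def)
  have "cmp B y y z f (ext a y) = cmp B y y z f (cmp B y (FG y) y (\<beta>' y) (cmp B y (FG y) (FG y) u (\<beta> y)))"
    using yz by (simp add: ext_def u_def)
  also have "\<dots> = cmp B y (FG z) z (\<beta>' z) (cmp B y (FG y) (FG z) g (cmp B y (FG y) (FG y) u (\<beta> y)))"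
    unfolding g_def conj_def using yz FGs b uv fh B.cmp_hom by (simp add: B.cmp_assoc cancel_\<beta>'_\<beta>)
  also have "\<dots> = cmp B y (FG z) z (\<beta>' z) (cmp B y (FG y) (FG z) (cmp B (FG y) (FG y) (FG z) g u) (\<beta> y))"
    using yz FGs b uv by (simp add: B.cmp_assoc)
  also have "\<dots> = scl B (koszul i j) (cmp B y (FG z) z (\<beta>' z) (cmp B y (FG z) (FG z) v (cmp B y (FG y) (FG z) g (\<beta> y))))"
    unfolding gu using yz FGs b uv B.cmp_hom by (simp add: B.cmp_assoc B.cmp_scl_left B.cmp_scl_right)
  also have "cmp B y (FG y) (FG z) g (\<beta> y) = cmp B y z (FG z) (\<beta> z) f"
    unfolding g_def by (rule conj_natural[OF yz fh])
  also have "cmp B y (FG z) z (\<beta>' z) (cmp B y (FG z) (FG z) v (cmp B y z (FG z) (\<beta> z) f)) =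
      cmp B y z z (ext a z) f"
    using yz FGs b uv fh B.cmp_hom by (simp add: ext_def v_def B.cmp_assoc)
  finally show "cmp B y y z f (ext a y) = scl B (koszul i j) (cmp B y z z (ext a z) f)" .
qed

lemma ext_center:
  assumes "a \<in> center A"
  shows "ext a \<in> center B"
  using assms
proof (induction rule: A.center_induct)
  case (homogeneous i a)
  then show ?case using ext_center_deg B.center_deg_center by blast
next
  case (add a b)
  then show ?case using ext_add A.center_fam B.W.subspace_add[OF B.center_subspace] by simp
qed

text \<open>At \<open>Fo x\<close> the formula involves \<open>a\<close> at
  \<open>Go (Fo x)\<close>. The degree zero isomorphism \<open>\<alpha> x\<close> carries this to
  the value at \<open>x\<close>, and its image \<open>\<beta> (Fo x)\<close> cancels against
  \<open>\<beta>'\<close>.\<close>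

lemma ext_F:
  assumes a: "a \<in> center A" and x: "x \<in> Obj A"
  shows "ext a (Fo x) = Fm x x (a x)"
proof -
  note Fx = F.F_obj[OF x] and GF = GF[OF x] and h = \<alpha>_hom(1)[OF x]
  note ax = A.famD[OF A.center_fam[OF a]]
  have "cmp B (Fo x) (FG (Fo x)) (FG (Fo x)) (Fm (Go (Fo x)) (Go (Fo x)) (a (Go (Fo x)))) (\<beta> (Fo x)) =
      Fm x (Go (Fo x)) (cmp A x (Go (Fo x)) (Go (Fo x)) (a (Go (Fo x))) (\<alpha> x))"
    using F.F_cmp[OF x GF GF h ax[OF GF]] F_\<alpha>[OF x] by simp
  also have "\<dots> = Fm x (Go (Fo x)) (cmp A x x (Go (Fo x)) (\<alpha> x) (a x))"
    using A.center_commute_0[OF a x GF \<alpha>(1)[OF x]] by simp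
  also have "\<dots> = cmp B (Fo x) (Fo x) (FG (Fo x)) (\<beta> (Fo x)) (Fm x x (a x))"
    using F.F_cmp[OF x x GF ax[OF x] h] F_\<alpha>[OF x] by simp
  finally show ?thesis
    using cancel_\<beta>'_\<beta>[OF Fx Fx F.F_hom[OF x x ax[OF x]]] Fx by (simp add: ext_def)
qed

text \<open>A central family commutes with the degree zero isomorphism \<open>\<beta> y\<close>, so
  its value at \<open>y\<close> is recovered from that at \<open>FG y\<close>.\<close>

lemma center_determined:
  assumes b: "b \<in> center B" and c: "c \<in> center B" and eq: "\<And>x. x \<in> Obj A \<Longrightarrow> b (Fo x) = c (Fo x)"
  shows "b = c"
proof
  fix y
  have "d y = cmp B y (FG y) y (\<beta>' y) (cmp B y (FG y) (FG y) (d (FG y)) (\<beta> y))"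
    if "d \<in> center B" "y \<in> Obj B" for d
    using B.center_commute_0[OF that(1,2) FG[OF that(2)] \<beta>[OF that(2)]]
      cancel_\<beta>'_\<beta>[OF that(2,2) B.famD[OF B.center_fam[OF that(1)] that(2)]] by simp
  from this[OF b] this[OF c] show "b y = c y"
    using eq[OF Go] B.fam_outside[OF B.center_fam[OF b]] B.fam_outside[OF B.center_fam[OF c]]
    by (cases "y \<in> Obj B") simp_all
qed

lemma center_map_rel_ext: "a \<in> center A \<Longrightarrow> center_map_rel A B Fo Fm a b \<longleftrightarrow> b = ext a"
  using ext_center ext_F center_determined unfolding center_map_rel_def by metis

lemma center_map_ext: "a \<in> center A \<Longrightarrow> center_map A B Fo Fm a = ext a"
  unfolding center_map_def using center_map_rel_ext by blast

text \<open>Compatibility with products, units, scalars and sums thereby needs checking only at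
  objects \<open>Fo x\<close>, where it is functoriality.\<close>

lemma ext_eqI:
  "a \<in> center A \<Longrightarrow> b \<in> center B \<Longrightarrow> (\<And>x. x \<in> Obj A \<Longrightarrow> b (Fo x) = Fm x x (a x)) \<Longrightarrow> ext a = b"
  using center_determined ext_center ext_F by simp

lemma ext_sum:
  assumes "\<And>i. i \<in> S \<Longrightarrow> c i \<in> center A"
  shows "ext (sum c S) = (\<Sum>i\<in>S. ext (c i))"
proof -
  have "ext 0 = 0"
    by (rule ext_eqI) (use A.W.subspace_0[OF A.center_subspace] B.W.subspace_0[OF B.center_subspace]
        in \<open>auto simp: fun_apply F.F_0\<close>)
  with assms show ?thesis
    by (induction S rule: infinite_finite_induct)
      (auto simp: ext_add A.center_fam A.W.subspace_sum[OF A.center_subspace])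
qed

lemma ext_inj: "inj_on ext (center A)"
\<comment> \<open>The rule \<open>ext\<close> is function extensionality, not a fact about the map
  on centres.\<close>
proof (rule inj_onI, rule ext)
  fix a b x assume a: "a \<in> center A" and b: "b \<in> center A" and eq: "ext a = ext b"
  show "a x = b x"
  proof (cases "x \<in> Obj A")
    case True
    have "Fm x x (a x) = Fm x x (b x)" using ext_F[OF a True] ext_F[OF b True] eq by simp
    then show ?thesis using F_inj[OF True True] A.famD[OF A.center_fam] a b True by blast
  next
    case False
    then show ?thesis using A.fam_outside[OF A.center_fam[OF a]] A.fam_outside[OF A.center_fam[OF b]] by simp
  qed
qed

lemma ext_image_center_deg: "ext ` center_deg A i = center_deg B i"
proof (intro equalityI subsetI)
  fix b assume "b \<in> ext ` center_deg A i"
  then show "b \<in> center_deg B i" using ext_center_deg by blast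
next
  fix b assume b: "b \<in> center_deg B i"
  \<comment> \<open>The only candidate for a preimage; full faithfulness makes it homogeneous, and
    its centrality is reflected from that of \<open>b\<close>.\<close>
  define a where "a = (\<lambda>x. if x \<in> Obj A then Finv x x (b (Fo x)) else 0)"
  have bF: "b (Fo x) \<in> Hom_deg B (Fo x) (Fo x) i" "b (Fo x) \<in> Hom B (Fo x) (Fo x)" if "x \<in> Obj A" for x
    using B.fdegD[OF B.center_deg_fdeg[OF b]] B.famD[OF B.center_deg_fam[OF b]] F.F_obj that by blast+
  have Fa: "Fm x x (a x) = b (Fo x)" if "x \<in> Obj A" for x
    using that F_Finv bF by (simp add: a_def)
  have a_fdeg: "a \<in> A.fdeg i" using Finv_deg bF by (simp add: a_def A.fdeg_def)
  have "a \<in> center_deg A i"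
    unfolding A.center_deg_iff
  proof (intro conjI ballI allI)
    fix x y j f assume xy: "x \<in> Obj A" "y \<in> Obj A" and f: "f \<in> Hom_deg A x y j"
    note fh = A.deg_hom[OF xy f] and ah = A.famD[OF A.fdeg_fam[OF a_fdeg]]
    note af = A.cmp_hom[OF xy xy(2) fh ah[OF xy(2)]]
    show "cmp A x x y f (a x) = scl A (koszul i j) (cmp A x y y (a y) f)"
    proof (rule F_inj[OF xy A.cmp_hom[OF xy(1) xy ah[OF xy(1)] fh] A.hom_scl[OF xy af]])
      show "Fm x y (cmp A x x y f (a x)) = Fm x y (scl A (koszul i j) (cmp A x y y (a y) f))"
        using F.F_cmp[OF xy(1) xy ah[OF xy(1)] fh] F.F_cmp[OF xy xy(2) fh ah[OF xy(2)]] F.F_scl[OF xy af]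
          B.center_deg_commute[OF b F.F_obj[OF xy(1)] F.F_obj[OF xy(2)] F.F_deg[OF xy f]] Fa xy by simp
    qed
  qed (rule a_fdeg)
  moreover from this have "ext a = b"
    using ext_eqI[OF A.center_deg_center B.center_deg_center[OF b]] Fa by simp
  ultimately show "b \<in> ext ` center_deg A i" by blast
qed

lemma ext_image_center: "ext ` center A = center B"
  unfolding center_def
proof (rule graded_sum_image)
  show "ext (sum c S) = (\<Sum>i\<in>S. ext (c i))" if "\<And>i. i \<in> S \<Longrightarrow> c i \<in> center_deg A i" for S c
    using ext_sum[of S c] that A.center_deg_center by blast
qed (rule ext_image_center_deg A.W.subspace_0[OF A.center_deg_subspace]
    B.W.subspace_0[OF B.center_deg_subspace])+

text \<open>Both inclusions come from \<open>Krs_deg_transfer\<close>, once along \<open>F\<close>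
  and once along the quasi-inverse. The second use requires that the preimage \<open>a\<close>
  corresponds to \<open>b\<close> under \<open>Gm\<close>.\<close>

lemma ext_image_Krs_deg: "ext ` Krs_deg A p r t n = Krs_deg B p r t n"
proof (intro equalityI subsetI)
  fix b assume "b \<in> ext ` Krs_deg A p r t n"
  then obtain a where a: "a \<in> Krs_deg A p r t n" "b = ext a" by blast
  then have ac: "a \<in> center_deg A n" using A.Krs_deg_center_deg by blast
  show "b \<in> Krs_deg B p r t n"
    using graded_functor_section.Krs_deg_transfer[OF F_section a(1) ext_center_deg[OF ac]]
      ext_F[OF A.center_deg_center[OF ac]] a(2) by simp
next
  fix b assume b: "b \<in> Krs_deg B p r t n"
  then have bc: "b \<in> center_deg B n" using B.Krs_deg_center_deg by blast
  then obtain a where a: "a \<in> center_deg A n" "b = ext a" using ext_image_center_deg by blast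
  have "a (Go y) = Gm y y (b y)" if y: "y \<in> Obj B" for y
  proof (rule Gm_eqI[symmetric, OF y y])
    note by_hom = B.famD[OF B.center_deg_fam[OF bc]]
    show "b y \<in> Hom B y y" by (rule by_hom[OF y])
    show "a (Go y) \<in> Hom A (Go y) (Go y)" by (rule A.famD[OF A.center_deg_fam[OF a(1)] Go[OF y]])
    \<comment> \<open>Since \<open>b\<close> commutes with \<open>\<beta> y\<close>, its conjugate
      at \<open>y\<close> is its value at \<open>FG y\<close>, which is the image of
      \<open>a (Go y)\<close>.\<close>
    have "conj y y (b y) = cmp B (FG y) y (FG y) (cmp B y y (FG y) (\<beta> y) (b y)) (\<beta>' y)"
      unfolding conj_def using B.cmp_assoc[OF FG[OF y] y y FG[OF y] \<beta>'_hom[OF y] by_hom[OF y] \<beta>_hom[OF y]] by simp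
    also have "\<dots> = cmp B (FG y) y (FG y) (cmp B y (FG y) (FG y) (b (FG y)) (\<beta> y)) (\<beta>' y)"
      using B.center_commute_0[OF B.center_deg_center[OF bc] y FG[OF y] \<beta>[OF y]] by simp
    also have "\<dots> = b (FG y)"
      using B.cmp_assoc[OF FG[OF y] y FG[OF y] FG[OF y] \<beta>'_hom[OF y] \<beta>_hom[OF y] by_hom[OF FG[OF y]]]
        inverse(2)[OF y] B.cmp_idn_right[OF FG[OF y] FG[OF y] by_hom[OF FG[OF y]]] by simp
    finally show "Fm (Go y) (Go y) (a (Go y)) = conj y y (b y)"
      using ext_F[OF A.center_deg_center[OF a(1)] Go[OF y]] a(2) by simp
  qed
  then have "a \<in> Krs_deg A p r t n"
    using graded_functor_section.Krs_deg_transfer[OF G_section b a(1)] by blast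
  then show "b \<in> ext ` Krs_deg A p r t n" using a(2) by blast
qed

lemma ext_image_Krs: "ext ` Krs A p r t = Krs B p r t"
  unfolding Krs_def
proof (rule graded_sum_image)
  show "ext (sum c S) = (\<Sum>i\<in>S. ext (c i))" if "\<And>i. i \<in> S \<Longrightarrow> c i \<in> Krs_deg A p r t i" for S c
    using ext_sum[of S c] that A.center_deg_center A.Krs_deg_center_deg by blast
qed (rule ext_image_Krs_deg A.W.subspace_0[OF A.Krs_deg_subspace]
    B.W.subspace_0[OF B.Krs_deg_subspace])+

lemma center_map_iso:
  "graded_algebra_iso (fscl A) (center_deg A) (center_ring A) (fscl B) (center_deg B) (center_ring B)
    (center_map A B Fo Fm)"
proof -
  let ?h = "center_map A B Fo Fm"
  have image: "?h ` S = ext ` S" if "S \<subseteq> center A" for S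
    using that center_map_ext by (intro image_cong) auto
  have mult: "ext (fmult A a b) = fmult B (ext a) (ext b)" if "a \<in> center A" "b \<in> center A" for a b
  proof (rule ext_eqI)
    fix x assume x: "x \<in> Obj A"
    show "fmult B (ext a) (ext b) (Fo x) = Fm x x (fmult A a b x)"
      using x F.F_obj[OF x] ext_F[OF that(1) x] ext_F[OF that(2) x]
        F.F_cmp[OF x x x] A.famD[OF A.center_fam] that by (simp add: fmult_def)
  qed (use that A.center_mult B.center_mult ext_center in auto)
  have one: "ext (fone A) = fone B"
    by (rule ext_eqI) (use A.center_deg_center[OF A.fone_center] B.center_deg_center[OF B.fone_center]
        F.F_obj F.F_idn in \<open>auto simp: fone_def\<close>)
  have scl: "ext (fscl A c a) = fscl B c (ext a)" if "a \<in> center A" for c a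
    by (rule ext_eqI) (use that A.W.subspace_scale[OF A.center_subspace] ext_F A.famD[OF A.center_fam]
        B.W.subspace_scale[OF B.center_subspace] ext_center F.F_scl in
        \<open>auto simp: A.fscl_apply B.fscl_apply\<close>)
  have "?h \<in> ring_iso (center_ring A) (center_ring B)"
  proof (rule ring_iso_memI)
    show "bij_betw ?h (carrier (center_ring A)) (carrier (center_ring B))"
      using ext_inj ext_image_center center_map_ext
      by (simp add: bij_betw_def inj_on_def image)
  qed (use center_map_ext A.center_mult mult one ext_center ext_add A.center_fam
      A.W.subspace_add[OF A.center_subspace] A.center_deg_center[OF A.fone_center] in auto)
  moreover have "?h ` center_deg A i = center_deg B i" for i
  proof -
    have "center_deg A i \<subseteq> center A" using A.center_deg_center by blast
    then show ?thesis using image ext_image_center_deg by simp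
  qed
  ultimately show ?thesis
    using center_map_ext scl A.W.subspace_scale[OF A.center_subspace]
    by (simp add: graded_algebra_iso_def)
qed

lemma center_map_Krs: "center_map A B Fo Fm ` Krs A p r t = Krs B p r t"
proof -
  have "Krs A p r t \<subseteq> center A"
    unfolding Krs_def center_def by (rule graded_sum_mono) (rule A.Krs_deg_center_deg)
  then have "center_map A B Fo Fm ` Krs A p r t = ext ` Krs A p r t"
    using center_map_ext by (intro image_cong) auto
  then show ?thesis using ext_image_Krs by simp
qed

end

theorem theorem3p3:
  fixes A :: "('k::field, 'o, 'm::ab_group_add) gcat"
    and p :: nat and s :: int
  assumes "CHAR('k) = p" and "p > 0"
    and "graded_category A"
  shows
    "graded_algebra (fscl A) (center_deg A) (center_ring A) \<and>
     (center A = Krs A p 0 s \<and>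
      (\<forall>r. Krs A p (Suc r) s \<subseteq> Krs A p r s) \<and>
      (\<forall>r. Rs A p s \<subseteq> Krs A p r s) \<and>
      (\<forall>r. graded_ideal (fscl A) (center_deg A) (center_ring A) (Krs A p r s)) \<and>
      graded_ideal (fscl A) (center_deg A) (center_ring A) (Rs A p s)) \<and>
     (center A = Kr A p 0 \<and>
      (\<forall>r. Kr A p (Suc r) \<subseteq> Kr A p r) \<and>
      (\<forall>r. Rinf A p \<subseteq> Kr A p r) \<and>
      (\<forall>r. graded_ideal (fscl A) (center_deg A) (center_ring A) (Kr A p r)) \<and>
      graded_ideal (fscl A) (center_deg A) (center_ring A) (Rinf A p)) \<and>
     (\<forall>(A' :: ('k, 'o2, 'm2::ab_group_add) gcat) Fo Fm.
        graded_category A' \<and> degree_preserving_equivalence A A' Fo Fm \<longrightarrow>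
        (\<forall>a\<in>center A. \<exists>!b. center_map_rel A A' Fo Fm a b) \<and>
        graded_algebra_iso (fscl A) (center_deg A) (center_ring A)
          (fscl A') (center_deg A') (center_ring A') (center_map A A' Fo Fm) \<and>
        (\<forall>r t. center_map A A' Fo Fm ` Krs A p r t = Krs A' p r t))"
proof -
  interpret A: graded_cat_char A p by unfold_locales (use assms in auto)
  have Kr: "graded_ideal (fscl A) (center_deg A) (center_ring A) (Kr A p r)" for r
    unfolding Kr_def by (rule A.graded_ideal_INT) (rule A.graded_ideal_Krs)
  have Rs: "graded_ideal (fscl A) (center_deg A) (center_ring A) (Rs A p s)"
    unfolding Rs_def by (rule A.graded_ideal_INT) (rule A.graded_ideal_Krs)
  have Rinf: "graded_ideal (fscl A) (center_deg A) (center_ring A) (Rinf A p)"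
    unfolding Rinf_def by (rule A.graded_ideal_INT) (rule Kr)
  have equiv: "(\<forall>a\<in>center A. \<exists>!b. center_map_rel A A' Fo Fm a b) \<and>
      graded_algebra_iso (fscl A) (center_deg A) (center_ring A)
        (fscl A') (center_deg A') (center_ring A') (center_map A A' Fo Fm) \<and>
      (\<forall>r t. center_map A A' Fo Fm ` Krs A p r t = Krs A' p r t)"
    if A': "graded_category A'" and F: "degree_preserving_equivalence A A' Fo Fm"
    for A' :: "('k, 'o2, 'm2) gcat" and Fo Fm
  proof -
    interpret B: graded_cat_char A' p by unfold_locales (use assms A' in auto)
    have "\<exists>x b b'. x \<in> Obj A \<and> b \<in> Hom_deg A' y (Fo x) 0 \<and> b' \<in> Hom_deg A' (Fo x) y 0 \<and>
        cmp A' y (Fo x) y b' b = idn A' y \<and> cmp A' (Fo x) y (Fo x) b b' = idn A' (Fo x)"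
      if y: "y \<in> Obj A'" for y
    proof -
      obtain x b where x: "x \<in> Obj A" and b: "b \<in> Hom_deg A' y (Fo x) 0" "is_isomorphism A' y (Fo x) b"
        using F y unfolding degree_preserving_equivalence_def by blast
      have "Fo x \<in> Obj A'"
        using F x by (simp add: degree_preserving_equivalence_def is_functor_def)
      \<comment> \<open>An isomorphism of degree zero has its inverse in degree zero, which makes
        \<open>\<beta>'\<close> homogeneous as well.\<close>
      from B.inverse_deg[OF y this b] show ?thesis using x b(1) by metis
    qed
    then obtain Go \<beta> \<beta>' where "\<And>y. y \<in> Obj A' \<Longrightarrow> Go y \<in> Obj A \<and>
        \<beta> y \<in> Hom_deg A' y (Fo (Go y)) 0 \<and> \<beta>' y \<in> Hom_deg A' (Fo (Go y)) y 0 \<and>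
        cmp A' y (Fo (Go y)) y (\<beta>' y) (\<beta> y) = idn A' y \<and>
        cmp A' (Fo (Go y)) y (Fo (Go y)) (\<beta> y) (\<beta>' y) = idn A' (Fo (Go y))"
      by metis
    then interpret graded_equivalence A A' p Fo Fm Go \<beta> \<beta>'
      by unfold_locales (use F in auto)
    show ?thesis using center_map_rel_ext center_map_iso center_map_Krs by auto
  qed
  show ?thesis
  proof (intro conjI allI impI)
    show "Kr A p (Suc r) \<subseteq> Kr A p r" for r
      unfolding Kr_def using A.Krs_Suc by blast
    show "center A = Kr A p 0" by (simp add: Kr_def A.Krs_0)
    show "Rs A p s \<subseteq> Krs A p r s" "Rinf A p \<subseteq> Kr A p r" for r
      unfolding Rs_def Rinf_def by blast+
  qed (use A.graded_algebra_center A.Krs_0 A.Krs_Suc A.graded_ideal_Krs Kr Rs Rinf equiv in blast)+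
qed

end
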